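(* Let $R_0>1$ be fixed, and let $u\in\dot H^1(\mathbb{R}^3)$ (a vector field with values in $\mathbb{R}^3$) be a solution of the stationary Navier--Stokes equations $$-\Delta u+u\cdot\nabla u+\nabla P=0,\qquad \nabla\cdot u=0\qquad\text{in }\mathbb{R}^3 .$$ Let $p:\mathbb{R}^3\to\mathbb{R}$ be a variable exponent such that: (1) $p(x)=6$ for all $x\in B(0,R_0)$; (2) $p$ is Lipschitz, radially decreasing, and satisfies $p(x)\ge\frac92$ for all $x\in\mathbb{R}^3$; (3) there exists a constant $C\in[0,R_0^2)$ such that $\left|p(x)-\frac92\right|\le\frac{C}{|x|}$ for all $|x|\ge R_0^2$. If in addition $u\in L^{p(\cdot)}(\mathbb{R}^3)$, then $u\equiv 0$.
   Context: A vector field $u$ is called a solution of the stationary Navier--Stokes equations if there is an associated scalar pressure $P$ on $\mathbb{R}^3$ such that both equations hold in the sense of distributions. The homogeneous Sobolev space $\dot H^1(\mathbb{R}^3)$ is understood with the convention that the Sobolev embedding $\dot H^1(\mathbb{R}^3)\subset L^6(\mathbb{R}^3)$ holds; that is, $u\in L^6(\mathbb{R}^3)$ and $\nabla u\in L^2(\mathbb{R}^3)$. "Radially decreasing" means that $p(x)=\tilde p(|x|)$ for a (not necessarily strictly) decreasing function $\tilde p$ on $[0,\infty)$. $B(0,R_0)$ is the ball of radius $R_0$ centered at the origin. Variable exponent Lebesgue spaces: for a domain $\Omega\subseteq\mathbb{R}^n$ and a measurable $p(\cdot):\Omega\to[1,+\infty)$ with $1<\operatorname{ess\,inf}_\Omega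 p\le\operatorname{ess\,sup}_\Omega p<+\infty$, the space $L^{p(\cdot)}(\Omega)$ is the set of measurable functions $u$ on $\Omega$ such that $$\|u\|_{L^{p(\cdot)}(\Omega)}:=\inf\Big\{\lambda>0:\ \int_\Omega \Big|\frac{u(x)}{\lambda}\Big|^{p(x)}dx\le 1\Big\}<+\infty ,$$ with the convention that the infimum of the empty set is $+\infty$. *)

theory Defs
  imports "HOL-Analysis.Analysis" "HOL-Probability.Essential_Supremum"
begin

section \<open>Test functions and distributions\<close>

definition partial_deriv :: "'n::finite \<Rightarrow> (real^'n \<Rightarrow> real) \<Rightarrow> real^'n \<Rightarrow> real" where
  "partial_deriv i f = (\<lambda>x. frechet_derivative f (at x) (axis i 1))"

definition iter_partial :: "'n::finite list \<Rightarrow> (real^'n \<Rightarrow> real) \<Rightarrow> real^'n \<Rightarrow> real" where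
  "iter_partial is f = foldr partial_deriv is f"

text \<open>Differentiability of all iterated partial derivatives makes them all continuous, so this
  is the class of \<open>C\<^sup>\<infinity>\<close> functions.\<close>

definition smooth :: "(real^'n::finite \<Rightarrow> real) \<Rightarrow> bool" where
  "smooth f \<longleftrightarrow> (\<forall>is x. iter_partial is f differentiable (at x))"

definition test_function :: "(real^'n::finite \<Rightarrow> real) \<Rightarrow> bool" where
  "test_function \<phi> \<longleftrightarrow> smooth \<phi> \<and> compact (closure {x. \<phi> x \<noteq> 0})"

text \<open>Distributions are represented by functionals on all functions; only their values on test
  functions are meaningful. Continuity is expressed by the usual seminorm estimates, where
  lists of indices of length at most \<open>N\<close> play the role of multi-indices of order at most \<open>N\<close>.\<close>

definition distribution :: "((real^'n::finite \<Rightarrow> real) \<Rightarrow> real) \<Rightarrow> bool" where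
  "distribution T \<longleftrightarrow>
     (\<forall>\<phi> \<psi>. test_function \<phi> \<longrightarrow> test_function \<psi> \<longrightarrow> T (\<lambda>x. \<phi> x + \<psi> x) = T \<phi> + T \<psi>) \<and>
     (\<forall>c \<phi>. test_function \<phi> \<longrightarrow> T (\<lambda>x. c * \<phi> x) = c * T \<phi>) \<and>
     (\<forall>K. compact K \<longrightarrow>
        (\<exists>C N. \<forall>\<phi>. test_function \<phi> \<longrightarrow> closure {x. \<phi> x \<noteq> 0} \<subseteq> K \<longrightarrow>
           \<bar>T \<phi>\<bar> \<le> C * (\<Sum>is\<in>{is. length is \<le> N}. SUP x. \<bar>iter_partial is \<phi> x\<bar>)))"

definition locally_integrable :: "(real^'n::finite \<Rightarrow> real) \<Rightarrow> bool" where
  "locally_integrable f \<longleftrightarrow> (\<forall>K. compact K \<longrightarrow> f absolutely_integrable_on K)"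

definition dist_of :: "(real^'n::finite \<Rightarrow> real) \<Rightarrow> (real^'n \<Rightarrow> real) \<Rightarrow> real" where
  "dist_of f = (\<lambda>\<phi>. LINT x|lebesgue. f x * \<phi> x)"

definition dist_deriv ::
    "'n::finite \<Rightarrow> ((real^'n \<Rightarrow> real) \<Rightarrow> real) \<Rightarrow> (real^'n \<Rightarrow> real) \<Rightarrow> real" where
  "dist_deriv i T = (\<lambda>\<phi>. - T (partial_deriv i \<phi>))"

definition dist_laplacian ::
    "((real^'n::finite \<Rightarrow> real) \<Rightarrow> real) \<Rightarrow> (real^'n \<Rightarrow> real) \<Rightarrow> real" where
  "dist_laplacian T = (\<lambda>\<phi>. \<Sum>i\<in>UNIV. dist_deriv i (dist_deriv i T) \<phi>)"

section \<open>Function spaces\<close>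

text \<open>Functions are representatives of their almost-everywhere classes. The Jacobian convention is
  \<open>G x $ i $ j = \<partial>\<^sub>j u\<^sub>i (x)\<close>; the norm of \<open>G x\<close> is then the Frobenius norm.\<close>

definition weak_gradient ::
    "(real^'n::finite \<Rightarrow> real^'m::finite) \<Rightarrow> (real^'n \<Rightarrow> real^'n^'m) \<Rightarrow> bool" where
  "weak_gradient u G \<longleftrightarrow>
     (\<forall>i. locally_integrable (\<lambda>x. u x $ i)) \<and>
     (\<forall>i j. locally_integrable (\<lambda>x. G x $ i $ j)) \<and>
     (\<forall>i j \<phi>. test_function \<phi> \<longrightarrow>
        dist_deriv j (dist_of (\<lambda>x. u x $ i)) \<phi> = dist_of (\<lambda>x. G x $ i $ j) \<phi>)"

definition in_Lebesgue_space ::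
    "real \<Rightarrow> ('a::euclidean_space \<Rightarrow> 'b::euclidean_space) \<Rightarrow> bool" where
  "in_Lebesgue_space q f \<longleftrightarrow>
     f \<in> borel_measurable lebesgue \<and> integrable lebesgue (\<lambda>x. norm (f x) powr q)"

text \<open>The exponent 6 is the Sobolev exponent of dimension 3.\<close>

definition homogeneous_H1 :: "(real^3 \<Rightarrow> real^3) \<Rightarrow> bool" where
  "homogeneous_H1 u \<longleftrightarrow>
     in_Lebesgue_space 6 u \<and> (\<exists>G. weak_gradient u G \<and> in_Lebesgue_space 2 G)"

text \<open>The essential infimum of \<open>p\<close> is minus the essential supremum of \<open>-p\<close>.\<close>

definition variable_exponent :: "'a::euclidean_space set \<Rightarrow> ('a \<Rightarrow> real) \<Rightarrow> bool" where
  "variable_exponent \<Omega> p \<longleftrightarrow>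
     p \<in> borel_measurable (lebesgue_on \<Omega>) \<and> (\<forall>x\<in>\<Omega>. 1 \<le> p x) \<and>
     1 < - esssup (lebesgue_on \<Omega>) (\<lambda>x. - ereal (p x)) \<and>
     esssup (lebesgue_on \<Omega>) (\<lambda>x. ereal (p x)) < \<infinity>"

text \<open>In \<open>ereal\<close> the infimum of the empty set is \<open>\<infinity>\<close>.\<close>

definition var_Lebesgue_norm ::
    "'a::euclidean_space set \<Rightarrow> ('a \<Rightarrow> real) \<Rightarrow> ('a \<Rightarrow> 'b::euclidean_space) \<Rightarrow> ereal" where
  "var_Lebesgue_norm \<Omega> p u =
     Inf (ereal ` {l. l > 0 \<and>
       (\<integral>\<^sup>+ x. ennreal (norm (u x /\<^sub>R l) powr p x) \<partial>lebesgue_on \<Omega>) \<le> 1})"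

definition in_var_Lebesgue_space ::
    "'a::euclidean_space set \<Rightarrow> ('a \<Rightarrow> real) \<Rightarrow> ('a \<Rightarrow> 'b::euclidean_space) \<Rightarrow> bool" where
  "in_var_Lebesgue_space \<Omega> p u \<longleftrightarrow>
     u \<in> borel_measurable (lebesgue_on \<Omega>) \<and> var_Lebesgue_norm \<Omega> p u < \<infinity>"

definition radially_decreasing :: "('a::euclidean_space \<Rightarrow> real) \<Rightarrow> bool" where
  "radially_decreasing p \<longleftrightarrow>
     (\<exists>q :: real \<Rightarrow> real. antimono_on {0..} q \<and> (\<forall>x. p x = q (norm x)))"

section \<open>Stationary Navier--Stokes equations\<close>

text \<open>With the above Jacobian convention \<open>u \<cdot> \<nabla>u\<close> is \<open>G x *v u x\<close>. Its local integrability,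
  needed for it to be a distribution, is automatic for \<open>u \<in> L\<^sup>6\<close>, \<open>G \<in> L\<^sup>2\<close>. The pressure is an
  arbitrary distribution.\<close>

definition stationary_NS_solution :: "(real^3 \<Rightarrow> real^3) \<Rightarrow> bool" where
  "stationary_NS_solution u \<longleftrightarrow>
     (\<exists>G P. weak_gradient u G \<and> (\<forall>i. locally_integrable (\<lambda>x. (G x *v u x) $ i)) \<and>
        distribution P \<and>
        (\<forall>i \<phi>. test_function \<phi> \<longrightarrow>
           - dist_laplacian (dist_of (\<lambda>x. u x $ i)) \<phi>
           + dist_of (\<lambda>x. (G x *v u x) $ i) \<phi> + dist_deriv i P \<phi> = 0) \<and>
        (\<forall>\<phi>. test_function \<phi> \<longrightarrow>
           (\<Sum>i\<in>UNIV. dist_deriv i (dist_of (\<lambda>x. u x $ i)) \<phi>) = 0))"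

end

theory Submission
  imports Defs "HOL-Computational_Algebra.Polynomial"
begin

text \<open>
  The assumptions imply \<open>u \<in> L\<^sup>9\<^sup>/\<^sup>2\<close> (\<open>integrable_powr_nine_halves\<close>). Near the origin this follows
  from \<open>u \<in> L\<^sup>6\<close>. At infinity \<open>p - 9/2 \<le> C/|x|\<close>, so that \<open>|u| powr (9/2) \<le> exp C * |u| powr p\<close> where
  \<open>|u| \<ge> exp (-|x|)\<close>, and where \<open>|u| < exp (-|x|)\<close> the function decays anyway; here \<open>u\<close> is first divided
  by a constant that makes the modular of the variable exponent finite. It remains to prove Galdi's
  theorem that a solution in \<open>L\<^sup>9\<^sup>/\<^sup>2\<close> with \<open>\<nabla>u \<in> L\<^sup>2\<close> vanishes.

  The usual proof tests the equation with \<open>\<phi> u\<close>, where \<open>\<phi>\<close> is a cutoff at radius \<open>R\<close>, and bounds the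
  pressure in \<open>L\<^sup>9\<^sup>/\<^sup>4\<close> by the Calderon-Zygmund theorem. Here the pressure is an arbitrary distribution
  and \<open>u\<close> is not known to be smooth, so the test field is replaced by a smooth, compactly supported
  and divergence-free one, which eliminates the pressure (\<open>tested_momentum\<close>). Let \<open>\<eta>\<^sub>r\<close> be a radial
  mollifier at scale \<open>r\<close>. Since the derivative of \<open>\<eta>\<^sub>r\<close> in \<open>r\<close> is the Laplacian of a compactly supported
  function, there is a test function \<open>K\<close> with \<open>\<Delta>K = \<eta>\<^sub>R - \<eta>\<^sub>a\<close> (\<open>laplacian_potential\<close>). With
  \<open>f = \<nabla>\<phi> \<cdot> u = div (\<phi> u)\<close>, the field \<open>W = \<eta>\<^sub>a * (\<phi> u) - \<eta>\<^sub>R * (\<phi> u) + \<nabla> (K * f)\<close> has all the required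
  properties. As \<open>a \<rightarrow> 0\<close> its first part gives the energy balance of \<open>\<phi> u\<close>; the other two parts
  are errors that are bounded uniformly in \<open>a\<close>.

  The gradient of \<open>\<nabla> (K * f)\<close> is estimated in \<open>L\<^sup>2\<close> only, by integration by parts
  (\<open>integral_hessian_squared\<close>). This is enough: all integrals are over balls of radius comparable to
  \<open>R\<close>, so \<open>u \<otimes> u\<close> may be measured in \<open>L\<^sup>2\<close> instead of \<open>L\<^sup>9\<^sup>/\<^sup>4\<close>, and Hoelder's inequality yields the same
  power of \<open>R\<close>. All errors are controlled by the Dirichlet integral and by the integrals of \<open>|u|\<^sup>q\<close> over such
  balls with \<open>1 \<le> q \<le> 4\<close>; divided by \<open>R powr (3 - 2 q / 3)\<close> the latter tend to zero because \<open>q < 9/2\<close> (\<open>scaled_average_tendsto_zero\<close>). Hence the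
  Dirichlet integral vanishes (\<open>energy_inequality\<close>, \<open>error_tendsto_zero\<close>), \<open>u\<close> is constant, and \<open>u = 0\<close> as
  \<open>u \<in> L\<^sup>6\<close>.
\<close>

section \<open>Calculus of smooth functions and test functions\<close>

text \<open>Peeling off the innermost derivative makes the product and chain rules provable by induction:
  they express a derivative of a product or composition through functions that are
  differentiable one time less.\<close>

primrec times_differentiable :: "nat \<Rightarrow> (real^'n::finite \<Rightarrow> real) \<Rightarrow> bool" where
  "times_differentiable 0 f \<longleftrightarrow> True"
| "times_differentiable (Suc n) f \<longleftrightarrow>
     (\<forall>x. f differentiable (at x)) \<and> (\<forall>i. times_differentiable n (partial_deriv i f))"

lemma times_differentiable_iff:
  "times_differentiable n f \<longleftrightarrow> (\<forall>is x. length is < n \<longrightarrow> iter_partial is f differentiable (at x))"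
proof (induction n arbitrary: f)
  case 0
  then show ?case by simp
next
  case (Suc n)
  have snoc: "iter_partial (js @ [j]) f = iter_partial js (partial_deriv j f)" for js j
    by (simp add: iter_partial_def)
  have nil: "iter_partial [] f = f" by (simp add: iter_partial_def)
  show ?case
  proof
    assume L: "times_differentiable (Suc n) f"
    show "\<forall>is x. length is < Suc n \<longrightarrow> iter_partial is f differentiable (at x)"
    proof (intro allI impI)
      fix "is" :: "'a list" and x assume "length is < Suc n"
      then show "iter_partial is f differentiable (at x)"
        using L Suc.IH by (cases "is" rule: rev_cases) (auto simp: nil snoc)
    qed
  next
    assume R: "\<forall>is x. length is < Suc n \<longrightarrow> iter_partial is f differentiable (at x)"
    have "f differentiable (at x)" for x using R[rule_format, of "[]" x] by (simp add: nil)
    moreover have "times_differentiable n (partial_deriv i f)" for i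
      unfolding Suc.IH using R[rule_format, of "_ @ [i]"] by (auto simp: snoc)
    ultimately show "times_differentiable (Suc n) f" by simp
  qed
qed

lemma smooth_iff_times_differentiable: "smooth f \<longleftrightarrow> (\<forall>n. times_differentiable n f)"
  unfolding smooth_def times_differentiable_iff by (meson lessI)

lemma smooth_partial_deriv: "smooth f \<Longrightarrow> smooth (partial_deriv i f)"
  unfolding smooth_iff_times_differentiable by (metis times_differentiable.simps(2))

lemma smooth_differentiable: "smooth f \<Longrightarrow> f differentiable (at x)"
  unfolding smooth_iff_times_differentiable by (metis times_differentiable.simps(2))

lemma smooth_continuous: "smooth f \<Longrightarrow> continuous_on S f"
  by (meson smooth_differentiable continuous_at_imp_continuous_on differentiable_imp_continuous_within)

lemma times_differentiable_mono: "times_differentiable n f \<Longrightarrow> m \<le> n \<Longrightarrow> times_differentiable m f"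
  unfolding times_differentiable_iff by auto

lemma has_derivative_imp_partial_deriv:
  "(f has_derivative f') (at x) \<Longrightarrow> partial_deriv i f x = f' (axis i 1)"
  unfolding partial_deriv_def by (metis frechet_derivative_at)

lemma differentiable_has_derivative_partial:
  assumes "f differentiable (at (x::real^'n::finite))"
  shows "(f has_derivative (\<lambda>h. \<Sum>i\<in>UNIV. h $ i * partial_deriv i f x)) (at x)"
proof -
  have d: "(f has_derivative frechet_derivative f (at x)) (at x)"
    using assms frechet_derivative_works by blast
  then have l: "linear (frechet_derivative f (at x))" by (rule has_derivative_linear)
  have "frechet_derivative f (at x) = (\<lambda>h. \<Sum>i\<in>UNIV. h $ i * partial_deriv i f x)"
  proof
    fix h
    have "frechet_derivative f (at x) h = frechet_derivative f (at x) (\<Sum>i\<in>UNIV. (h $ i) *\<^sub>R axis i 1)"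
      by (simp add: basis_expansion flip: scalar_mult_eq_scaleR)
    also have "\<dots> = (\<Sum>i\<in>UNIV. h $ i * partial_deriv i f x)"
      by (simp add: linear_sum[OF l] linear_scale[OF l] partial_deriv_def)
    finally show "frechet_derivative f (at x) h = (\<Sum>i\<in>UNIV. h $ i * partial_deriv i f x)" .
  qed
  with d show ?thesis by simp
qed

lemma partial_deriv_const: "partial_deriv i (\<lambda>x. c) = (\<lambda>x. 0)"
  by (rule ext, rule has_derivative_imp_partial_deriv[where f'="\<lambda>h. 0"]) simp

lemma partial_deriv_add:
  assumes "\<And>x. f differentiable (at x)" "\<And>x. g differentiable (at x)"
  shows "partial_deriv i (\<lambda>x. f x + g x) = (\<lambda>x. partial_deriv i f x + partial_deriv i g x)"
  using has_derivative_imp_partial_deriv[OF has_derivative_add[OF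
        assms(1)[unfolded frechet_derivative_works] assms(2)[unfolded frechet_derivative_works]]]
  by (simp add: fun_eq_iff partial_deriv_def)

lemma partial_deriv_mult:
  assumes "\<And>x. f differentiable (at x)" "\<And>x. g differentiable (at x)"
  shows "partial_deriv i (\<lambda>x. f x * g x) = (\<lambda>x. f x * partial_deriv i g x + partial_deriv i f x * g x)"
  using has_derivative_imp_partial_deriv[OF has_derivative_mult[OF
        assms(1)[unfolded frechet_derivative_works] assms(2)[unfolded frechet_derivative_works]]]
  by (simp add: fun_eq_iff partial_deriv_def)

lemma partial_deriv_compose:
  assumes "\<And>x. f differentiable (at x)" "\<And>s. (h has_real_derivative h' s) (at s)"
  shows "partial_deriv i (\<lambda>x. h (f x)) = (\<lambda>x. h' (f x) * partial_deriv i f x)"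
  using has_derivative_imp_partial_deriv[OF has_derivative_compose[OF
        assms(1)[unfolded frechet_derivative_works] assms(2)[unfolded has_field_derivative_def]]]
  by (simp add: fun_eq_iff partial_deriv_def)

lemma partial_deriv_affine:
  fixes f :: "real^'n::finite \<Rightarrow> real"
  assumes "\<And>x. f differentiable (at x)"
  shows "partial_deriv i (\<lambda>x. f (a + c *\<^sub>R x)) = (\<lambda>x. c * partial_deriv i f (a + c *\<^sub>R x))"
proof
  fix x
  have "((\<lambda>x. a + c *\<^sub>R x) has_derivative (\<lambda>h. c *\<^sub>R h)) (at x)"
    by (auto intro!: derivative_eq_intros)
  from has_derivative_compose[OF this differentiable_has_derivative_partial[OF assms]]
  have "((\<lambda>x. f (a + c *\<^sub>R x)) has_derivative
      (\<lambda>h. \<Sum>j\<in>UNIV. (c *\<^sub>R h) $ j * partial_deriv j f (a + c *\<^sub>R x))) (at x)" .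
  from has_derivative_imp_partial_deriv[OF this]
  show "partial_deriv i (\<lambda>x. f (a + c *\<^sub>R x)) x = c * partial_deriv i f (a + c *\<^sub>R x)"
    by (simp add: axis_def mult_ac if_distrib[where f="\<lambda>z. z * _"] if_distrib[where f="\<lambda>z. _ * z"] cong: if_cong)
qed

lemma smooth_const: "smooth (\<lambda>x::real^'n::finite. c)"
proof -
  have "times_differentiable n (\<lambda>x::real^'n. c)" for n c
    by (induction n arbitrary: c) (auto simp: partial_deriv_const)
  then show ?thesis by (simp add: smooth_iff_times_differentiable)
qed

lemma times_differentiable_add:
  "times_differentiable n f \<Longrightarrow> times_differentiable n g \<Longrightarrow> times_differentiable n (\<lambda>x. f x + g x)"
  by (induction n arbitrary: f g) (simp_all add: partial_deriv_add differentiable_add)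

lemma times_differentiable_mult:
  "times_differentiable n f \<Longrightarrow> times_differentiable n g \<Longrightarrow> times_differentiable n (\<lambda>x. f x * g x)"
proof (induction n arbitrary: f g)
  case (Suc n)
  have "times_differentiable n f" "times_differentiable n g"
    using Suc.prems times_differentiable_mono[of "Suc n" _ n] by auto
  with Suc show ?case by (simp add: partial_deriv_mult differentiable_mult times_differentiable_add)
qed simp

lemma smooth_add: "smooth f \<Longrightarrow> smooth g \<Longrightarrow> smooth (\<lambda>x. f x + g x)"
  by (simp add: smooth_iff_times_differentiable times_differentiable_add)

lemma smooth_mult: "smooth f \<Longrightarrow> smooth g \<Longrightarrow> smooth (\<lambda>x. f x * g x)"
  by (simp add: smooth_iff_times_differentiable times_differentiable_mult)

lemma smooth_cmult: "smooth f \<Longrightarrow> smooth (\<lambda>x. c * f x)"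
  by (intro smooth_mult smooth_const)

lemma smooth_sum: "finite A \<Longrightarrow> (\<And>a. a \<in> A \<Longrightarrow> smooth (f a)) \<Longrightarrow> smooth (\<lambda>x. \<Sum>a\<in>A. f a x)"
  by (induction A rule: finite_induct) (auto intro!: smooth_const smooth_add)

lemma smooth_minus: "smooth f \<Longrightarrow> smooth (\<lambda>x. - f x)"
  using smooth_cmult[of f "-1"] by simp

lemma smooth_diff: "smooth f \<Longrightarrow> smooth g \<Longrightarrow> smooth (\<lambda>x. f x - g x)"
  using smooth_add[OF _ smooth_minus, of f g] by simp

text \<open>The sequence \<open>h\<close> lists all derivatives of a function of one variable.\<close>

lemma smooth_compose:
  assumes h: "\<And>n s. (h n has_real_derivative h (Suc n) s) (at s)" and f: "smooth f"
  shows "smooth (\<lambda>x. h k (f x))"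
proof -
  have d: "\<And>x. f differentiable (at x)" using f by (rule smooth_differentiable)
  have "times_differentiable n (\<lambda>x. h k (f x))" for n
  proof (induction n arbitrary: k)
    case (Suc n)
    have "(\<lambda>x. h k (f x)) differentiable (at x)" for x
      using differentiable_compose[of "h k" f x UNIV] d h
      by (metis DERIV_subset differentiableI has_field_derivative_imp_has_derivative top_greatest)
    moreover have "times_differentiable n (partial_deriv i f)" for i
      using f smooth_iff_times_differentiable times_differentiable.simps(2) by blast
    ultimately show ?case using Suc.IH[of "Suc k"]
      by (auto simp: partial_deriv_compose[OF d h] intro!: times_differentiable_mult)
  qed simp
  then show ?thesis by (simp add: smooth_iff_times_differentiable)
qed

lemma smooth_affine:
  assumes "smooth f"
  shows "smooth (\<lambda>x. f (a + c *\<^sub>R x))"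
proof -
  have "times_differentiable n f \<Longrightarrow> times_differentiable n (\<lambda>x. b * f (a + c *\<^sub>R x))" for n b
  proof (induction n arbitrary: f b)
    case (Suc n)
    have d: "f differentiable (at x)" for x using Suc.prems by simp
    have e: "(\<lambda>x. f (a + c *\<^sub>R x)) differentiable (at x)" for x
      using differentiable_compose[of f "\<lambda>x. a + c *\<^sub>R x" x UNIV] d
      by (simp add: differentiable_at_withinI)
    have "partial_deriv i (\<lambda>x. b * f (a + c *\<^sub>R x)) = (\<lambda>x. (b * c) * partial_deriv i f (a + c *\<^sub>R x))" for i
      by (simp add: partial_deriv_mult[OF _ e] partial_deriv_const partial_deriv_affine[OF d] mult.assoc)
    then show ?case using Suc e by (simp add: differentiable_mult)
  qed simp
  from this[of _ 1] show ?thesis using assms by (simp add: smooth_iff_times_differentiable)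
qed

lemma partial_deriv_component: "partial_deriv j (\<lambda>x::real^'n::finite. x $ i) = (\<lambda>x. if i = j then 1 else 0)"
proof -
  have der: "((\<lambda>x::real^'n. x $ i) has_derivative (\<lambda>h. h $ i)) (at x)" for x
    by (simp add: bounded_linear_imp_has_derivative bounded_linear_vec_nth)
  show ?thesis by (rule ext) (simp add: has_derivative_imp_partial_deriv[OF der] axis_def)
qed

lemma smooth_component: "smooth (\<lambda>x::real^'n::finite. x $ i)"
proof -
  have "smooth (\<lambda>x::real^'n. if i = j then 1 else 0)" for j by (rule smooth_const)
  moreover have "(\<lambda>x::real^'n. x $ i) differentiable (at x)" for x
    by (intro bounded_linear_imp_differentiable bounded_linear_vec_nth)
  ultimately have "times_differentiable n (\<lambda>x::real^'n. x $ i)" for n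
    by (cases n) (simp_all add: partial_deriv_component smooth_iff_times_differentiable)
  then show ?thesis by (simp add: smooth_iff_times_differentiable)
qed

lemma norm_sq_sum: "(norm (x::real^'n::finite))\<^sup>2 = (\<Sum>i\<in>UNIV. x $ i * x $ i)"
  by (simp add: power2_norm_eq_inner inner_vec_def)

lemma smooth_norm_sq: "smooth (\<lambda>x::real^'n::finite. (norm x)\<^sup>2)"
  unfolding norm_sq_sum by (intro smooth_sum smooth_mult smooth_component) auto

lemma partial_deriv_norm_sq: "partial_deriv j (\<lambda>x::real^'n::finite. (norm x)\<^sup>2) = (\<lambda>x. 2 * x $ j)"
proof
  fix x :: "real^'n"
  have "((\<lambda>x::real^'n. (norm x)\<^sup>2) has_derivative (\<lambda>h. 2 * (x \<bullet> h))) (at x)"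
    unfolding power2_norm_eq_inner by (auto intro!: derivative_eq_intros simp: inner_commute)
  from has_derivative_imp_partial_deriv[OF this]
  show "partial_deriv j (\<lambda>x::real^'n. (norm x)\<^sup>2) x = 2 * x $ j"
    by (simp add: inner_axis)
qed

lemma test_function_iff:
  "test_function \<phi> \<longleftrightarrow> smooth \<phi> \<and> (\<exists>R>0. \<forall>x. norm x > R \<longrightarrow> \<phi> x = 0)"
proof -
  have "compact (closure {x. \<phi> x \<noteq> 0}) \<longleftrightarrow> (\<exists>R>0. \<forall>x. norm x > R \<longrightarrow> \<phi> x = 0)"
    unfolding compact_closure bounded_pos by (metis (mono_tags, lifting) mem_Collect_eq not_le)
  then show ?thesis by (simp add: test_function_def)
qed

lemma test_functionI: "smooth \<phi> \<Longrightarrow> (\<And>x. norm x > R \<Longrightarrow> \<phi> x = 0) \<Longrightarrow> test_function \<phi>"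
  unfolding test_function_iff by (intro conjI exI[of _ "max R 1"]) auto

lemma test_function_smooth: "test_function \<phi> \<Longrightarrow> smooth \<phi>"
  by (simp add: test_function_def)

lemma partial_deriv_outside:
  assumes "\<And>x. norm x > R \<Longrightarrow> f x = 0" and "norm x > R"
  shows "partial_deriv i f x = 0"
proof -
  have "open {x::real^'a. norm x > R}" by (intro open_Collect_less continuous_intros)
  then have "(f has_derivative (\<lambda>h. 0)) (at x)"
    using has_derivative_transform_within_open[OF has_derivative_const[of 0 "at x"], of "{x. norm x > R}" f] assms
    by auto
  then show ?thesis by (simp add: has_derivative_imp_partial_deriv)
qed

lemma test_function_partial_deriv: "test_function \<phi> \<Longrightarrow> test_function (partial_deriv i \<phi>)"
  unfolding test_function_iff by (blast intro: smooth_partial_deriv partial_deriv_outside)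

lemma test_function_mult_smooth: "test_function \<phi> \<Longrightarrow> smooth g \<Longrightarrow> test_function (\<lambda>x. \<phi> x * g x)"
  unfolding test_function_iff by (auto intro!: smooth_mult)

lemma test_function_smooth_mult: "test_function \<phi> \<Longrightarrow> smooth g \<Longrightarrow> test_function (\<lambda>x. g x * \<phi> x)"
  unfolding test_function_iff by (auto intro!: smooth_mult)

lemma test_function_cmult: "test_function \<phi> \<Longrightarrow> test_function (\<lambda>x. c * \<phi> x)"
  by (rule test_function_smooth_mult[OF _ smooth_const])

lemma test_function_zero: "test_function (\<lambda>x. 0)"
  by (rule test_functionI[OF smooth_const]) simp

lemma test_function_add:
  assumes "test_function \<phi>" "test_function \<psi>" shows "test_function (\<lambda>x. \<phi> x + \<psi> x)"
proof -
  obtain R S where "\<And>x. norm x > R \<Longrightarrow> \<phi> x = 0" "\<And>x. norm x > S \<Longrightarrow> \<psi> x = 0"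
    using assms unfolding test_function_iff by blast
  then show ?thesis
    using smooth_add[OF assms[THEN test_function_smooth]]
    by (intro test_functionI[where R="max R S"]) auto
qed

lemma test_function_minus: "test_function \<phi> \<Longrightarrow> test_function (\<lambda>x. - \<phi> x)"
  using test_function_cmult[of \<phi> "-1"] by simp

lemma test_function_diff: "test_function \<phi> \<Longrightarrow> test_function \<psi> \<Longrightarrow> test_function (\<lambda>x. \<phi> x - \<psi> x)"
  using test_function_add[OF _ test_function_minus, of \<phi> \<psi>] by simp

lemma test_function_sum:
  "finite A \<Longrightarrow> (\<And>a. a \<in> A \<Longrightarrow> test_function (f a)) \<Longrightarrow> test_function (\<lambda>x. \<Sum>a\<in>A. f a x)"
  by (induction A rule: finite_induct) (auto intro!: test_function_zero test_function_add)

lemma test_function_affine: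
  assumes "test_function \<phi>" "c \<noteq> 0" shows "test_function (\<lambda>x. \<phi> (a + c *\<^sub>R x))"
proof -
  obtain R where R: "\<And>x. norm x > R \<Longrightarrow> \<phi> x = 0"
    using assms unfolding test_function_iff by blast
  have "norm (a + c *\<^sub>R x) > R" if "norm x > (R + norm a) / \<bar>c\<bar>" for x
  proof -
    have "R + norm a < \<bar>c\<bar> * norm x" using that assms(2) by (simp add: field_simps)
    also have "\<dots> = norm ((a + c *\<^sub>R x) - a)" by simp
    also have "\<dots> \<le> norm (a + c *\<^sub>R x) + norm a" by (rule norm_triangle_ineq4)
    finally show ?thesis by simp
  qed
  then show ?thesis
    using smooth_affine[OF assms(1)[THEN test_function_smooth]] R
    by (intro test_functionI[where R="(R + norm a) / \<bar>c\<bar>"]) auto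
qed

lemma test_function_reflect: "test_function \<phi> \<Longrightarrow> test_function (\<lambda>y. \<phi> (x - y))"
  using test_function_affine[of \<phi> "-1" x] by simp

lemma partial_deriv_reflect:
  "smooth \<phi> \<Longrightarrow> partial_deriv i (\<lambda>y. \<phi> (x - y)) = (\<lambda>y. - partial_deriv i \<phi> (x - y))"
  using partial_deriv_affine[of \<phi> i x "-1", OF smooth_differentiable] by simp

lemma partial_deriv_cmult:
  "smooth f \<Longrightarrow> partial_deriv i (\<lambda>x. c * f x) = (\<lambda>x. c * partial_deriv i f x)"
  by (simp add: partial_deriv_mult[OF _ smooth_differentiable] partial_deriv_const)

lemma partial_deriv_diff:
  "smooth f \<Longrightarrow> smooth g \<Longrightarrow> partial_deriv i (\<lambda>x. f x - g x) = (\<lambda>x. partial_deriv i f x - partial_deriv i g x)"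
  using partial_deriv_add[of f "\<lambda>x. (-1) * g x" i] partial_deriv_cmult[of g i "-1"] smooth_minus[of g]
  by (simp add: smooth_differentiable)

lemma test_function_bounded:
  assumes "test_function \<phi>" obtains B where "B > 0" "\<And>x. \<bar>\<phi> x\<bar> \<le> B"
proof -
  obtain R where R: "\<And>x. norm x > R \<Longrightarrow> \<phi> x = 0"
    using assms unfolding test_function_iff by blast
  have "bounded (\<phi> ` cball 0 R)"
    by (intro compact_imp_bounded compact_continuous_image smooth_continuous test_function_smooth assms compact_cball)
  then obtain B where B: "B > 0" "\<And>x. x \<in> cball 0 R \<Longrightarrow> \<bar>\<phi> x\<bar> \<le> B"
    unfolding bounded_pos by auto
  have "\<bar>\<phi> x\<bar> \<le> B" for x using B R[of x] by (cases "norm x \<le> R") auto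
  with B that show ?thesis by blast
qed

lemma smooth_borel: "smooth f \<Longrightarrow> f \<in> borel_measurable borel"
  by (simp add: borel_measurable_continuous_onI smooth_continuous)

lemma smooth_lebesgue: "smooth f \<Longrightarrow> f \<in> borel_measurable lebesgue"
  by (intro measurable_completion) (simp add: smooth_borel)

lemma test_function_lipschitz:
  assumes "test_function \<phi>"
  obtains B where "B > 0" "\<And>x y. \<bar>\<phi> x - \<phi> y\<bar> \<le> B * norm (x - y)"
proof -
  have "\<exists>B. B > 0 \<and> (\<forall>x. \<bar>partial_deriv i \<phi> x\<bar> \<le> B)" for i
    using test_function_bounded[OF test_function_partial_deriv[OF assms], of i] by metis
  then obtain b where b: "\<And>i. b i > 0" "\<And>i x. \<bar>partial_deriv i \<phi> x\<bar> \<le> b i" by metis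
  define B where "B = (\<Sum>i\<in>UNIV. b i)"
  have B0: "B > 0" unfolding B_def by (intro sum_pos b) auto
  have "\<bar>\<phi> x - \<phi> y\<bar> \<le> B * norm (x - y)" for x y
  proof -
    have "norm (\<phi> x - \<phi> y) \<le> B * norm (x - y)"
    proof (rule differentiable_bound[OF convex_UNIV])
      fix z show "(\<phi> has_derivative (\<lambda>h. \<Sum>i\<in>UNIV. h $ i * partial_deriv i \<phi> z)) (at z within UNIV)"
        using differentiable_has_derivative_partial[OF smooth_differentiable[OF test_function_smooth[OF assms]]] by simp
      show "onorm (\<lambda>h. \<Sum>i\<in>UNIV. h $ i * partial_deriv i \<phi> z) \<le> B"
      proof (rule onorm_le)
        fix h :: "real^'a"
        have "norm (\<Sum>i\<in>UNIV. h $ i * partial_deriv i \<phi> z) \<le> (\<Sum>i\<in>UNIV. norm h * b i)"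
          by (rule sum_norm_le) (use b component_le_norm_cart[of h] in \<open>auto simp: abs_mult intro!: mult_mono\<close>)
        also have "\<dots> = B * norm h" by (simp add: B_def sum_distrib_left mult.commute)
        finally show "norm (\<Sum>i\<in>UNIV. h $ i * partial_deriv i \<phi> z) \<le> B * norm h" .
      qed
    qed auto
    then show ?thesis by simp
  qed
  with B0 that show ?thesis by blast
qed

text \<open>The remainder is quadratic uniformly in \<open>x\<close>, since the partial derivatives are again test
  functions and hence Lipschitz. This uniformity lets difference quotients be integrated.\<close>

lemma test_function_taylor:
  assumes "test_function \<phi>"
  obtains B where "B > 0"
    "\<And>x h. \<bar>\<phi> (x + h) - \<phi> x - (\<Sum>i\<in>UNIV. h $ i * partial_deriv i \<phi> x)\<bar> \<le> B * (norm h)\<^sup>2"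
proof -
  have "\<exists>B. B > 0 \<and> (\<forall>x y. \<bar>partial_deriv i \<phi> x - partial_deriv i \<phi> y\<bar> \<le> B * norm (x - y))" for i
    using test_function_lipschitz[OF test_function_partial_deriv[OF assms], of i] by metis
  then obtain b where b: "\<And>i. b i > 0"
    "\<And>i x y. \<bar>partial_deriv i \<phi> x - partial_deriv i \<phi> y\<bar> \<le> b i * norm (x - y)" by metis
  define B where "B = (\<Sum>i\<in>UNIV. b i)"
  have B0: "B > 0" unfolding B_def by (intro sum_pos b) auto
  have "\<bar>\<phi> (x + h) - \<phi> x - (\<Sum>i\<in>UNIV. h $ i * partial_deriv i \<phi> x)\<bar> \<le> B * (norm h)\<^sup>2" for x h
  proof -
    have "norm (\<phi> (x + h) - \<phi> x - (\<Sum>i\<in>UNIV. ((x + h) - x) $ i * partial_deriv i \<phi> x))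
        \<le> norm ((x + h) - x) * (B * norm h)"
    proof (rule differentiable_bound_linearization[where S="closed_segment x (x+h)" and ?x0.0=x
          and f'="\<lambda>z k. \<Sum>i\<in>UNIV. k $ i * partial_deriv i \<phi> z"])
      show "\<And>t. t \<in> {0..1} \<Longrightarrow> x + t *\<^sub>R (x + h - x) \<in> closed_segment x (x + h)"
        by (auto simp: in_segment algebra_simps)
      fix z assume "z \<in> closed_segment x (x + h)"
      show "(\<phi> has_derivative (\<lambda>h. \<Sum>i\<in>UNIV. h $ i * partial_deriv i \<phi> z)) (at z within closed_segment x (x + h))"
        by (rule has_derivative_at_withinI[OF differentiable_has_derivative_partial[OF
                smooth_differentiable[OF test_function_smooth[OF assms]]]])
    next
      fix z assume "z \<in> closed_segment x (x + h)"
      then have zx: "norm (z - x) \<le> norm h"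
        using segment_bound1[of z x "x + h"] by (simp add: norm_minus_commute)
      show "onorm ((\<lambda>k. \<Sum>i\<in>UNIV. k $ i * partial_deriv i \<phi> z) - (\<lambda>k. \<Sum>i\<in>UNIV. k $ i * partial_deriv i \<phi> x)) \<le> B * norm h"
        unfolding fun_diff_def
      proof (rule onorm_le)
        fix k :: "real^'a"
        have "norm (\<Sum>i\<in>UNIV. k $ i * (partial_deriv i \<phi> z - partial_deriv i \<phi> x)) \<le> (\<Sum>i\<in>UNIV. norm k * (b i * norm h))"
        proof (rule sum_norm_le)
          fix i
          have "b i * norm (z - x) \<le> b i * norm h" using b(1)[of i] zx by simp
          then have "\<bar>partial_deriv i \<phi> z - partial_deriv i \<phi> x\<bar> \<le> b i * norm h"
            using b(2)[of i z x] by linarith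
          then show "norm (k $ i * (partial_deriv i \<phi> z - partial_deriv i \<phi> x)) \<le> norm k * (b i * norm h)"
            using component_le_norm_cart[of k i] by (auto simp: abs_mult intro!: mult_mono)
        qed
        also have "\<dots> = B * norm h * norm k" by (simp add: B_def sum_distrib_left sum_distrib_right mult_ac)
        finally show "norm ((\<Sum>i\<in>UNIV. k $ i * partial_deriv i \<phi> z) - (\<Sum>i\<in>UNIV. k $ i * partial_deriv i \<phi> x)) \<le> B * norm h * norm k"
          by (simp add: sum_subtractf right_diff_distrib)
      qed
    qed auto
    then show ?thesis by (simp add: power2_eq_square mult_ac)
  qed
  with B0 that show ?thesis by blast
qed

section \<open>Integrals against test functions\<close>

lemma integrable_dominated:
  fixes f g :: "'a \<Rightarrow> real"
  assumes "f \<in> borel_measurable M" "integrable M g" "\<And>x. \<bar>f x\<bar> \<le> g x"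
  shows "integrable M f"
  by (rule Bochner_Integration.integrable_bound[OF assms(2,1)])
    (use assms(3) in \<open>auto intro: order_trans[OF _ abs_ge_self]\<close>)

lemma integrable_indicator_cball: "integrable lebesgue (indicat_real (cball (a::real^'n::finite) R))"
  using emeasure_bounded_finite[of "cball a R"] by (intro integrable_real_indicator) auto

lemma indicator_borel_mult:
  fixes f :: "real^'n::finite \<Rightarrow> real"
  assumes "f \<in> borel_measurable lebesgue" "S \<in> sets borel"
  shows "(\<lambda>x. indicat_real S x * f x) \<in> borel_measurable lebesgue"
proof -
  have "S \<in> sets lebesgue" using assms(2) by auto
  then show ?thesis using assms(1) by simp
qed

lemma integrable_bounded_support:
  fixes f :: "real^'n::finite \<Rightarrow> real"
  assumes "f \<in> borel_measurable lebesgue" "\<And>x. \<bar>f x\<bar> \<le> B" "\<And>x. norm x > R \<Longrightarrow> f x = 0"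
  shows "integrable lebesgue f"
proof (rule Bochner_Integration.integrable_bound)
  show "integrable lebesgue (\<lambda>x. indicator (cball (0::real^'n) R) x * B :: real)"
    by (intro integrable_mult_left integrable_indicator_cball)
  have "norm (f x) \<le> norm (indicator (cball 0 R) x * B)" for x
    using assms(2)[of x] assms(3)[of x] by (auto simp: indicator_def)
  then show "AE x in lebesgue. norm (f x) \<le> norm (indicator (cball 0 R) x * B)" by simp
qed (fact assms(1))

lemma integrable_test_function: "test_function \<phi> \<Longrightarrow> integrable lebesgue \<phi>"
proof -
  assume t: "test_function \<phi>"
  obtain B where "\<And>x. \<bar>\<phi> x\<bar> \<le> B" using test_function_bounded[OF t] by metis
  moreover obtain R where "\<And>x. norm x > R \<Longrightarrow> \<phi> x = 0" using t test_function_iff by metis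
  ultimately show ?thesis
    using integrable_bounded_support smooth_lebesgue test_function_smooth t by metis
qed

lemma locally_integrable_cball:
  "locally_integrable f \<Longrightarrow> integrable lebesgue (\<lambda>x. indicator (cball 0 R) x * f x)"
  unfolding locally_integrable_def set_integrable_def by (simp add: compact_cball)

lemma locally_integrable_of_integrable:
  fixes f :: "real^'n::finite \<Rightarrow> real"
  shows "integrable lebesgue f \<Longrightarrow> locally_integrable f"
  unfolding locally_integrable_def set_integrable_def
  by (intro allI impI integrable_mult_indicator sets_completionI_sets) (simp_all add: borel_compact)

lemma locally_integrable_measurable:
  assumes "locally_integrable f" shows "f \<in> borel_measurable lebesgue"
proof (rule borel_measurable_LIMSEQ_real)
  show "(\<lambda>x. indicator (cball 0 (real n)) x * f x) \<in> borel_measurable lebesgue" for n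
    using locally_integrable_cball[OF assms] by (rule borel_measurable_integrable)
  fix x
  have "\<forall>\<^sub>F n in sequentially. indicator (cball 0 (real n)) x * f x = f x"
    using eventually_ge_at_top[of "nat \<lceil>norm x\<rceil>"]
    by eventually_elim (simp add: indicator_def nat_ceiling_le_eq)
  then show "(\<lambda>n. indicator (cball 0 (real n)) x * f x) \<longlonglongrightarrow> f x"
    by (rule tendsto_eventually)
qed

lemma locally_integrableI:
  assumes "f \<in> borel_measurable lebesgue"
    and "\<And>R. integrable lebesgue (\<lambda>x. indicator (cball 0 R) x * g x)"
    and "\<And>x. \<bar>f x\<bar> \<le> g x"
  shows "locally_integrable f"
  unfolding locally_integrable_def set_integrable_def
proof (intro allI impI)
  fix K :: "(real^'a) set" assume K: "compact K"
  then obtain R where R: "K \<subseteq> cball 0 R"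
    using compact_imp_bounded[OF K] by (meson bounded_subset_ballD ball_subset_cball order_trans)
  show "integrable lebesgue (\<lambda>x. indicat_real K x *\<^sub>R f x)"
  proof (rule Bochner_Integration.integrable_bound[OF assms(2)[of R]])
    show "(\<lambda>x. indicat_real K x *\<^sub>R f x) \<in> borel_measurable lebesgue"
      using indicator_borel_mult[OF assms(1)] K by (simp add: borel_compact)
    have "norm (indicat_real K x *\<^sub>R f x) \<le> norm (indicat_real (cball 0 R) x * g x)" for x
      using R assms(3)[of x] by (auto simp: indicator_def)
    then show "AE x in lebesgue. norm (indicat_real K x *\<^sub>R f x) \<le> norm (indicat_real (cball 0 R) x * g x)"
      by simp
  qed
qed

lemma integrable_mult_bounded_support:
  assumes f: "locally_integrable f" and g: "g \<in> borel_measurable lebesgue"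
    and B: "\<And>x. \<bar>g x\<bar> \<le> B" and R: "\<And>x. norm x > R \<Longrightarrow> g x = 0"
  shows "integrable lebesgue (\<lambda>x. f x * g x)"
proof (rule Bochner_Integration.integrable_bound)
  show "integrable lebesgue (\<lambda>x. B * (indicator (cball 0 R) x * f x))"
    using locally_integrable_cball[OF f] by simp
  show "(\<lambda>x. f x * g x) \<in> borel_measurable lebesgue"
    using g locally_integrable_measurable[OF f] by simp
  have "norm (f x * g x) \<le> norm (B * (indicator (cball 0 R) x * f x))" for x
  proof (cases "norm x > R")
    case False
    have "\<bar>f x\<bar> * \<bar>g x\<bar> \<le> \<bar>f x\<bar> * \<bar>B\<bar>" using B[of x] by (intro mult_left_mono) auto
    with False show ?thesis by (simp add: abs_mult mult.commute)
  qed (simp add: R)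
  then show "AE x in lebesgue. norm (f x * g x) \<le> norm (B * (indicator (cball 0 R) x * f x))" by simp
qed

lemma integrable_mult_test:
  assumes "locally_integrable f" "test_function \<phi>"
  shows "integrable lebesgue (\<lambda>x. f x * \<phi> x)"
proof -
  obtain B where "\<And>x. \<bar>\<phi> x\<bar> \<le> B" using test_function_bounded[OF assms(2)] by metis
  moreover obtain R where "\<And>x. norm x > R \<Longrightarrow> \<phi> x = 0" using assms(2) test_function_iff by metis
  ultimately show ?thesis
    using integrable_mult_bounded_support[OF assms(1) smooth_lebesgue[OF test_function_smooth[OF assms(2)]]]
    by metis
qed

lemma locally_integrable_mult_smooth:
  assumes "locally_integrable f" "smooth g" shows "locally_integrable (\<lambda>x. f x * g x)"
  unfolding locally_integrable_def set_integrable_def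
proof (intro allI impI)
  fix K :: "(real^'a) set" assume K: "compact K"
  have "bounded (g ` K)"
    using K assms(2) by (intro compact_imp_bounded compact_continuous_image smooth_continuous) auto
  then obtain B where B: "\<And>x. x \<in> K \<Longrightarrow> \<bar>g x\<bar> \<le> B" unfolding bounded_iff by auto
  show "integrable lebesgue (\<lambda>x. indicat_real K x *\<^sub>R (f x * g x))"
  proof (rule Bochner_Integration.integrable_bound)
    show "integrable lebesgue (\<lambda>x. B * (indicat_real K x *\<^sub>R f x))"
      using assms(1) K unfolding locally_integrable_def set_integrable_def by simp
    show "(\<lambda>x. indicat_real K x *\<^sub>R (f x * g x)) \<in> borel_measurable lebesgue"
      unfolding real_scaleR_def
      by (intro indicator_borel_mult borel_measurable_times locally_integrable_measurable[OF assms(1)]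
          smooth_lebesgue[OF assms(2)] borel_compact K)
    have "norm (indicat_real K x *\<^sub>R (f x * g x)) \<le> norm (B * (indicat_real K x *\<^sub>R f x))" for x
    proof (cases "x \<in> K")
      case True
      have "\<bar>f x\<bar> * \<bar>g x\<bar> \<le> \<bar>f x\<bar> * \<bar>B\<bar>" using B[OF True] by (intro mult_left_mono) auto
      with True show ?thesis by (simp add: abs_mult mult.commute)
    qed simp
    then show "AE x in lebesgue. norm (indicat_real K x *\<^sub>R (f x * g x)) \<le> norm (B * (indicat_real K x *\<^sub>R f x))" by simp
  qed
qed

lemma locally_integrable_smooth:
  assumes "smooth g" shows "locally_integrable g"
proof -
  have "locally_integrable (\<lambda>x::real^'a. 1)"
    by (rule locally_integrableI[where g="\<lambda>x. 1"]) (simp_all add: integrable_indicator_cball)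
  from locally_integrable_mult_smooth[OF this assms] show ?thesis by simp
qed

lemma integral_lebesgue_affine:
  fixes f :: "real^'n::finite \<Rightarrow> real"
  assumes "f \<in> borel_measurable borel" "c \<noteq> 0"
  shows "(LINT x|lebesgue. f x) = \<bar>c\<bar> ^ CARD('n) * (LINT x|lebesgue. f (a + c *\<^sub>R x))"
proof -
  have m: "(\<lambda>x. a + c *\<^sub>R x) \<in> borel_measurable borel"
    by (intro borel_measurable_continuous_onI continuous_intros)
  have "(LINT x|lebesgue. f x) = (LINT x|lborel. f x)"
    using assms by (simp add: integral_completion)
  also have "\<dots> = (LINT x|density (distr lborel borel (\<lambda>x. a + c *\<^sub>R x)) (\<lambda>_. ennreal (\<bar>c\<bar>^DIM(real^'n))). f x)"
    using lborel_affine[OF assms(2), of a] by (simp add: ennreal_power)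
  also have "\<dots> = \<bar>c\<bar> ^ CARD('n) * (LINT x|lborel. f (a + c *\<^sub>R x))"
    using assms m by (subst integral_density) (auto simp: integral_distr)
  also have "(LINT x|lborel. f (a + c *\<^sub>R x)) = (LINT x|lebesgue. f (a + c *\<^sub>R x))"
    using assms(1) m by (subst integral_completion) (auto intro: measurable_compose)
  finally show ?thesis .
qed

lemma integral_lebesgue_shift:
  fixes f :: "real^'n::finite \<Rightarrow> real"
  assumes "f \<in> borel_measurable borel"
  shows "(LINT x|lebesgue. f (a + x)) = (LINT x|lebesgue. f x)"
  using integral_lebesgue_affine[OF assms, of 1 a] by simp

lemma integral_lebesgue_reflect:
  fixes f :: "real^'n::finite \<Rightarrow> real"
  assumes "f \<in> borel_measurable borel"
  shows "(LINT x|lebesgue. f (a - x)) = (LINT x|lebesgue. f x)"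
  using integral_lebesgue_affine[OF assms, of "-1" a] by simp

lemma nn_integral_lebesgue_shift:
  fixes f :: "real^'n::finite \<Rightarrow> ennreal"
  assumes "f \<in> borel_measurable borel"
  shows "(\<integral>\<^sup>+x. f (x - a) \<partial>lebesgue) = (\<integral>\<^sup>+x. f x \<partial>lebesgue)"
proof -
  have m: "(\<lambda>x::real^'n. - a + x) \<in> borel_measurable borel"
    by (intro borel_measurable_continuous_onI continuous_intros)
  have "(\<integral>\<^sup>+x. f x \<partial>lborel) = (\<integral>\<^sup>+x. f x \<partial>distr lborel borel ((+) (-a)))"
    by (simp add: lborel_distr_plus)
  also have "\<dots> = (\<integral>\<^sup>+x. f (- a + x) \<partial>lborel)"
    using assms m by (subst nn_integral_distr) auto
  finally show ?thesis by (simp add: nn_integral_completion)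
qed

text \<open>Translation invariance gives the integral of a partial derivative: the difference quotients
  of a test function integrate to zero, and by the uniform Taylor bound they converge to the
  partial derivative in \<open>L\<^sup>1\<close>.\<close>

lemma integral_partial_deriv:
  assumes F: "test_function (F :: real^'n::finite \<Rightarrow> real)"
  shows "(LINT x|lebesgue. partial_deriv i F x) = 0"
proof (rule ccontr)
  define I where "I = (LINT x|lebesgue. partial_deriv i F x)"
  assume "(LINT x|lebesgue. partial_deriv i F x) \<noteq> 0"
  then have I: "\<bar>I\<bar> > 0" by (simp add: I_def)
  obtain B where B: "B > 0"
    "\<And>x h. \<bar>F (x + h) - F x - (\<Sum>i\<in>UNIV. h $ i * partial_deriv i F x)\<bar> \<le> B * (norm h)\<^sup>2"
    using test_function_taylor[OF F] by metis
  obtain R where R: "\<And>x. norm x > R \<Longrightarrow> F x = 0" using F test_function_iff by metis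
  define M where "M = measure lebesgue (cball (0::real^'n) (R + 1))"
  have bound: "h * \<bar>I\<bar> \<le> B * h\<^sup>2 * M" if h: "0 < h" "h \<le> 1" for h
  proof -
    let ?e = "h *\<^sub>R axis i 1 :: real^'n"
    have ne: "norm ?e = h" using h by simp
    define D where "D = (\<lambda>x. F (?e + x) - F x - h * partial_deriv i F x)"
    have t: "test_function (\<lambda>x. F (?e + x))" using test_function_affine[OF F, of 1] by simp
    have ib: "integrable lebesgue D" unfolding D_def
      by (intro Bochner_Integration.integrable_diff integrable_mult_right integrable_test_function t F test_function_partial_deriv)
    have "(LINT x|lebesgue. F (?e + x)) = (LINT x|lebesgue. F x)"
      by (intro integral_lebesgue_shift smooth_borel test_function_smooth F)
    then have "integral\<^sup>L lebesgue D = - (h * I)"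
      unfolding D_def I_def
      by (simp add: integrable_test_function[OF t] integrable_test_function[OF F]
          integrable_test_function[OF test_function_partial_deriv[OF F]])
    moreover have "\<bar>integral\<^sup>L lebesgue D\<bar> \<le> (LINT x|lebesgue. B * h\<^sup>2 * indicator (cball (0::real^'n) (R+1)) x)"
    proof (rule Bochner_Integration.integral_abs_bound_integral[OF ib])
      show "integrable lebesgue (\<lambda>x::real^'n. B * h\<^sup>2 * indicator (cball 0 (R+1)) x)"
        by (simp add: integrable_indicator_cball)
      fix x :: "real^'n"
      have pd: "(\<Sum>j\<in>UNIV. ?e $ j * partial_deriv j F x) = h * partial_deriv i F x"
        by (simp add: axis_def mult_ac if_distrib[where f="\<lambda>z. z * _"] if_distrib[where f="\<lambda>z. _ * z"] cong: if_cong)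
      show "\<bar>D x\<bar> \<le> B * h\<^sup>2 * indicator (cball 0 (R+1)) x"
      proof (cases "norm x \<le> R + 1")
        case True
        with B(2)[of x ?e] show ?thesis by (simp only: D_def pd ne) (simp add: add.commute)
      next
        case False
        have "norm x \<le> norm (?e + x) + norm ?e" by (metis add_diff_cancel_left' norm_triangle_ineq4 add.commute)
        then have "norm (?e + x) > R" "norm x > R" using False h ne by auto
        then show ?thesis using R partial_deriv_outside[of R F x i] B(1) by (auto simp: D_def)
      qed
    qed
    ultimately show ?thesis using h by (simp add: abs_mult M_def)
  qed
  have M0: "M \<ge> 0" by (simp add: M_def)
  define h where "h = min 1 (\<bar>I\<bar> / (2 * (B * M + 1)))"
  have pos: "B * M + 1 > 0" using B(1) M0 by (simp add: add_nonneg_pos)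
  have h: "0 < h" "h \<le> 1" using I pos by (auto simp: h_def)
  have "h * \<bar>I\<bar> \<le> h * (h * (B * M))" using bound[OF h] by (simp add: power2_eq_square mult_ac)
  then have "\<bar>I\<bar> \<le> h * (B * M)" using h by simp
  also have "\<dots> \<le> h * (B * M + 1)" using h by simp
  also have "\<dots> \<le> \<bar>I\<bar> / (2 * (B * M + 1)) * (B * M + 1)"
    using pos by (intro mult_right_mono) (auto simp: h_def)
  also have "\<dots> = \<bar>I\<bar> / 2"
  proof -
    have "a / (2 * K) * K = a / 2" if "K > 0" for a K :: real using that by simp
    then show ?thesis using pos by blast
  qed
  finally show False using I by simp
qed

lemma integral_by_parts:
  assumes "test_function f" "smooth g"
  shows "(LINT x|lebesgue. partial_deriv i f x * g x) = - (LINT x|lebesgue. f x * partial_deriv i g x)"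
proof -
  have pd: "partial_deriv i (\<lambda>x. f x * g x) = (\<lambda>x. f x * partial_deriv i g x + partial_deriv i f x * g x)"
    by (rule partial_deriv_mult[OF smooth_differentiable[OF test_function_smooth[OF assms(1)]] smooth_differentiable[OF assms(2)]])
  have i: "integrable lebesgue (\<lambda>x. f x * partial_deriv i g x)" "integrable lebesgue (\<lambda>x. partial_deriv i f x * g x)"
    by (rule integrable_test_function[OF test_function_mult_smooth];
        intro assms test_function_partial_deriv smooth_partial_deriv)+
  show ?thesis
    using integral_partial_deriv[OF test_function_mult_smooth[OF assms], of i] i by (simp add: pd)
qed

section \<open>Convolution with a test function\<close>

definition convolution :: "(real^'n::finite \<Rightarrow> real) \<Rightarrow> (real^'n \<Rightarrow> real) \<Rightarrow> real^'n \<Rightarrow> real" where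
  "convolution \<kappa> f x = (LINT y|lebesgue. \<kappa> (x - y) * f y)"

lemma convolution_integrable:
  assumes "test_function \<kappa>" "locally_integrable f"
  shows "integrable lebesgue (\<lambda>y. \<kappa> (x - y) * f y)"
  using integrable_mult_test[OF assms(2) test_function_reflect[OF assms(1)]] by (simp add: mult.commute)

text \<open>The uniform Taylor bound of \<open>\<kappa>\<close> can be integrated against \<open>f\<close>, so no smoothness of \<open>f\<close> is involved.\<close>

lemma convolution_has_derivative:
  fixes f :: "real^'n::finite \<Rightarrow> real"
  assumes k: "test_function \<kappa>" and f: "locally_integrable f"
  shows "(convolution \<kappa> f has_derivative (\<lambda>h. \<Sum>i\<in>UNIV. h $ i * convolution (partial_deriv i \<kappa>) f x)) (at x)"
proof -
  obtain B where B: "B > 0"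
    "\<And>x h. \<bar>\<kappa> (x + h) - \<kappa> x - (\<Sum>i\<in>UNIV. h $ i * partial_deriv i \<kappa> x)\<bar> \<le> B * (norm h)\<^sup>2"
    using test_function_taylor[OF k] by metis
  obtain R where R: "\<And>x. norm x > R \<Longrightarrow> \<kappa> x = 0" using k test_function_iff by metis
  define S where "S = R + norm x + 1"
  define g where "g = (\<lambda>y. indicat_real (cball 0 S) y * f y)"
  have g: "integrable lebesgue g" unfolding g_def by (rule locally_integrable_cball[OF f])
  define M where "M = (LINT y|lebesgue. \<bar>g y\<bar>)"
  have M0: "M \<ge> 0" by (simp add: M_def)
  let ?L = "\<lambda>h. \<Sum>i\<in>UNIV. h $ i * convolution (partial_deriv i \<kappa>) f x"
  have bound: "\<bar>convolution \<kappa> f (x + h) - convolution \<kappa> f x - ?L h\<bar> \<le> B * (norm h)\<^sup>2 * M" if h: "norm h \<le> 1" for h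
  proof -
    let ?D = "\<lambda>y. (\<kappa> (x + h - y) - \<kappa> (x - y) - (\<Sum>i\<in>UNIV. h $ i * partial_deriv i \<kappa> (x - y))) * f y"
    have i1: "integrable lebesgue (\<lambda>y. \<kappa> (z - y) * f y)" for z by (rule convolution_integrable[OF k f])
    have i2: "integrable lebesgue (\<lambda>y. partial_deriv i \<kappa> (z - y) * f y)" for z i
      by (rule convolution_integrable[OF test_function_partial_deriv[OF k] f])
    have Deq: "?D = (\<lambda>y. \<kappa> (x + h - y) * f y - \<kappa> (x - y) * f y - (\<Sum>i\<in>UNIV. h $ i * (partial_deriv i \<kappa> (x - y) * f y)))"
      by (rule ext) (simp add: left_diff_distrib sum_distrib_right mult.assoc)
    have iD: "integrable lebesgue ?D" unfolding Deq
      by (intro Bochner_Integration.integrable_diff Bochner_Integration.integrable_sum integrable_mult_right i1 i2)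
    have "integral\<^sup>L lebesgue ?D = convolution \<kappa> f (x + h) - convolution \<kappa> f x - ?L h"
      unfolding Deq convolution_def using i1 i2
      by (simp add: Bochner_Integration.integral_diff Bochner_Integration.integral_sum)
    moreover have "\<bar>integral\<^sup>L lebesgue ?D\<bar> \<le> (LINT y|lebesgue. B * (norm h)\<^sup>2 * \<bar>g y\<bar>)"
    proof (rule Bochner_Integration.integral_abs_bound_integral[OF iD])
      show "integrable lebesgue (\<lambda>y. B * (norm h)\<^sup>2 * \<bar>g y\<bar>)" using g by simp
      fix y
      show "\<bar>?D y\<bar> \<le> B * (norm h)\<^sup>2 * \<bar>g y\<bar>"
      proof (cases "norm y \<le> S")
        case True
        have "x + h - y = (x - y) + h" by simp
        then have "\<bar>\<kappa> (x + h - y) - \<kappa> (x - y) - (\<Sum>i\<in>UNIV. h $ i * partial_deriv i \<kappa> (x - y))\<bar> \<le> B * (norm h)\<^sup>2"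
          using B(2)[of "x - y" h] by metis
        then show ?thesis using True by (simp add: abs_mult g_def mult_right_mono)
      next
        case False
        have "norm y \<le> norm (x - y) + norm x" by (metis norm_triangle_sub norm_minus_commute add.commute)
        then have a: "norm (x - y) > R" using False by (simp add: S_def)
        have "norm y \<le> norm (x + h - y) + norm (x + h)" by (metis norm_triangle_sub norm_minus_commute add.commute)
        then have b: "norm (x + h - y) > R" using False h norm_triangle_ineq[of x h] by (simp add: S_def)
        show ?thesis using R[OF a] R[OF b] partial_deriv_outside[OF R a] by (simp add: B less_imp_le)
      qed
    qed
    ultimately show ?thesis by (simp add: M_def)
  qed
  have bl: "bounded_linear ?L"
    by (intro bounded_linear_sum bounded_linear_mult_const bounded_linear_vec_nth) 
  show ?thesis
    unfolding has_derivative_at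
  proof (intro conjI bl)
    show "(\<lambda>h. norm (convolution \<kappa> f (x + h) - convolution \<kappa> f x - ?L h) / norm h) \<midarrow>0\<rightarrow> 0"
    proof (rule Lim_null_comparison)
      have "\<forall>\<^sub>F h::real^'n in at 0. norm h \<le> 1"
        by (rule eventually_at_ball[of 1 0, THEN eventually_mono]) auto
      then show "\<forall>\<^sub>F h in at 0. norm (norm (convolution \<kappa> f (x + h) - convolution \<kappa> f x - ?L h) / norm h) \<le> B * M * norm h"
      proof eventually_elim
        case (elim h)
        show ?case
        proof (cases "h = 0")
          case False
          then show ?thesis using bound[OF elim] by (simp add: divide_le_eq power2_eq_square mult_ac)
        qed simp
      qed
      have "((\<lambda>h::real^'n. B * M * norm h) \<longlongrightarrow> B * M * norm (0::real^'n)) (at 0)" by (intro tendsto_intros)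
      then show "((\<lambda>h::real^'n. B * M * norm h) \<longlongrightarrow> 0) (at 0)" by simp
    qed
  qed
qed

lemma partial_deriv_convolution:
  assumes "test_function \<kappa>" "locally_integrable f"
  shows "partial_deriv i (convolution \<kappa> f) = convolution (partial_deriv i \<kappa>) f"
proof
  fix x
  show "partial_deriv i (convolution \<kappa> f) x = convolution (partial_deriv i \<kappa>) f x"
    using has_derivative_imp_partial_deriv[OF convolution_has_derivative[OF assms], of i x]
    by (simp add: axis_def if_distrib[where f="\<lambda>z. z * _"] cong: if_cong)
qed

lemma smooth_convolution:
  assumes "test_function \<kappa>" "locally_integrable f"
  shows "smooth (convolution \<kappa> f)"
proof -
  have "times_differentiable n (convolution \<kappa> f)" if "test_function \<kappa>" for n \<kappa>
    using that
  proof (induction n arbitrary: \<kappa>)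
    case (Suc n)
    then show ?case using convolution_has_derivative[OF Suc.prems assms(2)]
      by (auto simp: partial_deriv_convolution[OF _ assms(2)] differentiable_def intro: test_function_partial_deriv)
  qed simp
  then show ?thesis using assms(1) by (simp add: smooth_iff_times_differentiable)
qed

lemma convolution_outside:
  assumes "\<And>x. norm x > R \<Longrightarrow> \<kappa> x = 0" "\<And>x. norm x > S \<Longrightarrow> f x = 0" "norm x > R + S"
  shows "convolution \<kappa> f x = 0"
proof -
  have "(\<lambda>y. \<kappa> (x - y) * f y) = (\<lambda>y. 0)"
  proof
    fix y
    have "norm x \<le> norm (x - y) + norm y" by (metis norm_triangle_sub add.commute)
    then have "norm (x - y) > R \<or> norm y > S" using assms(3) by linarith
    then show "\<kappa> (x - y) * f y = 0" using assms(1,2) by auto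
  qed
  then show ?thesis by (simp add: convolution_def)
qed

lemma test_function_convolution:
  assumes "test_function \<kappa>" "locally_integrable f" "\<And>x. norm x > S \<Longrightarrow> f x = 0"
  shows "test_function (convolution \<kappa> f)"
proof -
  obtain R where R: "\<And>x. norm x > R \<Longrightarrow> \<kappa> x = 0" using assms(1) test_function_iff by metis
  show ?thesis
    by (rule test_functionI[where R="R + S"]) (auto intro!: smooth_convolution assms convolution_outside R)
qed

lemma convolution_cong: "(\<And>y. \<kappa> (x - y) \<noteq> 0 \<Longrightarrow> f y = g y) \<Longrightarrow> convolution \<kappa> f x = convolution \<kappa> g x"
  unfolding convolution_def by (rule Bochner_Integration.integral_cong) auto

lemma convolution_diff_right:
  "test_function \<kappa> \<Longrightarrow> locally_integrable f \<Longrightarrow> locally_integrable g \<Longrightarrow>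
    convolution \<kappa> (\<lambda>y. f y - g y) x = convolution \<kappa> f x - convolution \<kappa> g x"
  unfolding convolution_def by (simp add: right_diff_distrib convolution_integrable)

lemma convolution_diff_left:
  "test_function \<kappa> \<Longrightarrow> test_function \<kappa>' \<Longrightarrow> locally_integrable f \<Longrightarrow>
    convolution (\<lambda>z. \<kappa> z - \<kappa>' z) f x = convolution \<kappa> f x - convolution \<kappa>' f x"
  unfolding convolution_def by (simp add: left_diff_distrib convolution_integrable)

lemma convolution_sum_left:
  "(\<And>a. a \<in> A \<Longrightarrow> test_function (\<kappa> a)) \<Longrightarrow> locally_integrable f \<Longrightarrow>
    convolution (\<lambda>z. \<Sum>a\<in>A. \<kappa> a z) f x = (\<Sum>a\<in>A. convolution (\<kappa> a) f x)"
  unfolding convolution_def by (simp add: sum_distrib_right convolution_integrable Bochner_Integration.integral_sum)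

section \<open>Mollification in local Lebesgue spaces\<close>

lemma integral_Cauchy_Schwarz:
  fixes f g :: "'a \<Rightarrow> real"
  assumes [measurable]: "f \<in> borel_measurable M" "g \<in> borel_measurable M"
    and f2: "integrable M (\<lambda>x. (f x)\<^sup>2)" and g2: "integrable M (\<lambda>x. (g x)\<^sup>2)"
  shows "integrable M (\<lambda>x. f x * g x)"
    and "\<bar>LINT x|M. f x * g x\<bar> \<le> sqrt (LINT x|M. (f x)\<^sup>2) * sqrt (LINT x|M. (g x)\<^sup>2)"
proof -
  have fg: "\<bar>f x * g x\<bar> \<le> (f x)\<^sup>2 + (g x)\<^sup>2" for x
  proof -
    have "2 * (\<bar>f x\<bar> * \<bar>g x\<bar>) \<le> (f x)\<^sup>2 + (g x)\<^sup>2" using sum_squares_bound[of "\<bar>f x\<bar>" "\<bar>g x\<bar>"] by simp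
    moreover have "0 \<le> \<bar>f x\<bar> * \<bar>g x\<bar>" by simp
    ultimately show ?thesis unfolding abs_mult by linarith
  qed
  show i: "integrable M (\<lambda>x. f x * g x)"
    by (rule integrable_dominated[OF _ Bochner_Integration.integrable_add[OF f2 g2] fg]) simp
  then have ia: "integrable M (\<lambda>x. \<bar>f x\<bar> * \<bar>g x\<bar>)" using integrable_abs[OF i] by (simp add: abs_mult)
  let ?A = "LINT x|M. (f x)\<^sup>2" and ?B = "LINT x|M. (g x)\<^sup>2" and ?C = "LINT x|M. \<bar>f x\<bar> * \<bar>g x\<bar>"
  have "(\<integral>\<^sup>+x. ennreal \<bar>f x\<bar> * ennreal \<bar>g x\<bar> \<partial>M)\<^sup>2
      \<le> (\<integral>\<^sup>+x. ennreal \<bar>f x\<bar> ^ 2 \<partial>M) * (\<integral>\<^sup>+x. ennreal \<bar>g x\<bar> ^ 2 \<partial>M)"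
    by (intro Cauchy_Schwarz_nn_integral) auto
  also have "(\<integral>\<^sup>+x. ennreal \<bar>f x\<bar> * ennreal \<bar>g x\<bar> \<partial>M) = ennreal ?C"
    by (simp add: nn_integral_eq_integral[OF ia] flip: ennreal_mult)
  also have "(\<integral>\<^sup>+x. ennreal \<bar>f x\<bar> ^ 2 \<partial>M) = ennreal ?A"
    by (simp add: ennreal_power nn_integral_eq_integral[OF f2])
  also have "(\<integral>\<^sup>+x. ennreal \<bar>g x\<bar> ^ 2 \<partial>M) = ennreal ?B"
    by (simp add: ennreal_power nn_integral_eq_integral[OF g2])
  finally have "?C\<^sup>2 \<le> ?A * ?B"
    by (simp add: ennreal_power flip: ennreal_mult)
  then have "?C \<le> sqrt (?A * ?B)" by (rule real_le_rsqrt)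
  moreover have "\<bar>LINT x|M. f x * g x\<bar> \<le> ?C"
    using integral_abs_bound[of M "\<lambda>x. f x * g x"] by (simp add: abs_mult)
  ultimately show "\<bar>LINT x|M. f x * g x\<bar> \<le> sqrt ?A * sqrt ?B" by (simp add: real_sqrt_mult)
qed

lemma power_tangent:
  fixes t m :: real
  assumes "0 \<le> t" "0 \<le> m"
  shows "m ^ Suc p + real (Suc p) * m ^ p * (t - m) \<le> t ^ Suc p"
proof (induction p)
  case (Suc p)
  have "m ^ Suc (Suc p) + real (Suc (Suc p)) * m ^ Suc p * (t - m)
      = t * (m ^ Suc p + real (Suc p) * m ^ p * (t - m)) - real (Suc p) * m ^ p * (t - m)\<^sup>2"
    by (simp add: algebra_simps power2_eq_square)
  also have "\<dots> \<le> t * (m ^ Suc p + real (Suc p) * m ^ p * (t - m))"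
    using assms by simp
  also have "\<dots> \<le> t * t ^ Suc p" using Suc assms by (intro mult_left_mono) auto
  finally show ?case by simp
qed simp

lemma abs_add_power_le: "\<bar>a + b :: real\<bar> ^ p \<le> 2 ^ p * (\<bar>a\<bar> ^ p + \<bar>b\<bar> ^ p)"
proof -
  have "\<bar>a + b\<bar> ^ p \<le> (2 * max \<bar>a\<bar> \<bar>b\<bar>) ^ p" by (intro power_mono) auto
  also have "\<dots> = 2 ^ p * max \<bar>a\<bar> \<bar>b\<bar> ^ p" by (rule power_mult_distrib)
  also have "\<dots> \<le> 2 ^ p * (\<bar>a\<bar> ^ p + \<bar>b\<bar> ^ p)" by (intro mult_left_mono) (auto simp: max_def)
  finally show ?thesis .
qed

lemma integral_power_tendsto_zero:
  fixes f :: "nat \<Rightarrow> 'a \<Rightarrow> real"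
  assumes "\<And>n. f n \<in> borel_measurable M" "integrable M w"
    and "AE x in M. (\<lambda>n. f n x) \<longlonglongrightarrow> 0" "\<And>n. AE x in M. \<bar>f n x\<bar> ^ Suc p \<le> w x"
  shows "(\<lambda>n. LINT x|M. \<bar>f n x\<bar> ^ Suc p) \<longlonglongrightarrow> 0" "\<And>n. integrable M (\<lambda>x. \<bar>f n x\<bar> ^ Suc p)"
proof -
  have lim: "AE x in M. (\<lambda>n. \<bar>f n x\<bar> ^ Suc p) \<longlonglongrightarrow> 0"
    using assms(3)
  proof eventually_elim
    case (elim x)
    then show ?case using tendsto_power[OF tendsto_rabs[OF elim], of "Suc p"] by simp
  qed
  have m: "(\<lambda>x. \<bar>f n x\<bar> ^ Suc p) \<in> borel_measurable M" for n using assms(1)[of n] by measurable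
  have b: "AE x in M. norm (\<bar>f n x\<bar> ^ Suc p) \<le> w x" for n using assms(4)[of n] by simp
  have "(\<lambda>n. LINT x|M. \<bar>f n x\<bar> ^ Suc p) \<longlonglongrightarrow> (LINT x|M. 0)"
    by (rule integral_dominated_convergence[OF _ m assms(2) lim b]) simp
  then show "(\<lambda>n. LINT x|M. \<bar>f n x\<bar> ^ Suc p) \<longlonglongrightarrow> 0" by simp
  show "integrable M (\<lambda>x. \<bar>f n x\<bar> ^ Suc p)" for n
  proof (rule Bochner_Integration.integrable_bound[OF assms(2) m])
    show "AE x in M. norm (\<bar>f n x\<bar> ^ Suc p) \<le> norm (w x)" using b[of n] by eventually_elim auto
  qed
qed

lemma continuous_lebesgue:
  fixes g :: "real^'n::finite \<Rightarrow> real"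
  shows "continuous_on UNIV g \<Longrightarrow> g \<in> borel_measurable lebesgue"
  by (intro measurable_completion) (simp add: borel_measurable_continuous_onI)

text \<open>Measurable functions are almost everywhere limits of continuous ones. Clamping the approximants and
  cutting them off keeps their limit and gives a dominating function.\<close>

lemma bounded_approximate_continuous:
  fixes h :: "real^'n::finite \<Rightarrow> real"
  assumes h: "h \<in> borel_measurable lebesgue" and M: "\<And>x. \<bar>h x\<bar> \<le> M" and R: "\<And>x. norm x > R \<Longrightarrow> h x = 0" and "e > 0"
  obtains g where "continuous_on UNIV g" "\<And>x. norm x > R + 1 \<Longrightarrow> g x = 0"
    "integrable lebesgue (\<lambda>x. \<bar>h x - g x\<bar> ^ Suc p)" "(LINT x|lebesgue. \<bar>h x - g x\<bar> ^ Suc p) < e"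
proof -
  have M0: "M \<ge> 0" using M[of 0] by linarith
  have "h measurable_on UNIV"
    using h by (simp add: measurable_on_iff_borel_measurable)
  then obtain N G where N: "negligible N" and G: "\<And>n. continuous_on UNIV (G n)"
    and lim: "\<And>x. x \<notin> N \<Longrightarrow> (\<lambda>n. G n x) \<longlonglongrightarrow> h x"
    unfolding measurable_on_def by auto
  define \<psi> :: "real^'n \<Rightarrow> real" where "\<psi> = (\<lambda>x. max 0 (min 1 (R + 1 - norm x)))"
  define g where "g = (\<lambda>n x. max (-M) (min M (G n x)) * \<psi> x)"
  have cont: "continuous_on UNIV (g n)" for n
    unfolding g_def \<psi>_def by (intro continuous_intros G)
  have supp: "g n x = 0" if "norm x > R + 1" for n x using that by (simp add: g_def \<psi>_def)
  have gb: "\<bar>g n x\<bar> \<le> M" for n x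
  proof -
    have "\<bar>max (-M) (min M (G n x))\<bar> \<le> M" "\<bar>\<psi> x\<bar> \<le> 1" using M0 by (auto simp: \<psi>_def)
    then have "\<bar>max (-M) (min M (G n x))\<bar> * \<bar>\<psi> x\<bar> \<le> M * 1" by (intro mult_mono) auto
    then show ?thesis by (simp add: g_def abs_mult)
  qed
  have li: "(\<lambda>n. LINT x|lebesgue. \<bar>h x - g n x\<bar> ^ Suc p) \<longlonglongrightarrow> 0 \<and> (\<forall>n. integrable lebesgue (\<lambda>x. \<bar>h x - g n x\<bar> ^ Suc p))"
  proof -
    have a: "(\<lambda>x. h x - g n x) \<in> borel_measurable lebesgue" for n
      by (intro borel_measurable_diff h continuous_lebesgue cont)
    have w: "integrable lebesgue (\<lambda>x::real^'n. (2 * M) ^ Suc p * indicator (cball 0 (R + 1)) x)"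
      by (intro integrable_mult_right integrable_indicator_cball)
    have "(\<lambda>n. h x - g n x) \<longlonglongrightarrow> 0" if "x \<notin> N" for x
    proof (cases "norm x > R")
      case True
      have "(\<lambda>n. h x - g n x) \<longlonglongrightarrow> h x - max (-M) (min M (h x)) * \<psi> x"
        unfolding g_def by (intro tendsto_intros lim that)
      then show ?thesis using R[OF True] M0 by simp
    next
      case False
      have "(\<lambda>n. h x - g n x) \<longlonglongrightarrow> h x - max (-M) (min M (h x)) * \<psi> x"
        unfolding g_def by (intro tendsto_intros lim that)
      moreover have "max (-M) (min M (h x)) = h x" "\<psi> x = 1"
        using M[of x] False by (auto simp: \<psi>_def)
      ultimately show ?thesis by simp
    qed
    moreover have "AE x in lebesgue. x \<notin> N"
      using N by (intro AE_not_in) (simp add: negligible_iff_null_sets)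
    ultimately have b: "AE x in lebesgue. (\<lambda>n. h x - g n x) \<longlonglongrightarrow> 0"
      by (auto elim: eventually_mono)
    have "\<bar>h x - g n x\<bar> ^ Suc p \<le> (2 * M) ^ Suc p * indicator (cball 0 (R + 1)) x" for n x
    proof (cases "norm x > R + 1")
      case False
      have "\<bar>h x - g n x\<bar> \<le> 2 * M" using M[of x] gb[of n x] by linarith
      then have "\<bar>h x - g n x\<bar> ^ Suc p \<le> (2 * M) ^ Suc p" by (intro power_mono) auto
      with False show ?thesis by simp
    qed (use R[of x] supp[of x n] in simp)
    then have c: "AE x in lebesgue. \<bar>h x - g n x\<bar> ^ Suc p \<le> (2 * M) ^ Suc p * indicator (cball 0 (R + 1)) x" for n
      by simp
    show ?thesis using integral_power_tendsto_zero[OF a w b c] by blast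
  qed
  obtain n where "(LINT x|lebesgue. \<bar>h x - g n x\<bar> ^ Suc p) < e" "integrable lebesgue (\<lambda>x. \<bar>h x - g n x\<bar> ^ Suc p)"
    using order_tendstoD(2)[OF conjunct1[OF li] \<open>e > 0\<close>, unfolded eventually_sequentially] conjunct2[OF li] by blast
  with that cont supp show ?thesis by blast
qed

lemma Lp_approximate_continuous:
  fixes h :: "real^'n::finite \<Rightarrow> real"
  assumes h: "h \<in> borel_measurable lebesgue" and hp: "integrable lebesgue (\<lambda>x. \<bar>h x\<bar> ^ Suc p)" and "e > 0"
  obtains g R where "continuous_on UNIV g" "\<And>x. norm x > R \<Longrightarrow> g x = 0"
    "integrable lebesgue (\<lambda>x. \<bar>h x - g x\<bar> ^ Suc p)" "(LINT x|lebesgue. \<bar>h x - g x\<bar> ^ Suc p) < e"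
proof -
  define T where "T = (\<lambda>n x. if norm x \<le> real n \<and> \<bar>h x\<bar> \<le> real n then h x else 0)"
  have Tm: "T n \<in> borel_measurable lebesgue" for n
  proof -
    have "{x \<in> space lebesgue. norm x \<le> real n \<and> \<bar>h x\<bar> \<le> real n} \<in> sets lebesgue"
    proof -
      have "(\<lambda>x::real^'n. norm x) \<in> borel_measurable lebesgue" by (intro measurable_completion) simp
      then show ?thesis using h by measurable
    qed
    then show ?thesis unfolding T_def by (intro measurable_If h) auto
  qed
  have li: "(\<lambda>n. LINT x|lebesgue. \<bar>h x - T n x\<bar> ^ Suc p) \<longlonglongrightarrow> 0 \<and> (\<forall>n. integrable lebesgue (\<lambda>x. \<bar>h x - T n x\<bar> ^ Suc p))"
  proof -
    have a: "(\<lambda>x. h x - T n x) \<in> borel_measurable lebesgue" for n using h Tm by simp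
    have "(\<lambda>n. h x - T n x) \<longlonglongrightarrow> 0" for x
    proof (rule tendsto_eventually)
      show "\<forall>\<^sub>F n in sequentially. h x - T n x = 0"
        using eventually_ge_at_top[of "nat \<lceil>max (norm x) \<bar>h x\<bar>\<rceil>"]
        by eventually_elim (simp add: T_def nat_ceiling_le_eq)
    qed
    then have b: "AE x in lebesgue. (\<lambda>n. h x - T n x) \<longlonglongrightarrow> 0" by simp
    have c: "AE x in lebesgue. \<bar>h x - T n x\<bar> ^ Suc p \<le> \<bar>h x\<bar> ^ Suc p" for n
      by (intro AE_I2 power_mono) (auto simp: T_def)
    show ?thesis using integral_power_tendsto_zero[OF a hp b c] by blast
  qed
  have e2: "e / (2 * 2 ^ Suc p) > 0" using \<open>e > 0\<close> by simp
  obtain n where n: "(LINT x|lebesgue. \<bar>h x - T n x\<bar> ^ Suc p) < e / (2 * 2 ^ Suc p)"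
    and ni: "integrable lebesgue (\<lambda>x. \<bar>h x - T n x\<bar> ^ Suc p)"
    using order_tendstoD(2)[OF conjunct1[OF li] e2, unfolded eventually_sequentially] conjunct2[OF li] by blast
  obtain g where g: "continuous_on UNIV g" "\<And>x. norm x > real n + 1 \<Longrightarrow> g x = 0"
    "integrable lebesgue (\<lambda>x. \<bar>T n x - g x\<bar> ^ Suc p)" "(LINT x|lebesgue. \<bar>T n x - g x\<bar> ^ Suc p) < e / (2 * 2 ^ Suc p)"
    by (rule bounded_approximate_continuous[OF Tm, of n "real n" "real n" "e / (2 * 2 ^ Suc p)" p])
      (use e2 in \<open>auto simp: T_def\<close>)
  have gm: "g \<in> borel_measurable lebesgue"
    by (rule continuous_lebesgue[OF g(1)])
  have bd: "\<bar>h x - g x\<bar> ^ Suc p \<le> 2 ^ Suc p * (\<bar>h x - T n x\<bar> ^ Suc p + \<bar>T n x - g x\<bar> ^ Suc p)" for x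
    using abs_add_power_le[of "h x - T n x" "T n x - g x" "Suc p"] by simp
  have ii: "integrable lebesgue (\<lambda>x. 2 ^ Suc p * (\<bar>h x - T n x\<bar> ^ Suc p + \<bar>T n x - g x\<bar> ^ Suc p))"
    using ni g(3) by (intro integrable_mult_right Bochner_Integration.integrable_add)
  have hg: "integrable lebesgue (\<lambda>x. \<bar>h x - g x\<bar> ^ Suc p)"
  proof (rule integrable_dominated[OF _ ii])
    show "(\<lambda>x. \<bar>h x - g x\<bar> ^ Suc p) \<in> borel_measurable lebesgue" using h gm by measurable
    show "\<bar>\<bar>h x - g x\<bar> ^ Suc p\<bar> \<le> 2 ^ Suc p * (\<bar>h x - T n x\<bar> ^ Suc p + \<bar>T n x - g x\<bar> ^ Suc p)" for x
      using bd[of x] by (simp del: power_Suc)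
  qed
  have "(LINT x|lebesgue. \<bar>h x - g x\<bar> ^ Suc p) \<le> 2 ^ Suc p * ((LINT x|lebesgue. \<bar>h x - T n x\<bar> ^ Suc p) + (LINT x|lebesgue. \<bar>T n x - g x\<bar> ^ Suc p))"
    using integral_mono[OF hg ii bd] ni g(3) by (simp only: integral_mult_right_zero Bochner_Integration.integral_add[OF ni g(3)])
  also have "\<dots> < 2 ^ Suc p * (e / (2 * 2 ^ Suc p) + e / (2 * 2 ^ Suc p))"
    using n g(4) by (intro mult_strict_left_mono add_strict_mono) auto
  also have "\<dots> = e" by simp
  finally show ?thesis using that g(1,2) hg by blast
qed

lemma Lp_locally_integrable:
  fixes h :: "real^'m::finite \<Rightarrow> real"
  assumes "h \<in> borel_measurable lebesgue" "locally_integrable (\<lambda>x. \<bar>h x\<bar> ^ Suc p)"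
  shows "locally_integrable h"
proof (rule locally_integrableI[OF assms(1)])
  fix R
  have "integrable lebesgue (\<lambda>x. indicator (cball 0 R) x + indicator (cball (0::real^'m) R) x * \<bar>h x\<bar> ^ Suc p)"
    by (intro Bochner_Integration.integrable_add integrable_indicator_cball locally_integrable_cball assms)
  then show "integrable lebesgue (\<lambda>x. indicator (cball (0::real^'m) R) x * (1 + \<bar>h x\<bar> ^ Suc p))"
    by (simp add: distrib_left)
next
  fix x
  show "\<bar>h x\<bar> \<le> 1 + \<bar>h x\<bar> ^ Suc p"
  proof (cases "\<bar>h x\<bar> \<le> 1")
    case True
    have "\<bar>h x\<bar> ^ Suc p \<ge> 0" by simp
    with True show ?thesis by linarith
  next
    case False
    then have "\<bar>h x\<bar> ^ 1 \<le> \<bar>h x\<bar> ^ Suc p" by (intro power_increasing) auto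
    then show ?thesis by simp
  qed
qed

lemma sigma_finite_lebesgue: "sigma_finite_measure (lebesgue :: (real^'n::finite) measure)"
proof
  have "(\<Union>n. cball (0::real^'n) (real n)) = UNIV"
    using real_arch_simple by (auto simp: dist_norm)
  moreover have "emeasure lebesgue (cball (0::real^'n) (real n)) \<noteq> \<infinity>" for n
    using emeasure_bounded_finite[of "cball (0::real^'n) (real n)"] by auto
  ultimately show "\<exists>A. countable A \<and> A \<subseteq> sets (lebesgue :: (real^'n) measure) \<and> \<Union> A = space lebesgue
      \<and> (\<forall>a\<in>A. emeasure lebesgue a \<noteq> \<infinity>)"
    by (intro exI[of _ "range (\<lambda>n. cball (0::real^'n) (real n))"]) auto
qed

definition rescaled :: "(real^'n::finite \<Rightarrow> real) \<Rightarrow> real \<Rightarrow> real^'n \<Rightarrow> real" where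
  "rescaled \<eta> r x = \<eta> (x /\<^sub>R r) / r ^ CARD('n)"

locale mollifier =
  fixes \<eta> :: "real^'n::finite \<Rightarrow> real"
  assumes test: "test_function \<eta>"
    and nonneg: "0 \<le> \<eta> x"
    and integral_one: "(LINT x|lebesgue. \<eta> x) = 1"
    and support: "norm x > 1 \<Longrightarrow> \<eta> x = 0"
begin

abbreviation "mollify r \<equiv> convolution (rescaled \<eta> r)"

lemma test_rescaled: "r > 0 \<Longrightarrow> test_function (rescaled \<eta> r)"
  unfolding rescaled_def
  using test_function_cmult[OF test_function_affine[OF test, of "inverse r" 0], of "1 / r ^ CARD('n)"] by simp

lemma rescaled_nonneg: "r > 0 \<Longrightarrow> 0 \<le> rescaled \<eta> r x"
  unfolding rescaled_def using nonneg by simp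

lemma rescaled_support: "r > 0 \<Longrightarrow> norm x > r \<Longrightarrow> rescaled \<eta> r x = 0"
  unfolding rescaled_def by (subst support) (auto simp: field_simps)

lemma integral_rescaled: "r > 0 \<Longrightarrow> (LINT x|lebesgue. rescaled \<eta> r x) = 1"
  using integral_lebesgue_affine[OF smooth_borel[OF test_function_smooth[OF test]], of "inverse r" 0] integral_one
  by (simp add: rescaled_def divide_inverse power_inverse mult.commute)

lemma integral_rescaled_reflect: "r > 0 \<Longrightarrow> (LINT y|lebesgue. rescaled \<eta> r (x - y)) = 1"
  using integral_lebesgue_reflect[of "rescaled \<eta> r" x] integral_rescaled
    smooth_borel[OF test_function_smooth[OF test_rescaled]] by simp

text \<open>Jensen's inequality, from the tangent line of the power at the mean of \<open>|f|\<close>.\<close>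

lemma mollification_power_le:
  assumes r: "r > 0" and f: "locally_integrable f" and fp: "locally_integrable (\<lambda>y. \<bar>f y\<bar> ^ Suc p)"
  shows "\<bar>mollify r f x\<bar> ^ Suc p \<le> mollify r (\<lambda>y. \<bar>f y\<bar> ^ Suc p) x"
proof -
  let ?k = "\<lambda>y. rescaled \<eta> r (x - y)"
  define m where "m = (LINT y|lebesgue. \<bar>?k y * f y\<bar>)"
  have i: "integrable lebesgue (\<lambda>y. ?k y * f y)" by (rule convolution_integrable[OF test_rescaled[OF r] f])
  have ip: "integrable lebesgue (\<lambda>y. ?k y * \<bar>f y\<bar> ^ Suc p)" by (rule convolution_integrable[OF test_rescaled[OF r] fp])
  have ik: "integrable lebesgue ?k" by (intro integrable_test_function test_function_reflect test_rescaled r)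
  have k0: "?k y \<ge> 0" for y by (rule rescaled_nonneg[OF r])
  have ia: "integrable lebesgue (\<lambda>y. ?k y * \<bar>f y\<bar>)" using i[THEN integrable_abs] k0 by (simp add: abs_mult)
  have m: "m = (LINT y|lebesgue. ?k y * \<bar>f y\<bar>)" using k0 by (simp add: m_def abs_mult)
  have m0: "m \<ge> 0" by (simp add: m_def)
  have le: "\<bar>mollify r f x\<bar> \<le> m"
    unfolding convolution_def m_def by (rule integral_abs_bound)
  have "m ^ Suc p = (LINT y|lebesgue. m ^ Suc p * ?k y + real (Suc p) * m ^ p * (?k y * \<bar>f y\<bar> - m * ?k y))"
    using ik ia integral_rescaled_reflect[OF r, of x] by (simp add: m[symmetric] del: power_Suc)
  also have "\<dots> \<le> (LINT y|lebesgue. ?k y * \<bar>f y\<bar> ^ Suc p)"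
  proof (rule integral_mono[OF _ ip])
    show "integrable lebesgue (\<lambda>y. m ^ Suc p * ?k y + real (Suc p) * m ^ p * (?k y * \<bar>f y\<bar> - m * ?k y))"
      using ik ia by simp
    fix y
    have "?k y * (m ^ Suc p + real (Suc p) * m ^ p * (\<bar>f y\<bar> - m)) \<le> ?k y * \<bar>f y\<bar> ^ Suc p"
      by (intro mult_left_mono power_tangent k0 m0) auto
    then show "m ^ Suc p * ?k y + real (Suc p) * m ^ p * (?k y * \<bar>f y\<bar> - m * ?k y) \<le> ?k y * \<bar>f y\<bar> ^ Suc p"
      by (simp add: algebra_simps)
  qed
  finally have "m ^ Suc p \<le> mollify r (\<lambda>y. \<bar>f y\<bar> ^ Suc p) x" by (simp add: convolution_def)
  moreover have "\<bar>mollify r f x\<bar> ^ Suc p \<le> m ^ Suc p" using le by (intro power_mono) auto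
  ultimately show ?thesis by linarith
qed

text \<open>Tonelli's theorem on the product of the completed measures; the kernel is Borel.\<close>

lemma nn_integral_mollification:
  assumes r: "r > 0" and f: "locally_integrable f" and f0: "\<And>x. 0 \<le> f x"
  shows "(\<integral>\<^sup>+x. ennreal (mollify r f x) \<partial>lebesgue) = (\<integral>\<^sup>+x. ennreal (f x) \<partial>lebesgue)"
proof -
  let ?k = "rescaled \<eta> r"
  interpret L: pair_sigma_finite "lebesgue :: (real^'n) measure" "lebesgue :: (real^'n) measure"
    by (intro pair_sigma_finite.intro sigma_finite_lebesgue)
  have fm: "f \<in> borel_measurable lebesgue" by (rule locally_integrable_measurable[OF f])
  have km: "?k \<in> borel_measurable borel" by (intro smooth_borel test_function_smooth test_rescaled r)
  have idm: "(\<lambda>x::real^'n. x) \<in> borel_measurable lebesgue" by (intro measurable_completion) simp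
  have dm: "(\<lambda>p. fst p - snd p) \<in> borel_measurable ((lebesgue :: (real^'n) measure) \<Otimes>\<^sub>M lebesgue)"
    by (intro borel_measurable_diff measurable_compose[OF measurable_fst idm] measurable_compose[OF measurable_snd idm])
  have meas: "(\<lambda>(x, y). ennreal (?k (x - y) * f y)) \<in> borel_measurable (lebesgue \<Otimes>\<^sub>M lebesgue)"
    unfolding case_prod_beta
    by (intro measurable_compose[OF _ measurable_ennreal] borel_measurable_times
        measurable_compose[OF dm km] measurable_compose[OF measurable_snd fm])
  have "(\<integral>\<^sup>+x. ennreal (convolution ?k f x) \<partial>lebesgue) = (\<integral>\<^sup>+x. \<integral>\<^sup>+y. ennreal (?k (x - y) * f y) \<partial>lebesgue \<partial>lebesgue)"
    unfolding convolution_def using rescaled_nonneg[OF r] f0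
    by (intro nn_integral_cong nn_integral_eq_integral[symmetric] convolution_integrable[OF test_rescaled[OF r] f]) auto
  also have "\<dots> = (\<integral>\<^sup>+y. \<integral>\<^sup>+x. ennreal (?k (x - y) * f y) \<partial>lebesgue \<partial>lebesgue)"
    using L.Fubini'[OF meas] by simp
  also have "\<dots> = (\<integral>\<^sup>+y. ennreal (f y) \<partial>lebesgue)"
  proof (rule nn_integral_cong)
    fix y
    have "(\<integral>\<^sup>+x. ennreal (?k (x - y) * f y) \<partial>lebesgue) = (\<integral>\<^sup>+x. ennreal (?k (x - y)) \<partial>lebesgue) * ennreal (f y)"
    proof -
      have "(\<lambda>x. ?k (x - y)) \<in> borel_measurable lebesgue"
        using smooth_lebesgue[OF test_function_smooth[OF test_function_affine[OF test_rescaled[OF r], of 1 "-y"]]] by simp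
      then show ?thesis using f0 rescaled_nonneg[OF r] by (simp add: ennreal_mult nn_integral_multc)
    qed
    also have "(\<integral>\<^sup>+x. ennreal (?k (x - y)) \<partial>lebesgue) = (\<integral>\<^sup>+x. ennreal (?k x) \<partial>lebesgue)"
      by (rule nn_integral_lebesgue_shift) (use km in measurable)
    also have "\<dots> = 1"
      using nn_integral_eq_integral[OF integrable_test_function[OF test_rescaled[OF r]]] rescaled_nonneg[OF r]
        integral_rescaled[OF r] by simp
    finally show "(\<integral>\<^sup>+x. ennreal (?k (x - y) * f y) \<partial>lebesgue) = ennreal (f y)" by simp
  qed
  finally show ?thesis .
qed

lemma Lp_mollification_le:
  assumes r: "r > 0" and f: "locally_integrable f" and fp: "integrable lebesgue (\<lambda>y. \<bar>f y\<bar> ^ Suc p)"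
  shows "integrable lebesgue (\<lambda>x. \<bar>mollify r f x\<bar> ^ Suc p)"
    and "(LINT x|lebesgue. \<bar>mollify r f x\<bar> ^ Suc p) \<le> (LINT x|lebesgue. \<bar>f x\<bar> ^ Suc p)"
proof -
  let ?F = "\<lambda>x. \<bar>mollify r f x\<bar> ^ Suc p"
  have fpl: "locally_integrable (\<lambda>y. \<bar>f y\<bar> ^ Suc p)"
    by (rule locally_integrable_of_integrable[OF fp])
  have m: "?F \<in> borel_measurable lebesgue"
    by (intro borel_measurable_power borel_measurable_abs smooth_lebesgue smooth_convolution test_rescaled r f)
  have "(\<integral>\<^sup>+x. ennreal (?F x) \<partial>lebesgue)
      \<le> (\<integral>\<^sup>+x. ennreal (mollify r (\<lambda>y. \<bar>f y\<bar> ^ Suc p) x) \<partial>lebesgue)"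
    by (intro nn_integral_mono ennreal_leI mollification_power_le[OF r f fpl])
  also have "\<dots> = (\<integral>\<^sup>+x. ennreal (\<bar>f x\<bar> ^ Suc p) \<partial>lebesgue)"
    by (rule nn_integral_mollification[OF r fpl]) simp
  also have "\<dots> = ennreal (LINT x|lebesgue. \<bar>f x\<bar> ^ Suc p)"
    by (rule nn_integral_eq_integral[OF fp]) simp
  finally have le: "(\<integral>\<^sup>+x. ennreal (?F x) \<partial>lebesgue) \<le> ennreal (LINT x|lebesgue. \<bar>f x\<bar> ^ Suc p)" .
  show i: "integrable lebesgue ?F"
  proof (rule integrableI_bounded[OF m])
    have eq: "norm (?F x) = ?F x" for x by (simp del: power_Suc)
    show "(\<integral>\<^sup>+x. ennreal (norm (?F x)) \<partial>lebesgue) < \<infinity>"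
      unfolding eq using le_less_trans[OF le ennreal_less_top] by (simp only: infinity_ennreal_def)
  qed
  have "ennreal (integral\<^sup>L lebesgue ?F) \<le> ennreal (LINT x|lebesgue. \<bar>f x\<bar> ^ Suc p)"
    using le nn_integral_eq_integral[OF i] by simp
  then show "integral\<^sup>L lebesgue ?F \<le> (LINT x|lebesgue. \<bar>f x\<bar> ^ Suc p)"
    by (subst (asm) ennreal_le_iff) auto
qed

text \<open>The mollification is a contraction of \<open>L\<^sup>p\<close>, so it is enough to prove convergence on the
  dense set of compactly supported continuous functions, where it is uniform.\<close>

lemma mollification_tendsto:
  assumes h: "h \<in> borel_measurable lebesgue" and hp: "integrable lebesgue (\<lambda>x. \<bar>h x\<bar> ^ Suc p)"
  shows "((\<lambda>r. LINT x|lebesgue. \<bar>mollify r h x - h x\<bar> ^ Suc p) \<longlongrightarrow> 0) (at_right 0)"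
proof (rule tendstoI)
  fix e :: real assume e: "e > 0"
  define C where "C = (4::real) ^ Suc p"
  have C0: "C > 0" by (simp add: C_def)
  have three: "\<bar>a + b + c\<bar> ^ Suc p \<le> C * (\<bar>a\<bar> ^ Suc p + \<bar>b\<bar> ^ Suc p + \<bar>c\<bar> ^ Suc p)" for a b c :: real
  proof -
    have C: "C = 2 ^ Suc p * 2 ^ Suc p" by (simp add: C_def power_mult_distrib[symmetric] del: power_Suc)
    have one: "(1::real) \<le> 2 ^ Suc p" by (rule one_le_power) simp
    have "\<bar>a + b + c\<bar> ^ Suc p \<le> 2 ^ Suc p * (\<bar>a + b\<bar> ^ Suc p + \<bar>c\<bar> ^ Suc p)" by (rule abs_add_power_le)
    also have "\<dots> \<le> 2 ^ Suc p * (2 ^ Suc p * (\<bar>a\<bar> ^ Suc p + \<bar>b\<bar> ^ Suc p) + 2 ^ Suc p * \<bar>c\<bar> ^ Suc p)"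
    proof (intro mult_left_mono add_mono abs_add_power_le)
      show "\<bar>c\<bar> ^ Suc p \<le> 2 ^ Suc p * \<bar>c\<bar> ^ Suc p"
        using mult_right_mono[OF one, of "\<bar>c\<bar> ^ Suc p"] by (simp del: power_Suc)
    qed simp
    also have "\<dots> = C * (\<bar>a\<bar> ^ Suc p + \<bar>b\<bar> ^ Suc p + \<bar>c\<bar> ^ Suc p)"
      unfolding C by (simp add: algebra_simps del: power_Suc)
    finally show ?thesis .
  qed
  define d where "d = e / (4 * C)"
  have d: "d > 0" using e C0 by (simp add: d_def)
  obtain g R where g: "continuous_on UNIV g" and gR: "\<And>x. norm x > R \<Longrightarrow> g x = 0"
    and hg: "integrable lebesgue (\<lambda>x. \<bar>h x - g x\<bar> ^ Suc p)" "(LINT x|lebesgue. \<bar>h x - g x\<bar> ^ Suc p) < d"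
    by (rule Lp_approximate_continuous[OF h hp d]) blast
  have gm: "g \<in> borel_measurable lebesgue" by (rule continuous_lebesgue[OF g])
  have comp: "bounded (g ` cball 0 R)"
    by (intro compact_imp_bounded compact_continuous_image continuous_on_subset[OF g]) auto
  then obtain B where "\<And>x. x \<in> cball 0 R \<Longrightarrow> \<bar>g x\<bar> \<le> B"
    unfolding bounded_iff by (metis imageI real_norm_def)
  then have B: "\<bar>g x\<bar> \<le> \<bar>B\<bar>" for x using gR[of x] by (cases "norm x \<le> R") force+
  have gl: "locally_integrable g"
    by (rule locally_integrableI[OF gm, of "\<lambda>x. \<bar>B\<bar>"])
      (simp_all add: B integrable_indicator_cball)
  have loc: "locally_integrable k"
    if "k \<in> borel_measurable lebesgue" "integrable lebesgue (\<lambda>x. \<bar>k x\<bar> ^ Suc p)" for k :: "real^'n \<Rightarrow> real"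
    by (rule Lp_locally_integrable[OF that(1) locally_integrable_of_integrable[OF that(2)]])
  have hl: "locally_integrable h" by (rule loc[OF h hp])
  have hgl: "locally_integrable (\<lambda>x. h x - g x)" by (rule loc[OF borel_measurable_diff[OF h gm] hg(1)])
  \<comment> \<open>an error of at most \<open>t\<close> on the ball of radius \<open>R + 1\<close> costs at most \<open>d\<close>\<close>
  define m where "m = measure lebesgue (cball (0::real^'n) (R + 1))"
  have m0: "m \<ge> 0" by (simp add: m_def)
  define t where "t = min 1 (d / (m + 1))"
  have t: "0 < t" "t \<le> 1" using d m0 by (auto simp: t_def)
  have t3: "t * (m + 1) \<le> d"
  proof -
    have "t * (m + 1) \<le> d / (m + 1) * (m + 1)" using m0 by (intro mult_right_mono) (auto simp: t_def)
    also have "\<dots> = d" using m0 by simp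
    finally show ?thesis .
  qed
  have tm: "t ^ Suc p * m \<le> d"
  proof -
    have "t ^ Suc p \<le> t ^ 1" using t by (intro power_decreasing) auto
    then have "t ^ Suc p * m \<le> t * m" using m0 by (simp add: mult_right_mono)
    also have "\<dots> \<le> t * (m + 1)" using t by simp
    finally show ?thesis using t3 by simp
  qed
  have "uniformly_continuous_on (cball 0 (R + 2)) g"
    by (intro compact_uniformly_continuous continuous_on_subset[OF g]) auto
  then obtain s where s: "s > 0" "\<And>x y. norm x \<le> R + 2 \<Longrightarrow> norm y \<le> R + 2 \<Longrightarrow> dist y x < s \<Longrightarrow> dist (g y) (g x) < t"
    unfolding uniformly_continuous_on_def using t(1) by (metis mem_cball_0)
  have "(LINT x|lebesgue. \<bar>mollify r h x - h x\<bar> ^ Suc p) < e" if r: "0 < r" "r < min s 1" for r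
  proof -
    let ?k = "rescaled \<eta> r"
    have near: "\<bar>convolution ?k g x - g x\<bar> \<le> t * indicator (cball 0 (R + 1)) x" for x
    proof (cases "norm x \<le> R + 1")
      case True
      have i: "integrable lebesgue (\<lambda>y. ?k (x - y) * g y)" "integrable lebesgue (\<lambda>y. ?k (x - y))"
        by (intro convolution_integrable test_rescaled gl r integrable_test_function test_function_reflect)+
      have "convolution ?k g x - g x = (LINT y|lebesgue. ?k (x - y) * g y - ?k (x - y) * g x)"
        using i integral_rescaled_reflect[OF r(1), of x] by (simp add: convolution_def)
      also have "\<bar>\<dots>\<bar> \<le> (LINT y|lebesgue. ?k (x - y) * t)"
      proof (rule Bochner_Integration.integral_abs_bound_integral)
        show "integrable lebesgue (\<lambda>y. ?k (x - y) * g y - ?k (x - y) * g x)" "integrable lebesgue (\<lambda>y. ?k (x - y) * t)"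
          using i by auto
        fix y
        show "\<bar>?k (x - y) * g y - ?k (x - y) * g x\<bar> \<le> ?k (x - y) * t"
        proof (cases "norm (x - y) \<le> r")
          case False
          then show ?thesis using rescaled_support[OF r(1), of "x - y"] by simp
        next
          case n: True
          have "norm y \<le> norm x + norm (x - y)" by (metis norm_minus_commute norm_triangle_sub)
          then have "norm y \<le> R + 2" "norm x \<le> R + 2" "dist y x < s"
            using n True r by (auto simp: dist_norm norm_minus_commute)
          then have "dist (g y) (g x) < t" by (intro s(2))
          then have "\<bar>g y - g x\<bar> \<le> t" by (simp add: dist_real_def)
          then show ?thesis
            using rescaled_nonneg[OF r(1), of "x - y"]
            by (simp add: abs_mult mult_left_mono flip: right_diff_distrib)
        qed
      qed
      also have "\<dots> = t" using integral_rescaled_reflect[OF r(1), of x] by simp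
      finally show ?thesis using True by simp
    next
      case False
      have "convolution ?k g x = 0"
        by (rule convolution_outside[of r _ R]) (use rescaled_support[OF r(1)] gR False r in auto)
      then show ?thesis using False gR[of x] by simp
    qed
    have ti: "integrable lebesgue (\<lambda>x. t ^ Suc p * indicator (cball (0::real^'n) (R + 1)) x)"
      by (intro integrable_mult_right integrable_indicator_cball)
    have near': "\<bar>convolution ?k g x - g x\<bar> ^ Suc p \<le> t ^ Suc p * indicator (cball 0 (R + 1)) x" for x
      using power_mono[OF near[of x], of "Suc p"] by (cases "x \<in> cball 0 (R + 1)") auto
    let ?H = "\<lambda>x. C * (\<bar>convolution ?k (\<lambda>x. h x - g x) x\<bar> ^ Suc p + t ^ Suc p * indicator (cball 0 (R + 1)) x + \<bar>h x - g x\<bar> ^ Suc p)"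
    note cl = Lp_mollification_le[OF r(1) hgl hg(1)]
    have Hi: "integrable lebesgue ?H"
      by (intro integrable_mult_right Bochner_Integration.integrable_add cl ti hg)
    have le: "\<bar>convolution ?k h x - h x\<bar> ^ Suc p \<le> ?H x" for x
    proof -
      have "convolution ?k h x - h x = convolution ?k (\<lambda>x. h x - g x) x + (convolution ?k g x - g x) + (g x - h x)"
        by (simp add: convolution_diff_right[OF test_rescaled[OF r(1)] hl gl])
      then have "\<bar>convolution ?k h x - h x\<bar> ^ Suc p \<le> C * (\<bar>convolution ?k (\<lambda>x. h x - g x) x\<bar> ^ Suc p + \<bar>convolution ?k g x - g x\<bar> ^ Suc p + \<bar>g x - h x\<bar> ^ Suc p)"
        using three by metis
      also have "\<dots> \<le> ?H x"
        using near'[of x] C0 by (intro mult_left_mono add_mono) (auto simp: abs_minus_commute)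
      finally show ?thesis .
    qed
    have "(LINT x|lebesgue. \<bar>convolution ?k h x - h x\<bar> ^ Suc p) \<le> integral\<^sup>L lebesgue ?H"
    proof (rule integral_mono_AE'[OF Hi])
      show "AE x in lebesgue. \<bar>convolution ?k h x - h x\<bar> ^ Suc p \<le> ?H x" using le by simp
      show "AE x in lebesgue. 0 \<le> ?H x"
        by (rule AE_I2, rule order_trans[OF _ le]) simp
    qed
    also have "\<dots> = C * ((LINT x|lebesgue. \<bar>convolution ?k (\<lambda>x. h x - g x) x\<bar> ^ Suc p) + t ^ Suc p * m + (LINT x|lebesgue. \<bar>h x - g x\<bar> ^ Suc p))"
      using cl(1) ti hg(1) by (simp add: m_def Bochner_Integration.integrable_add del: power_Suc)
    also have "\<dots> < C * (d + d + d)"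
      using cl(2) tm hg(2) C0 by (intro mult_strict_left_mono) linarith+
    also have "\<dots> < e" using e C0 by (simp add: d_def)
    finally show ?thesis .
  qed
  then have "\<forall>\<^sub>F r in at_right 0. (LINT x|lebesgue. \<bar>mollify r h x - h x\<bar> ^ Suc p) < e"
    unfolding eventually_at_right[OF zero_less_one] using s(1) by (intro exI[of _ "min s 1"]) auto
  then show "\<forall>\<^sub>F r in at_right 0. dist (LINT x|lebesgue. \<bar>mollify r h x - h x\<bar> ^ Suc p) 0 < e"
    by (simp add: dist_real_def del: power_Suc)
qed

lemma local_mollification_tendsto:
  assumes f: "f \<in> borel_measurable lebesgue" and fp: "locally_integrable (\<lambda>x. \<bar>f x\<bar> ^ Suc p)"
  shows "((\<lambda>r. LINT x|lebesgue. indicator (cball 0 S) x * \<bar>mollify r f x - f x\<bar> ^ Suc p) \<longlongrightarrow> 0) (at_right 0)"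
proof -
  define h where "h = (\<lambda>x. indicat_real (cball 0 (S + 1)) x * f x)"
  have hm: "h \<in> borel_measurable lebesgue" unfolding h_def by (intro indicator_borel_mult f) simp
  have eq: "\<bar>h x\<bar> ^ Suc p = indicator (cball 0 (S + 1)) x * \<bar>f x\<bar> ^ Suc p" for x
    by (simp add: h_def indicator_def)
  have hp: "integrable lebesgue (\<lambda>x. \<bar>h x\<bar> ^ Suc p)"
    unfolding eq by (rule locally_integrable_cball[OF fp])
  have hl: "locally_integrable h"
    by (rule Lp_locally_integrable[OF hm locally_integrable_of_integrable[OF hp]])
  show ?thesis
  proof (rule tendsto_sandwich[OF _ _ tendsto_const mollification_tendsto[OF hm hp]])
    show "\<forall>\<^sub>F r in at_right 0. 0 \<le> (LINT x|lebesgue. indicator (cball 0 S) x * \<bar>mollify r f x - f x\<bar> ^ Suc p)"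
      by (intro always_eventually allI integral_nonneg_AE AE_I2) auto
    have "(LINT x|lebesgue. indicator (cball 0 S) x * \<bar>mollify r f x - f x\<bar> ^ Suc p)
        \<le> (LINT x|lebesgue. \<bar>mollify r h x - h x\<bar> ^ Suc p)" if r: "0 < r" "r < 1" for r
    proof (rule integral_mono_AE')
      have bd: "\<bar>mollify r h x - h x\<bar> ^ Suc p \<le> 2 ^ Suc p * (\<bar>mollify r h x\<bar> ^ Suc p + \<bar>h x\<bar> ^ Suc p)" for x
        using abs_add_power_le[of "mollify r h x" "- h x" "Suc p"] by simp
      show "integrable lebesgue (\<lambda>x. \<bar>mollify r h x - h x\<bar> ^ Suc p)"
      proof (rule integrable_dominated)
        show "integrable lebesgue (\<lambda>x. 2 ^ Suc p * (\<bar>mollify r h x\<bar> ^ Suc p + \<bar>h x\<bar> ^ Suc p))"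
          by (intro integrable_mult_right Bochner_Integration.integrable_add hp Lp_mollification_le r hl)
        show "(\<lambda>x. \<bar>mollify r h x - h x\<bar> ^ Suc p) \<in> borel_measurable lebesgue"
          by (intro borel_measurable_power borel_measurable_abs borel_measurable_diff hm
              smooth_lebesgue smooth_convolution test_rescaled r hl)
        show "\<bar>\<bar>mollify r h x - h x\<bar> ^ Suc p\<bar>
          \<le> 2 ^ Suc p * (\<bar>mollify r h x\<bar> ^ Suc p + \<bar>h x\<bar> ^ Suc p)" for x
          using bd[of x] by (simp del: power_Suc)
      qed
      show "AE x in lebesgue. indicator (cball 0 S) x * \<bar>mollify r f x - f x\<bar> ^ Suc p
          \<le> \<bar>mollify r h x - h x\<bar> ^ Suc p"
      proof (rule AE_I2)
        fix x
        show "indicator (cball 0 S) x * \<bar>mollify r f x - f x\<bar> ^ Suc p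
          \<le> \<bar>mollify r h x - h x\<bar> ^ Suc p"
        proof (cases "norm x \<le> S")
          case True
          have "mollify r f x = mollify r h x"
          proof (rule convolution_cong)
            fix y assume "rescaled \<eta> r (x - y) \<noteq> 0"
            then have "norm (x - y) \<le> r" using rescaled_support[OF r(1), of "x - y"] by fastforce
            moreover have "norm y \<le> norm x + norm (x - y)" by (metis norm_minus_commute norm_triangle_sub)
            ultimately show "f y = h y" using True r by (simp add: h_def)
          qed
          moreover have "h x = f x" using True by (simp add: h_def)
          ultimately show ?thesis using True by (simp del: power_Suc)
        qed simp
      qed
      show "AE x in lebesgue. 0 \<le> \<bar>mollify r h x - h x\<bar> ^ Suc p" by simp
    qed
    then show "\<forall>\<^sub>F r in at_right 0. (LINT x|lebesgue. indicator (cball 0 S) x * \<bar>mollify r f x - f x\<bar> ^ Suc p)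
        \<le> (LINT x|lebesgue. \<bar>mollify r h x - h x\<bar> ^ Suc p)"
      unfolding eventually_at_right[OF zero_less_one] by (intro exI[of _ 1]) auto
  qed
qed

end

section \<open>A radial mollifier and the potential of its rescaling\<close>

text \<open>All derivatives of \<open>exp (- 1 / t)\<close>, extended by zero to \<open>t \<le> 0\<close>, have this form.\<close>

definition flat :: "real poly \<Rightarrow> real \<Rightarrow> real" where
  "flat P t = (if t > 0 then poly P (1 / t) * exp (- (1 / t)) else 0)"

lemma flat_tendsto: "(flat P \<longlongrightarrow> 0) (at_right 0)"
proof -
  have "((\<lambda>x::real. poly P x * exp (- x)) \<longlongrightarrow> (\<Sum>i\<le>degree P. coeff P i * 0)) at_top"
  proof -
    have "((\<lambda>x::real. \<Sum>i\<le>degree P. coeff P i * (x ^ i / exp x)) \<longlongrightarrow> (\<Sum>i\<le>degree P. coeff P i * 0)) at_top"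
      by (intro tendsto_sum tendsto_mult tendsto_const tendsto_power_div_exp_0)
    moreover have "(\<lambda>x::real. \<Sum>i\<le>degree P. coeff P i * (x ^ i / exp x)) = (\<lambda>x. poly P x * exp (- x))"
      by (simp add: poly_altdef sum_distrib_right exp_minus divide_inverse mult.assoc)
    ultimately show ?thesis by simp
  qed
  then have "((\<lambda>t::real. poly P (1 / t) * exp (- (1 / t))) \<longlongrightarrow> 0) (at_right 0)"
    using filterlim_compose[OF _ filterlim_inverse_at_top_right] by (simp add: inverse_eq_divide)
  moreover have "\<forall>\<^sub>F t in at_right 0. poly P (1 / t) * exp (- (1 / t)) = flat P t"
    unfolding eventually_at_right[OF zero_less_one] by (intro exI[of _ 1]) (auto simp: flat_def)
  ultimately show ?thesis using tendsto_cong by fastforce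
qed

lemma flat_has_derivative:
  "(flat P has_real_derivative flat ([:0, 0, 1:] * (P - pderiv P)) t) (at t)"
proof -
  consider "t > 0" | "t < 0" | "t = 0" by linarith
  then show ?thesis
  proof cases
    case 1
    have "((\<lambda>t. poly P (1 / t) * exp (- (1 / t))) has_real_derivative
        (poly (pderiv P) (1 / t) * (- 1 / t\<^sup>2)) * exp (- (1 / t)) + poly P (1 / t) * (exp (- (1 / t)) * (1 / t\<^sup>2))) (at t)"
      using 1 by (auto intro!: derivative_eq_intros DERIV_chain2[OF poly_DERIV] simp: power2_eq_square)
    moreover have "(poly (pderiv P) (1 / t) * (- 1 / t\<^sup>2)) * exp (- (1 / t)) + poly P (1 / t) * (exp (- (1 / t)) * (1 / t\<^sup>2))
        = flat ([:0, 0, 1:] * (P - pderiv P)) t"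
      using 1 by (simp add: flat_def power2_eq_square algebra_simps add_divide_distrib diff_divide_distrib)
    ultimately have "((\<lambda>t. poly P (1 / t) * exp (- (1 / t))) has_real_derivative flat ([:0, 0, 1:] * (P - pderiv P)) t) (at t)"
      by metis
    then show ?thesis
      by (rule has_field_derivative_transform_within_open[where S="{0<..}"]) (use 1 in \<open>auto simp: flat_def\<close>)
  next
    case 2
    have "((\<lambda>t. 0) has_real_derivative flat ([:0, 0, 1:] * (P - pderiv P)) t) (at t)"
      using 2 by (simp add: flat_def)
    then show ?thesis
      by (rule has_field_derivative_transform_within_open[where S="{..<0}"]) (use 2 in \<open>auto simp: flat_def\<close>)
  next
    case 3
    have "((\<lambda>h. flat P h / h) \<longlongrightarrow> 0) (at_right 0)"
    proof (rule Lim_transform_eventually[OF flat_tendsto[of "[:0, 1:] * P"]])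
      show "\<forall>\<^sub>F h in at_right 0. flat ([:0, 1:] * P) h = flat P h / h"
        unfolding eventually_at_right[OF zero_less_one] by (intro exI[of _ 1]) (auto simp: flat_def)
    qed
    moreover have "((\<lambda>h. flat P h / h) \<longlongrightarrow> 0) (at_left 0)"
    proof (rule Lim_transform_eventually[OF tendsto_const])
      show "\<forall>\<^sub>F h in at_left 0. 0 = flat P h / h"
        unfolding eventually_at_filter by (auto simp: flat_def)
    qed
    ultimately have "((\<lambda>h. flat P h / h) \<longlongrightarrow> 0) (at 0)" by (simp add: filterlim_at_split)
    then show ?thesis using 3 by (simp add: has_field_derivative_iff flat_def)
  qed
qed

text \<open>The \<open>n\<close>-th derivative of \<open>exp (- 1 / (1 - s))\<close>, extended by zero to \<open>s \<ge> 1\<close>.\<close>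

definition bump_deriv :: "nat \<Rightarrow> real \<Rightarrow> real" where
  "bump_deriv n s = (-1) ^ n * flat (((\<lambda>P. [:0, 0, 1:] * (P - pderiv P)) ^^ n) 1) (1 - s)"

lemma bump_deriv_has_derivative: "(bump_deriv n has_real_derivative bump_deriv (Suc n) s) (at s)"
proof -
  let ?P = "((\<lambda>P. [:0, 0, 1:] * (P - pderiv P)) ^^ n) (1 :: real poly)"
  have "((\<lambda>s. (-1) ^ n * flat ?P (1 - s)) has_real_derivative
      (-1) ^ n * (flat ([:0, 0, 1:] * (?P - pderiv ?P)) (1 - s) * (-1))) (at s)"
    by (intro DERIV_cmult DERIV_chain2[OF flat_has_derivative]) (auto intro!: derivative_eq_intros)
  then show ?thesis unfolding bump_deriv_def by simp
qed

lemma bump_deriv_zero: "s \<ge> 1 \<Longrightarrow> bump_deriv n s = 0"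
  by (simp add: bump_deriv_def flat_def)

lemma continuous_bump_deriv: "continuous_on S (bump_deriv n)"
  using bump_deriv_has_derivative by (meson DERIV_isCont continuous_at_imp_continuous_on)

lemma bump_0: "bump_deriv 0 s = (if s < 1 then exp (- (1 / (1 - s))) else 0)"
  by (simp add: bump_deriv_def flat_def)

lemma bump_1: "bump_deriv 1 s = (if s < 1 then - exp (- (1 / (1 - s))) / (1 - s)\<^sup>2 else 0)"
  by (simp add: bump_deriv_def flat_def power2_eq_square)

definition radial_bump :: "nat \<Rightarrow> real^3 \<Rightarrow> real" where
  "radial_bump n x = bump_deriv n ((norm x)\<^sup>2)"

lemma radial_bump_support: "norm x > 1 \<Longrightarrow> radial_bump n x = 0"
  unfolding radial_bump_def by (intro bump_deriv_zero) (simp add: one_le_power)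

lemma test_function_radial_bump: "test_function (radial_bump n)"
proof (rule test_functionI[OF _ radial_bump_support])
  show "smooth (radial_bump n)"
    unfolding radial_bump_def by (rule smooth_compose[where h=bump_deriv, OF bump_deriv_has_derivative smooth_norm_sq])
qed

definition bump_mass :: real where
  "bump_mass = (LINT x|lebesgue. - radial_bump 1 x)"

lemma bump_mass_pos: "bump_mass > 0"
proof -
  define B where "B = cball (0::real^3) (1/2)"
  have "0 < exp (- 4 / 3) * measure lebesgue B"
    using content_cball_pos[of "1/2" "0::real^3"] by (simp add: B_def)
  also have "\<dots> = (LINT x|lebesgue. exp (- 4 / 3) * indicator B x)" by (simp add: B_def)
  also have "\<dots> \<le> (LINT x|lebesgue. - radial_bump 1 x)"
  proof (rule integral_mono)
    show "integrable lebesgue (\<lambda>x. exp (- 4 / 3) * indicat_real B x)"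
      unfolding B_def by (intro integrable_mult_right integrable_indicator_cball)
    show "integrable lebesgue (\<lambda>x. - radial_bump 1 x)"
      by (intro integrable_test_function test_function_minus test_function_radial_bump)
    fix x :: "real^3"
    show "exp (- 4 / 3) * indicat_real B x \<le> - radial_bump 1 x"
    proof (cases "x \<in> B")
      case True
      then have "norm x \<le> 1/2" by (simp add: B_def)
      then have s: "(norm x)\<^sup>2 \<le> (1/2)\<^sup>2" by (intro power_mono) auto
      define t where "t = 1 - (norm x)\<^sup>2"
      have t: "3/4 \<le> t" "t \<le> 1" using s by (auto simp: t_def power2_eq_square)
      have "1 / t \<le> 4 / 3" using t by (simp add: field_simps)
      then have e: "exp (- 4 / 3) \<le> exp (- (1 / t))" by simp
      have "t\<^sup>2 \<le> 1" using t by (simp add: power_le_one)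
      then have "exp (- (1 / t)) \<le> exp (- (1 / t)) / t\<^sup>2" using t by (simp add: le_divide_eq)
      with e have "exp (- 4 / 3) \<le> exp (- (1 / t)) / t\<^sup>2" by linarith
      then show ?thesis using True t by (simp add: radial_bump_def bump_1[unfolded One_nat_def] t_def)
    next
      case False
      then show ?thesis by (simp add: radial_bump_def bump_1[unfolded One_nat_def])
    qed
  qed
  finally show ?thesis by (simp add: bump_mass_def)
qed

text \<open>The mollifier is taken to be minus the derivative of the bump, not the bump, because its potential
  is then again explicit: \<open>\<nabla> (radial_bump 0) = 2 x (radial_bump 1)\<close>, so that the derivative of
  \<open>rescaled radial_mollifier r\<close> in \<open>r\<close> is the Laplacian of a multiple of
  \<open>radial_bump 0 (x / r) / r\<^sup>2\<close>.\<close>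

definition radial_mollifier :: "real^3 \<Rightarrow> real" where
  "radial_mollifier x = - radial_bump 1 x / bump_mass"

interpretation radial: mollifier radial_mollifier
proof
  show "test_function radial_mollifier"
    unfolding radial_mollifier_def
    using test_function_cmult[OF test_function_radial_bump, of "- 1 / bump_mass" 1] by simp
  show "0 \<le> radial_mollifier x" for x
    using bump_mass_pos by (simp add: radial_mollifier_def radial_bump_def bump_1[unfolded One_nat_def])
  show "(LINT x|lebesgue. radial_mollifier x) = 1"
    using bump_mass_pos by (simp add: radial_mollifier_def bump_mass_def)
  show "norm x > 1 \<Longrightarrow> radial_mollifier x = 0" for x
    by (simp add: radial_mollifier_def radial_bump_support)
qed

text \<open>A compactly supported substitute for the Newtonian potential between the scales \<open>a\<close> and \<open>b\<close>:
  by the identity above, integrating over the scale gives a function whose Laplacian is the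
  difference of the mollifiers at the two ends. The profile with index \<open>n\<close> is the \<open>n\<close>-th derivative
  of the profile with index \<open>0\<close>, as a function of \<open>s = |x|\<^sup>2\<close>.\<close>

definition potential_profile :: "real \<Rightarrow> real \<Rightarrow> nat \<Rightarrow> real \<Rightarrow> real" where
  "potential_profile a b n s =
     integral {a..b} (\<lambda>r. bump_deriv n (s / r\<^sup>2) / r ^ (2 + 2 * n)) / (2 * bump_mass)"

definition potential :: "real \<Rightarrow> real \<Rightarrow> real^3 \<Rightarrow> real" where
  "potential a b x = potential_profile a b 0 ((norm x)\<^sup>2)"

context
  fixes a b :: real
  assumes a: "0 < a" and ab: "a \<le> b"
begin

lemma potential_integrand_continuous:
  "continuous_on (UNIV \<times> {a..b}) (\<lambda>(s, r). bump_deriv n (s / r\<^sup>2) / r ^ m)"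
  unfolding case_prod_beta
  by (intro continuous_intros continuous_on_compose2[OF continuous_bump_deriv[of UNIV]]) (use a in auto)

lemma potential_integrand_continuous1:
  "continuous_on {a..b} (\<lambda>r. bump_deriv n (s / r\<^sup>2) / r ^ m)"
  by (intro continuous_intros continuous_on_compose2[OF continuous_bump_deriv[of UNIV]]) (use a in auto)

lemma potential_profile_has_derivative:
  "(potential_profile a b n has_real_derivative potential_profile a b (Suc n) s) (at s)"
proof -
  have "((\<lambda>s. integral (cbox a b) (\<lambda>r. bump_deriv n (s / r\<^sup>2) / r ^ (2 + 2 * n))) has_real_derivative
      integral (cbox a b) (\<lambda>r. bump_deriv (Suc n) (s / r\<^sup>2) / r ^ (2 + 2 * Suc n))) (at s within UNIV)"
  proof (rule leibniz_rule_field_derivative)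
    fix s r assume "r \<in> cbox a b"
    then have r: "r > 0" using a by simp
    have "((\<lambda>s. bump_deriv n (s / r\<^sup>2)) has_real_derivative bump_deriv (Suc n) (s / r\<^sup>2) * (1 / r\<^sup>2)) (at s)"
      by (rule DERIV_chain2[OF bump_deriv_has_derivative DERIV_cdivide[OF DERIV_ident]])
    have e: "r ^ (2 + 2 * Suc n) = r\<^sup>2 * r ^ (2 + 2 * n)" by (simp add: power2_eq_square)
    have eq: "A * (1 / q) / w = A / (q * w)" for A q w :: real by simp
    from DERIV_cdivide[OF \<open>((\<lambda>s. bump_deriv n (s / r\<^sup>2)) has_real_derivative _) _\<close>, of "r ^ (2 + 2 * n)"]
    show "((\<lambda>s. bump_deriv n (s / r\<^sup>2) / r ^ (2 + 2 * n)) has_real_derivative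
        bump_deriv (Suc n) (s / r\<^sup>2) / r ^ (2 + 2 * Suc n)) (at s)"
      by (simp only: e eq)
  next
    show "(\<lambda>r. bump_deriv n (s / r\<^sup>2) / r ^ (2 + 2 * n)) integrable_on cbox a b" for s
      by (intro integrable_continuous) (simp only: cbox_interval potential_integrand_continuous1)
    show "continuous_on (UNIV \<times> cbox a b) (\<lambda>(s, r). bump_deriv (Suc n) (s / r\<^sup>2) / r ^ (2 + 2 * Suc n))"
      using potential_integrand_continuous[of "Suc n" "2 + 2 * Suc n"] by (simp only: cbox_interval)
  qed auto
  from DERIV_cdivide[OF this, of "2 * bump_mass"] show ?thesis
    unfolding potential_profile_def by (simp only: cbox_interval)
qed

lemma potential_support: "norm x > b \<Longrightarrow> potential a b x = 0"
proof -
  assume x: "norm x > b"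
  have "integral {a..b} (\<lambda>r. bump_deriv 0 ((norm x)\<^sup>2 / r\<^sup>2) / r ^ (2 + 2 * 0)) = integral {a..b} (\<lambda>r. 0)"
  proof (rule Henstock_Kurzweil_Integration.integral_cong)
    fix r assume r: "r \<in> {a..b}"
    then have "r\<^sup>2 \<le> (norm x)\<^sup>2" using a x by (intro power_mono) auto
    then have "(norm x)\<^sup>2 / r\<^sup>2 \<ge> 1" using r a by simp
    then show "bump_deriv 0 ((norm x)\<^sup>2 / r\<^sup>2) / r ^ (2 + 2 * 0) = 0" using bump_deriv_zero by simp
  qed
  then show ?thesis by (simp add: potential_def potential_profile_def)
qed

lemma test_function_potential: "test_function (potential a b)"
proof (rule test_functionI[OF _ potential_support])
  show "smooth (potential a b)"
    unfolding potential_def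
    by (rule smooth_compose[where h="potential_profile a b", OF potential_profile_has_derivative smooth_norm_sq])
qed

text \<open>The Laplacian of the integrand is an exact derivative in the scaling parameter.\<close>

lemma laplacian_potential:
  "(\<Sum>i\<in>UNIV. partial_deriv i (partial_deriv i (potential a b)) x)
    = rescaled radial_mollifier b x - rescaled radial_mollifier a x"
proof -
  let ?k = "potential_profile a b"
  let ?s = "\<lambda>x::real^3. (norm x)\<^sup>2"
  note pc = partial_deriv_compose[OF smooth_differentiable[OF smooth_norm_sq] potential_profile_has_derivative]
  have d1: "partial_deriv i (potential a b) = (\<lambda>x. ?k 1 (?s x) * (2 * x $ i))" for i
    unfolding potential_def by (simp add: pc partial_deriv_norm_sq)
  have sm: "smooth (\<lambda>x. ?k 1 (?s x))"
    by (rule smooth_compose[where h="potential_profile a b", OF potential_profile_has_derivative smooth_norm_sq])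
  have pc1: "partial_deriv i (\<lambda>x. ?k 1 (?s x)) = (\<lambda>x. ?k 2 (?s x) * (2 * x $ i))" for i
    using partial_deriv_compose[OF smooth_differentiable[OF smooth_norm_sq] potential_profile_has_derivative, of i 1]
    by (simp only: Suc_1 partial_deriv_norm_sq)
  have d2: "partial_deriv i (partial_deriv i (potential a b)) x = 4 * ?k 2 (?s x) * (x $ i * x $ i) + 2 * ?k 1 (?s x)" for i
    unfolding d1
    by (simp add: partial_deriv_mult[OF smooth_differentiable[OF sm] smooth_differentiable[OF smooth_cmult[OF smooth_component]]]
        partial_deriv_cmult[OF smooth_component] partial_deriv_component pc1 del: One_nat_def)
  define s where "s = ?s x"
  have "(\<Sum>i\<in>UNIV. partial_deriv i (partial_deriv i (potential a b)) x) = 4 * s * ?k 2 s + 6 * ?k 1 s"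
  proof -
    have "(\<Sum>i\<in>UNIV. 4 * ?k 2 s * (x $ i * x $ i)) = 4 * ?k 2 s * s"
      unfolding sum_distrib_left[symmetric] s_def norm_sq_sum[symmetric] by (rule refl)
    then show ?thesis unfolding d2 s_def[symmetric] by (simp add: sum.distrib)
  qed
  also have "\<dots> = integral {a..b} (\<lambda>r. 2 * s * bump_deriv 2 (s / r\<^sup>2) / r ^ 6 + 3 * bump_deriv 1 (s / r\<^sup>2) / r ^ 4) / bump_mass"
  proof -
    have i2: "(\<lambda>r. bump_deriv 2 (s / r\<^sup>2) / r ^ 6) integrable_on {a..b}"
      by (rule integrable_continuous_interval[OF potential_integrand_continuous1])
    have i1: "(\<lambda>r. bump_deriv 1 (s / r\<^sup>2) / r ^ 4) integrable_on {a..b}"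
      by (rule integrable_continuous_interval[OF potential_integrand_continuous1])
    have "integral {a..b} (\<lambda>r. 2 * s * bump_deriv 2 (s / r\<^sup>2) / r ^ 6 + 3 * bump_deriv 1 (s / r\<^sup>2) / r ^ 4)
       = integral {a..b} (\<lambda>r. 2 * s * (bump_deriv 2 (s / r\<^sup>2) / r ^ 6)) + integral {a..b} (\<lambda>r. 3 * (bump_deriv 1 (s / r\<^sup>2) / r ^ 4))"
      using Henstock_Kurzweil_Integration.integral_add[OF integrable_on_cmult_left[OF i2, of "2 * s"] integrable_on_cmult_left[OF i1, of 3]]
      by simp
    also have "\<dots> = 2 * s * integral {a..b} (\<lambda>r. bump_deriv 2 (s / r\<^sup>2) / r ^ 6) + 3 * integral {a..b} (\<lambda>r. bump_deriv 1 (s / r\<^sup>2) / r ^ 4)"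
      by (simp only: integral_mult_right)
    finally show ?thesis by (simp add: potential_profile_def add_divide_distrib)
  qed
  also have "integral {a..b} (\<lambda>r. 2 * s * bump_deriv 2 (s / r\<^sup>2) / r ^ 6 + 3 * bump_deriv 1 (s / r\<^sup>2) / r ^ 4)
      = - bump_deriv 1 (s / b\<^sup>2) / b ^ 3 - (- bump_deriv 1 (s / a\<^sup>2) / a ^ 3)"
  proof (rule integral_unique, rule fundamental_theorem_of_calculus[OF ab])
    fix r assume "r \<in> {a..b}"
    then have r: "r > 0" using a by simp
    have q: "((\<lambda>r. s / r\<^sup>2) has_real_derivative - 2 * s / r ^ 3) (at r)"
      using r by (auto intro!: derivative_eq_intros simp: power2_eq_square power3_eq_cube field_simps)
    have "((\<lambda>r. bump_deriv 1 (s / r\<^sup>2)) has_real_derivative bump_deriv 2 (s / r\<^sup>2) * (- 2 * s / r ^ 3)) (at r)"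
      using DERIV_chain2[OF bump_deriv_has_derivative q, of 1] by (simp add: numeral_2_eq_2)
    then have d: "((\<lambda>r. bump_deriv 1 (s / r\<^sup>2) / r ^ 3) has_real_derivative
        (bump_deriv 2 (s / r\<^sup>2) * (- 2 * s / r ^ 3) * r ^ 3 - bump_deriv 1 (s / r\<^sup>2) * (3 * r\<^sup>2)) / (r ^ 3 * r ^ 3)) (at r)"
      using r by (intro DERIV_divide) (auto intro!: derivative_eq_intros)
    have eq: "- ((B2 * (- 2 * s / r ^ 3) * r ^ 3 - B1 * (3 * r\<^sup>2)) / (r ^ 3 * r ^ 3))
        = 2 * s * B2 / r ^ 6 + 3 * B1 / r ^ 4" for B1 B2
      using r by (simp add: field_simps eval_nat_numeral)
    have "((\<lambda>r. - (bump_deriv 1 (s / r\<^sup>2) / r ^ 3)) has_real_derivative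
        2 * s * bump_deriv 2 (s / r\<^sup>2) / r ^ 6 + 3 * bump_deriv 1 (s / r\<^sup>2) / r ^ 4) (at r)"
      using DERIV_minus[OF d] unfolding eq .
    then show "((\<lambda>r. - bump_deriv 1 (s / r\<^sup>2) / r ^ 3) has_vector_derivative
        2 * s * bump_deriv 2 (s / r\<^sup>2) / r ^ 6 + 3 * bump_deriv 1 (s / r\<^sup>2) / r ^ 4) (at r within {a..b})"
      by (simp add: has_real_derivative_iff_has_vector_derivative has_vector_derivative_at_within
          flip: minus_divide_left)
  qed
  also have "(- bump_deriv 1 (s / b\<^sup>2) / b ^ 3 - (- bump_deriv 1 (s / a\<^sup>2) / a ^ 3)) / bump_mass
      = rescaled radial_mollifier b x - rescaled radial_mollifier a x"
  proof -
    have "(norm (x /\<^sub>R r))\<^sup>2 = s / r\<^sup>2" if "r > 0" for r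
      using that by (simp add: s_def power_mult_distrib power_inverse divide_inverse mult.commute)
    then show ?thesis using a ab
      by (simp add: rescaled_def radial_mollifier_def radial_bump_def diff_divide_distrib mult.commute)
  qed
  finally show ?thesis .
qed

end

section \<open>Second derivatives in \<open>L\<^sup>2\<close>\<close>

lemma sum_axis: "(\<Sum>k\<in>UNIV. (c *\<^sub>R axis i (1::real)) $ k * F k) = c * (F i :: real)"
  by (simp add: axis_def mult_ac if_distrib[where f="\<lambda>z. z * _"] if_distrib[where f="\<lambda>z. _ * z"] cong: if_cong)

text \<open>The mixed second difference is symmetric in the two directions, and it determines the mixed
  derivative.\<close>

lemma second_difference:
  fixes f :: "real^'n::finite \<Rightarrow> real"
  assumes f: "test_function f"
  obtains B where "\<And>t. 0 < t \<Longrightarrow>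
    \<bar>f (x + t *\<^sub>R axis i 1 + t *\<^sub>R axis j 1) - f (x + t *\<^sub>R axis j 1) - (f (x + t *\<^sub>R axis i 1) - f x)
      - t\<^sup>2 * partial_deriv i (partial_deriv j f) x\<bar> \<le> B * t ^ 3"
proof -
  let ?F = "partial_deriv j f"
  obtain B where B: "B > 0" "\<And>x h. \<bar>?F (x + h) - ?F x - (\<Sum>k\<in>UNIV. h $ k * partial_deriv k ?F x)\<bar> \<le> B * (norm h)\<^sup>2"
    by (rule test_function_taylor[OF test_function_partial_deriv[OF f, of j]]) blast
  have "\<bar>f (x + t *\<^sub>R axis i 1 + t *\<^sub>R axis j 1) - f (x + t *\<^sub>R axis j 1) - (f (x + t *\<^sub>R axis i 1) - f x)
      - t\<^sup>2 * partial_deriv i ?F x\<bar> \<le> 5 * B * t ^ 3" if t: "0 < t" for t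
  proof -
    have der: "((\<lambda>s. f (z + s *\<^sub>R axis j 1)) has_real_derivative ?F (z + s *\<^sub>R axis j 1)) (at s)" for z s
    proof -
      have "((\<lambda>s. z + s *\<^sub>R axis j 1) has_derivative (\<lambda>h. h *\<^sub>R axis j 1)) (at s)"
        by (auto intro!: derivative_eq_intros)
      from has_derivative_compose[OF this differentiable_has_derivative_partial[OF smooth_differentiable[OF test_function_smooth[OF f]]]]
      have "((\<lambda>s. f (z + s *\<^sub>R axis j 1)) has_derivative (\<lambda>h. h * ?F (z + s *\<^sub>R axis j 1))) (at s)"
        unfolding sum_axis .
      moreover have "(\<lambda>h. h * c) = (*) c" for c :: real by (rule ext) (rule mult.commute)
      ultimately show ?thesis by (simp only: has_field_derivative_def)
    qed
    let ?p = "\<lambda>s. f (x + t *\<^sub>R axis i 1 + s *\<^sub>R axis j 1) - f (x + s *\<^sub>R axis j 1)"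
    have "\<exists>z. 0 < z \<and> z < t \<and> ?p t - ?p 0 = (t - 0) * (?F (x + t *\<^sub>R axis i 1 + z *\<^sub>R axis j 1) - ?F (x + z *\<^sub>R axis j 1))"
      by (rule MVT2[OF t]) (intro DERIV_diff der)
    then obtain z where z: "0 < z" "z < t"
      and pz: "?p t - ?p 0 = t * (?F (x + t *\<^sub>R axis i 1 + z *\<^sub>R axis j 1) - ?F (x + z *\<^sub>R axis j 1))" by auto
    let ?h = "t *\<^sub>R axis i 1 + z *\<^sub>R axis j 1 :: real^'n"
    have "norm ?h \<le> 2 * t" using norm_triangle_ineq[of "t *\<^sub>R axis i 1" "z *\<^sub>R axis j (1::real)"] z t by simp
    then have h2: "(norm ?h)\<^sup>2 \<le> (2 * t)\<^sup>2" by (intro power_mono) auto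
    have s1: "(\<Sum>k\<in>UNIV. ?h $ k * partial_deriv k ?F x) = t * partial_deriv i ?F x + z * partial_deriv j ?F x"
      unfolding vector_add_component distrib_right sum.distrib sum_axis ..
    have b1: "\<bar>?F (x + ?h) - ?F x - (t * partial_deriv i ?F x + z * partial_deriv j ?F x)\<bar> \<le> B * (4 * t\<^sup>2)"
    proof -
      have "B * (norm ?h)\<^sup>2 \<le> B * (4 * t\<^sup>2)"
        using h2 B(1) by (intro mult_left_mono) (auto simp: power_mult_distrib)
      with B(2)[of x ?h] show ?thesis unfolding s1 by linarith
    qed
    have z2: "z\<^sup>2 \<le> t\<^sup>2" using z by (intro power_mono) auto
    have b2: "\<bar>?F (x + z *\<^sub>R axis j 1) - ?F x - z * partial_deriv j ?F x\<bar> \<le> B * t\<^sup>2"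
    proof -
      have "B * z\<^sup>2 \<le> B * t\<^sup>2" using z2 B(1) by (intro mult_left_mono) auto
      moreover have "norm (z *\<^sub>R axis j 1 :: real^'n) = z" using z by simp
      ultimately show ?thesis using B(2)[of x "z *\<^sub>R axis j 1"] unfolding sum_axis by simp
    qed
    define A where "A = ?F (x + t *\<^sub>R axis i 1 + z *\<^sub>R axis j 1) - ?F (x + z *\<^sub>R axis j 1) - t * partial_deriv i ?F x"
    have "\<bar>A\<bar> \<le> 5 * B * t\<^sup>2" using b1 b2 unfolding A_def add.assoc[of x] abs_le_iff by linarith
    then have "t * \<bar>A\<bar> \<le> t * (5 * B * t\<^sup>2)" using t by (intro mult_left_mono) auto
    moreover have "f (x + t *\<^sub>R axis i 1 + t *\<^sub>R axis j 1) - f (x + t *\<^sub>R axis j 1) - (f (x + t *\<^sub>R axis i 1) - f x)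
      - t\<^sup>2 * partial_deriv i ?F x = t * A"
      using pz by (simp add: A_def algebra_simps power2_eq_square)
    ultimately show ?thesis using t by (simp add: abs_mult power2_eq_square power3_eq_cube mult_ac)
  qed
  with that show ?thesis by blast
qed

lemma partial_deriv_commute:
  fixes f :: "real^'n::finite \<Rightarrow> real"
  assumes f: "test_function f"
  shows "partial_deriv i (partial_deriv j f) = partial_deriv j (partial_deriv i f)"
proof
  fix x
  define d where "d = partial_deriv i (partial_deriv j f) x - partial_deriv j (partial_deriv i f) x"
  let ?Q = "\<lambda>i j t. f (x + t *\<^sub>R axis i 1 + t *\<^sub>R axis j 1) - f (x + t *\<^sub>R axis j 1) - (f (x + t *\<^sub>R axis i 1) - f x)"
  obtain B where B: "\<And>t. 0 < t \<Longrightarrow> \<bar>?Q i j t - t\<^sup>2 * partial_deriv i (partial_deriv j f) x\<bar> \<le> B * t ^ 3"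
    using second_difference[OF f] by metis
  obtain C where C: "\<And>t. 0 < t \<Longrightarrow> \<bar>?Q j i t - t\<^sup>2 * partial_deriv j (partial_deriv i f) x\<bar> \<le> C * t ^ 3"
    using second_difference[OF f] by metis
  have Q: "?Q i j t = ?Q j i t" for t by (simp add: add_ac)
  have "\<bar>d\<bar> \<le> (\<bar>B\<bar> + \<bar>C\<bar>) * t" if t: "0 < t" for t
  proof -
    have "t\<^sup>2 * d = (?Q j i t - t\<^sup>2 * partial_deriv j (partial_deriv i f) x) - (?Q i j t - t\<^sup>2 * partial_deriv i (partial_deriv j f) x)"
      unfolding Q d_def by (simp add: algebra_simps)
    then have "\<bar>t\<^sup>2 * d\<bar> \<le> C * t ^ 3 + B * t ^ 3" using B[OF t] C[OF t] by linarith
    also have "\<dots> \<le> (\<bar>B\<bar> + \<bar>C\<bar>) * t ^ 3"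
      using t by (simp flip: distrib_right add: mult_right_mono)
    finally have "t\<^sup>2 * \<bar>d\<bar> \<le> t\<^sup>2 * ((\<bar>B\<bar> + \<bar>C\<bar>) * t)"
      using t by (simp add: abs_mult power2_eq_square power3_eq_cube mult_ac)
    then show ?thesis using t by simp
  qed
  then have lim: "\<forall>\<^sub>F t in at_right 0. \<bar>d\<bar> \<le> (\<bar>B\<bar> + \<bar>C\<bar>) * t"
    unfolding eventually_at_right[OF zero_less_one] by (intro exI[of _ 1]) auto
  have "((\<lambda>t. (\<bar>B\<bar> + \<bar>C\<bar>) * t) \<longlongrightarrow> (\<bar>B\<bar> + \<bar>C\<bar>) * 0) (at_right 0)" by (intro tendsto_intros)
  from tendsto_lowerbound[OF this lim] have "\<bar>d\<bar> \<le> 0" by simp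
  then show "partial_deriv i (partial_deriv j f) x = partial_deriv j (partial_deriv i f) x" by (simp add: d_def)
qed

definition laplacian :: "(real^'n::finite \<Rightarrow> real) \<Rightarrow> real^'n \<Rightarrow> real" where
  "laplacian f x = (\<Sum>i\<in>UNIV. partial_deriv i (partial_deriv i f) x)"

lemma test_function_laplacian: "test_function f \<Longrightarrow> test_function (laplacian f)"
  unfolding laplacian_def[abs_def] by (intro test_function_sum test_function_partial_deriv) auto

lemma integrable_test_mult: "test_function f \<Longrightarrow> test_function g \<Longrightarrow> integrable lebesgue (\<lambda>x. f x * g x)"
  by (rule integrable_test_function[OF test_function_mult_smooth[OF _ test_function_smooth]])

text \<open>Two integrations by parts. This is the only singular integral estimate that the proof needs.\<close>

lemma integral_hessian_squared:
  fixes g :: "real^'n::finite \<Rightarrow> real"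
  assumes g: "test_function g"
  shows "(LINT x|lebesgue. (laplacian g x)\<^sup>2) = (\<Sum>i\<in>UNIV. \<Sum>j\<in>UNIV. LINT x|lebesgue. (partial_deriv j (partial_deriv i g) x)\<^sup>2)"
proof -
  note [intro] = test_function_partial_deriv g test_function_smooth
  have "(LINT x|lebesgue. (laplacian g x)\<^sup>2) = (LINT x|lebesgue. (\<Sum>i\<in>UNIV. \<Sum>j\<in>UNIV.
      partial_deriv i (partial_deriv i g) x * partial_deriv j (partial_deriv j g) x))"
    by (simp add: laplacian_def power2_eq_square sum_product)
  also have "\<dots> = (\<Sum>i\<in>UNIV. \<Sum>j\<in>UNIV. LINT x|lebesgue.
      partial_deriv i (partial_deriv i g) x * partial_deriv j (partial_deriv j g) x)"
    by (subst Bochner_Integration.integral_sum,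
        intro Bochner_Integration.integrable_sum integrable_test_mult test_function_partial_deriv g,
        intro sum.cong refl Bochner_Integration.integral_sum integrable_test_mult test_function_partial_deriv g)
  also have "\<dots> = (\<Sum>i\<in>UNIV. \<Sum>j\<in>UNIV. LINT x|lebesgue. (partial_deriv j (partial_deriv i g) x)\<^sup>2)"
  proof (intro sum.cong refl)
    fix i j :: 'n
    have c: "partial_deriv i (partial_deriv j (partial_deriv j g)) = partial_deriv j (partial_deriv j (partial_deriv i g))"
      using partial_deriv_commute[OF test_function_partial_deriv[OF g], of i j j] partial_deriv_commute[OF g, of i j] by simp
    have "(LINT x|lebesgue. partial_deriv i (partial_deriv i g) x * partial_deriv j (partial_deriv j g) x)
        = - (LINT x|lebesgue. partial_deriv i g x * partial_deriv j (partial_deriv j (partial_deriv i g)) x)"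
      unfolding c[symmetric] by (rule integral_by_parts) auto
    also have "\<dots> = (LINT x|lebesgue. partial_deriv j (partial_deriv i g) x * partial_deriv j (partial_deriv i g) x)"
      by (subst integral_by_parts) auto
    finally show "(LINT x|lebesgue. partial_deriv i (partial_deriv i g) x * partial_deriv j (partial_deriv j g) x)
        = (LINT x|lebesgue. (partial_deriv j (partial_deriv i g) x)\<^sup>2)" by (simp add: power2_eq_square)
  qed
  finally show ?thesis .
qed

lemma integral_second_partial_le:
  fixes g :: "real^'n::finite \<Rightarrow> real"
  assumes g: "test_function g"
  shows "(LINT x|lebesgue. (partial_deriv j (partial_deriv i g) x)\<^sup>2) \<le> (LINT x|lebesgue. (laplacian g x)\<^sup>2)"
proof -
  let ?a = "\<lambda>i j. LINT x|lebesgue. (partial_deriv j (partial_deriv i g) x)\<^sup>2"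
  have "?a i j \<le> (\<Sum>j\<in>UNIV. ?a i j)" by (rule member_le_sum) auto
  also have "\<dots> \<le> (\<Sum>i\<in>UNIV. \<Sum>j\<in>UNIV. ?a i j)" by (rule member_le_sum[where f="\<lambda>i. \<Sum>j\<in>UNIV. ?a i j"]) (auto intro: sum_nonneg)
  finally show ?thesis by (simp add: integral_hessian_squared[OF g])
qed

section \<open>Functions that are locally square integrable\<close>

definition locally_L2 :: "(real^'n::finite \<Rightarrow> real) \<Rightarrow> bool" where
  "locally_L2 f \<longleftrightarrow> f \<in> borel_measurable lebesgue \<and> locally_integrable (\<lambda>x. (f x)\<^sup>2)"

lemma locally_integrable_subset:
  fixes f :: "real^'n::finite \<Rightarrow> real"
  assumes "f \<in> borel_measurable lebesgue" "locally_integrable g" "\<And>x. \<bar>f x\<bar> \<le> g x"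
  shows "locally_integrable f"
  by (rule locally_integrableI[where g=g, OF assms(1) locally_integrable_cball[OF assms(2)] assms(3)])

lemma locally_integrable_add:
  "locally_integrable f \<Longrightarrow> locally_integrable g \<Longrightarrow> locally_integrable (\<lambda>x. f x + g x)"
  unfolding locally_integrable_def by (blast intro: set_integral_add(1))

lemma locally_integrable_cmult:
  "locally_integrable f \<Longrightarrow> locally_integrable (\<lambda>x. c * f x)"
  unfolding locally_integrable_def by (blast intro: set_integrable_mult_right)

lemma locally_integrable_diff:
  "locally_integrable f \<Longrightarrow> locally_integrable g \<Longrightarrow> locally_integrable (\<lambda>x. f x - g x)"
  using locally_integrable_add[of f "\<lambda>x. -1 * g x"] locally_integrable_cmult[of g "-1"] by simp

lemma locally_integrable_sum:
  "finite A \<Longrightarrow> (\<And>a. a \<in> A \<Longrightarrow> locally_integrable (f a)) \<Longrightarrow> locally_integrable (\<lambda>x. \<Sum>a\<in>A. f a x)"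
proof (induction A rule: finite_induct)
  case empty
  then show ?case using locally_integrable_smooth[OF smooth_const[of 0]] by simp
next
  case (insert a A)
  then show ?case using locally_integrable_add[of "f a" "\<lambda>x. \<Sum>a\<in>A. f a x"] by simp
qed

lemma locally_integrable_abs:
  assumes "locally_integrable f" shows "locally_integrable (\<lambda>x. \<bar>f x\<bar>)"
  unfolding locally_integrable_def set_integrable_def
proof (intro allI impI)
  fix K :: "(real^'a) set" assume "compact K"
  then have "integrable lebesgue (\<lambda>x. \<bar>indicat_real K x *\<^sub>R f x\<bar>)"
    using assms unfolding locally_integrable_def set_integrable_def by (intro integrable_abs) auto
  moreover have "\<bar>indicat_real K x *\<^sub>R f x\<bar> = indicat_real K x *\<^sub>R \<bar>f x\<bar>" for x
    by (simp add: indicator_def)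
  ultimately show "integrable lebesgue (\<lambda>x. indicat_real K x *\<^sub>R \<bar>f x\<bar>)" by simp
qed

lemma locally_L2_measurable: "locally_L2 f \<Longrightarrow> f \<in> borel_measurable lebesgue"
  by (simp add: locally_L2_def)

lemma locally_L2_integrable: "locally_L2 f \<Longrightarrow> locally_integrable f"
  unfolding locally_L2_def by (rule Lp_locally_integrable[of f 1]) (simp_all add: power2_eq_square)

lemma locally_L2_mult:
  assumes "locally_L2 f" "locally_L2 g" shows "locally_integrable (\<lambda>x. f x * g x)"
proof (rule locally_integrable_subset)
  show "locally_integrable (\<lambda>x. (f x)\<^sup>2 + (g x)\<^sup>2)"
    using assms by (intro locally_integrable_add) (auto simp: locally_L2_def)
  show "(\<lambda>x. f x * g x) \<in> borel_measurable lebesgue"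
    by (intro borel_measurable_times locally_L2_measurable assms)
  fix x
  have "2 * (\<bar>f x\<bar> * \<bar>g x\<bar>) \<le> (f x)\<^sup>2 + (g x)\<^sup>2" using sum_squares_bound[of "\<bar>f x\<bar>" "\<bar>g x\<bar>"] by simp
  moreover have "0 \<le> \<bar>f x\<bar> * \<bar>g x\<bar>" by simp
  ultimately show "\<bar>f x * g x\<bar> \<le> (f x)\<^sup>2 + (g x)\<^sup>2" unfolding abs_mult by linarith
qed

lemma locally_L2_add:
  assumes "locally_L2 f" "locally_L2 g" shows "locally_L2 (\<lambda>x. f x + g x)"
  unfolding locally_L2_def
proof
  show m: "(\<lambda>x. f x + g x) \<in> borel_measurable lebesgue"
    by (intro borel_measurable_add locally_L2_measurable assms)
  have "locally_integrable (\<lambda>x. 2 * ((f x)\<^sup>2 + (g x)\<^sup>2))"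
    using assms by (intro locally_integrable_cmult locally_integrable_add) (auto simp: locally_L2_def)
  moreover have "\<bar>(f x + g x)\<^sup>2\<bar> \<le> 2 * ((f x)\<^sup>2 + (g x)\<^sup>2)" for x
  proof -
    have "(f x + g x)\<^sup>2 \<le> 2 * ((f x)\<^sup>2 + (g x)\<^sup>2)"
      using sum_squares_bound[of "f x" "g x"] unfolding power2_sum by argo
    then show ?thesis by (simp only: abs_power2)
  qed
  ultimately show "locally_integrable (\<lambda>x. (f x + g x)\<^sup>2)"
    by (rule locally_integrable_subset[OF borel_measurable_power[OF m]])
qed

lemma locally_L2_mult_smooth:
  assumes "locally_L2 f" "smooth g" shows "locally_L2 (\<lambda>x. f x * g x)"
  unfolding locally_L2_def power_mult_distrib
proof
  show "(\<lambda>x. f x * g x) \<in> borel_measurable lebesgue"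
    by (intro borel_measurable_times locally_L2_measurable smooth_lebesgue assms)
  have "smooth (\<lambda>x. (g x)\<^sup>2)" unfolding power2_eq_square by (intro smooth_mult assms)
  then show "locally_integrable (\<lambda>x. (f x)\<^sup>2 * (g x)\<^sup>2)"
    using assms by (intro locally_integrable_mult_smooth) (auto simp: locally_L2_def)
qed

lemma locally_L2_smooth: "smooth g \<Longrightarrow> locally_L2 g"
  unfolding locally_L2_def power2_eq_square by (intro conjI smooth_lebesgue locally_integrable_smooth smooth_mult)

lemma locally_L2_cmult: "locally_L2 f \<Longrightarrow> locally_L2 (\<lambda>x. c * f x)"
  using locally_L2_mult_smooth[of f "\<lambda>x. c"] smooth_const[of c] by (simp add: mult.commute)

lemma locally_L2_diff: "locally_L2 f \<Longrightarrow> locally_L2 g \<Longrightarrow> locally_L2 (\<lambda>x. f x - g x)"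
  using locally_L2_add[of f "\<lambda>x. -1 * g x"] locally_L2_cmult[of g "-1"] by simp

lemma integrable_bounded_support_of_local:
  assumes "locally_integrable f" "\<And>x. norm x > R \<Longrightarrow> f x = 0"
  shows "integrable lebesgue f"
proof -
  have eq: "(\<lambda>x. indicator (cball 0 R) x * f x) = f"
    by (rule ext) (use assms(2) in \<open>auto simp: indicator_def\<close>)
  show ?thesis using locally_integrable_cball[OF assms(1), of R] unfolding eq .
qed

lemma (in mollifier) pairing_tendsto:
  assumes a: "locally_L2 a" and S: "\<And>x. norm x > S \<Longrightarrow> a x = 0" and b: "locally_L2 b"
  shows "((\<lambda>r. LINT x|lebesgue. a x * mollify r b x) \<longlongrightarrow> (LINT x|lebesgue. a x * b x)) (at_right 0)"
proof -
  let ?w = "\<lambda>r. mollify r b"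
  have bl: "locally_integrable b" by (rule locally_L2_integrable[OF b])
  have ab: "integrable lebesgue (\<lambda>x. a x * b x)"
    by (rule integrable_bounded_support_of_local[OF locally_L2_mult[OF a b], of S]) (simp add: S)
  have "((\<lambda>r. LINT x|lebesgue. indicator (cball 0 S) x * \<bar>?w r x - b x\<bar> ^ Suc 1) \<longlongrightarrow> 0) (at_right 0)"
    using b by (intro local_mollification_tendsto) (auto simp: locally_L2_def power2_eq_square)
  then have "((\<lambda>r. sqrt (LINT x|lebesgue. indicator (cball 0 S) x * (?w r x - b x)\<^sup>2)) \<longlongrightarrow> sqrt 0) (at_right 0)"
    by (intro tendsto_real_sqrt) (simp add: power2_eq_square)
  from tendsto_mult_left[OF this, of "sqrt (LINT x|lebesgue. (a x)\<^sup>2)"]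
  have lim: "((\<lambda>r. sqrt (LINT x|lebesgue. (a x)\<^sup>2) * sqrt (LINT x|lebesgue. indicator (cball 0 S) x * (?w r x - b x)\<^sup>2)) \<longlongrightarrow> 0) (at_right 0)"
    by simp
  have "((\<lambda>r. (LINT x|lebesgue. a x * ?w r x) - (LINT x|lebesgue. a x * b x)) \<longlongrightarrow> 0) (at_right 0)"
  proof (rule Lim_null_comparison[OF _ lim])
    have "\<bar>(LINT x|lebesgue. a x * ?w r x) - (LINT x|lebesgue. a x * b x)\<bar>
        \<le> sqrt (LINT x|lebesgue. (a x)\<^sup>2) * sqrt (LINT x|lebesgue. indicator (cball 0 S) x * (?w r x - b x)\<^sup>2)" if r: "0 < r" for r
    proof -
      let ?d = "\<lambda>x. indicator (cball 0 S) x * (?w r x - b x)"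
      have w: "locally_L2 (?w r)" by (intro locally_L2_smooth smooth_convolution test_rescaled r bl)
      have aw: "integrable lebesgue (\<lambda>x. a x * ?w r x)"
        by (rule integrable_bounded_support_of_local[OF locally_L2_mult[OF a w], of S]) (simp add: S)
      have d2: "(?d x)\<^sup>2 = indicator (cball 0 S) x * (?w r x - b x)\<^sup>2" for x by (simp add: indicator_def)
      have "(LINT x|lebesgue. a x * ?w r x) - (LINT x|lebesgue. a x * b x) = (LINT x|lebesgue. a x * ?w r x - a x * b x)"
        by (rule Bochner_Integration.integral_diff[OF aw ab, symmetric])
      also have "\<dots> = (LINT x|lebesgue. a x * ?d x)"
      proof (rule Bochner_Integration.integral_cong[OF refl])
        fix x show "a x * ?w r x - a x * b x = a x * ?d x"
          using S[of x] by (auto simp: indicator_def right_diff_distrib)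
      qed
      also have "\<bar>\<dots>\<bar> \<le> sqrt (LINT x|lebesgue. (a x)\<^sup>2) * sqrt (LINT x|lebesgue. (?d x)\<^sup>2)"
      proof (rule integral_Cauchy_Schwarz(2))
        show "a \<in> borel_measurable lebesgue" by (rule locally_L2_measurable[OF a])
        show "?d \<in> borel_measurable lebesgue"
          by (intro indicator_borel_mult locally_L2_measurable locally_L2_diff w b) simp
        show "integrable lebesgue (\<lambda>x. (a x)\<^sup>2)"
          by (rule integrable_bounded_support_of_local[of _ S]) (use a S in \<open>auto simp: locally_L2_def\<close>)
        show "integrable lebesgue (\<lambda>x. (?d x)\<^sup>2)"
          unfolding d2 using locally_L2_diff[OF w b] by (intro locally_integrable_cball) (simp add: locally_L2_def)
      qed
      finally show ?thesis unfolding d2 .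
    qed
    then show "\<forall>\<^sub>F r in at_right 0. norm ((LINT x|lebesgue. a x * ?w r x) - (LINT x|lebesgue. a x * b x))
        \<le> sqrt (LINT x|lebesgue. (a x)\<^sup>2) * sqrt (LINT x|lebesgue. indicator (cball 0 S) x * (?w r x - b x)\<^sup>2)"
      unfolding eventually_at_right[OF zero_less_one] by (intro exI[of _ 1]) auto
  qed
  then show ?thesis by (simp add: LIM_zero_iff)
qed

lemma (in mollifier) mollification_zero_imp_zero:
  fixes f :: "real^'n \<Rightarrow> real"
  assumes f: "locally_integrable f" and zero: "\<And>r x. r > 0 \<Longrightarrow> mollify r f x = 0"
  shows "AE x in lebesgue. f x = 0"
proof -
  have c: "\<forall>\<^sub>F r in at_right 0. (LINT x|lebesgue. indicator (cball 0 S) x * \<bar>mollify r f x - f x\<bar> ^ Suc 0)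
     = (LINT x|lebesgue. indicator (cball 0 S) x * \<bar>f x\<bar>)" for S
    unfolding eventually_at_right[OF zero_less_one] using zero by (intro exI[of _ 1]) auto
  have fa: "locally_integrable (\<lambda>x. \<bar>f x\<bar> ^ Suc 0)"
    using locally_integrable_abs[OF f] by simp
  have z: "(LINT x|lebesgue. indicator (cball 0 S) x * \<bar>f x\<bar>) = 0" for S
    using tendsto_unique[OF _ tendsto_eventually[OF c] local_mollification_tendsto[OF locally_integrable_measurable[OF f] fa, of S]]
    by (simp add: trivial_limit_at_right_real)
  have "AE x in lebesgue. indicator (cball 0 (real n)) x * \<bar>f x\<bar> = 0" for n
    using z[of "real n"] integral_nonneg_eq_0_iff_AE[of lebesgue "\<lambda>x. indicator (cball 0 (real n)) x * \<bar>f x\<bar>"]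
      locally_integrable_cball[OF fa, of "real n"] by simp
  then have "AE x in lebesgue. \<forall>n. indicator (cball 0 (real n)) x * \<bar>f x\<bar> = 0" unfolding AE_all_countable by blast
  then show ?thesis
  proof eventually_elim
    case (elim x)
    obtain n where "norm x \<le> real n" using real_arch_simple by blast
    then show ?case using elim[rule_format, of n] by (simp add: indicator_def)
  qed
qed

text \<open>A mollification is a pairing with reflected and translated test functions.\<close>

lemma (in mollifier) test_function_orthogonal:
  fixes f :: "real^'n \<Rightarrow> real"
  assumes f: "locally_integrable f" and zero: "\<And>\<phi>. test_function \<phi> \<Longrightarrow> (LINT x|lebesgue. f x * \<phi> x) = 0"
  shows "AE x in lebesgue. f x = 0"
proof (rule mollification_zero_imp_zero[OF f])
  show "mollify r f x = 0" if "r > 0" for r x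
    unfolding convolution_def
    using zero[OF test_function_reflect[OF test_rescaled[OF that]]] by (simp add: mult.commute)
qed

section \<open>Integral identities for the flow\<close>

lemma laplacian_convolution_potential:
  fixes f :: "real^3 \<Rightarrow> real"
  assumes ab: "0 < a" "a \<le> b" and f: "locally_integrable f"
  shows "laplacian (convolution (potential a b) f) x = convolution (rescaled radial_mollifier b) f x - convolution (rescaled radial_mollifier a) f x"
proof -
  have b: "0 < b" using ab by linarith
  note ta = radial.test_rescaled[OF ab(1)] and tb = radial.test_rescaled[OF b] and tK = test_function_potential[OF ab]
  have "laplacian (convolution (potential a b) f) x = (\<Sum>i\<in>UNIV. convolution (partial_deriv i (partial_deriv i (potential a b))) f x)"
    by (simp add: laplacian_def partial_deriv_convolution tK f test_function_partial_deriv)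
  also have "\<dots> = convolution (\<lambda>z. \<Sum>i\<in>UNIV. partial_deriv i (partial_deriv i (potential a b)) z) f x"
    by (rule convolution_sum_left[symmetric]) (intro test_function_partial_deriv tK f)+
  also have "\<dots> = convolution (rescaled radial_mollifier b) f x - convolution (rescaled radial_mollifier a) f x"
    unfolding laplacian_potential[OF ab] by (rule convolution_diff_left[OF tb ta f])
  finally show ?thesis .
qed

lemma weak_gradient_test:
  assumes "weak_gradient u G" "test_function \<phi>"
  shows "(LINT x|lebesgue. u x $ i * partial_deriv j \<phi> x) = - (LINT x|lebesgue. G x $ i $ j * \<phi> x)"
proof -
  have "dist_deriv j (dist_of (\<lambda>x. u x $ i)) \<phi> = dist_of (\<lambda>x. G x $ i $ j) \<phi>"
    using assms unfolding weak_gradient_def by blast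
  then show ?thesis by (simp add: dist_deriv_def dist_of_def)
qed

text \<open>In the momentum equation the pressure is gone because the test field is divergence-free, and one
  derivative of the viscous term has been moved onto \<open>u\<close>.\<close>

locale stationary_flow =
  fixes u :: "real^3 \<Rightarrow> real^3" and G :: "real^3 \<Rightarrow> real^3^3"
  assumes gradient: "weak_gradient u G"
    and u6: "integrable lebesgue (\<lambda>x. norm (u x) ^ 6)"
    and G2: "integrable lebesgue (\<lambda>x. (G x $ i $ j)\<^sup>2)"
    and divergence_free: "test_function \<phi> \<Longrightarrow> (\<Sum>i\<in>UNIV. LINT x|lebesgue. u x $ i * partial_deriv i \<phi> x) = 0"
    and momentum: "(\<And>i. test_function (W i)) \<Longrightarrow> (\<And>x. (\<Sum>i\<in>UNIV. partial_deriv i (W i) x) = 0) \<Longrightarrow>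
      (\<Sum>i\<in>UNIV. \<Sum>j\<in>UNIV. LINT x|lebesgue. G x $ i $ j * partial_deriv j (W i) x)
      + (\<Sum>i\<in>UNIV. LINT x|lebesgue. (G x *v u x) $ i * W i x) = 0"
begin

abbreviation "\<eta> \<equiv> radial_mollifier"
abbreviation "mollify r \<equiv> convolution (rescaled \<eta> r)"

lemmas gradient_eq = weak_gradient_test[OF gradient]

lemma u_locally_integrable: "locally_integrable (\<lambda>x. u x $ i)"
  using gradient by (simp add: weak_gradient_def)

lemma G_locally_integrable: "locally_integrable (\<lambda>x. G x $ i $ j)"
  using gradient by (simp add: weak_gradient_def)

lemma u_measurable: "(\<lambda>x. u x $ i) \<in> borel_measurable lebesgue"
  by (rule locally_integrable_measurable[OF u_locally_integrable])

lemma G_measurable: "(\<lambda>x. G x $ i $ j) \<in> borel_measurable lebesgue"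
  by (rule locally_integrable_measurable[OF G_locally_integrable])

lemma component_u_le: "\<bar>u x $ i\<bar> \<le> norm (u x)"
  by (rule component_le_norm_cart)

lemma norm_u_measurable: "(\<lambda>x. norm (u x)) \<in> borel_measurable lebesgue"
proof -
  have "(\<lambda>x. sqrt (\<Sum>i\<in>UNIV. u x $ i * u x $ i)) \<in> borel_measurable lebesgue"
    by (intro measurable_compose[OF _ borel_measurable_sqrt] borel_measurable_sum borel_measurable_times u_measurable)
  then show ?thesis by (simp add: norm_sq_sum[symmetric])
qed

lemma norm_u_power: "q \<le> 6 \<Longrightarrow> locally_integrable (\<lambda>x. norm (u x) ^ q)"
proof (rule locally_integrable_subset)
  show "(\<lambda>x. norm (u x) ^ q) \<in> borel_measurable lebesgue" using norm_u_measurable by simp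
  show "locally_integrable (\<lambda>x. 1 + norm (u x) ^ 6)"
    by (intro locally_integrable_add locally_integrable_smooth smooth_const locally_integrable_of_integrable u6)
  assume q: "q \<le> 6"
  fix x
  have "norm (u x) ^ q \<le> 1 + norm (u x) ^ 6"
  proof (cases "norm (u x) \<le> 1")
    case True
    then have "norm (u x) ^ q \<le> 1" by (simp add: power_le_one)
    moreover have "0 \<le> norm (u x) ^ 6" by simp
    ultimately show ?thesis by linarith
  next
    case False
    then have "norm (u x) ^ q \<le> norm (u x) ^ 6" using q by (intro power_increasing) auto
    then show ?thesis by simp
  qed
  then show "\<bar>norm (u x) ^ q\<bar> \<le> 1 + norm (u x) ^ 6" by simp
qed

lemma u4: "locally_integrable (\<lambda>x. (u x $ i) ^ 4)"
proof (rule locally_integrable_subset)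
  show "(\<lambda>x. (u x $ i) ^ 4) \<in> borel_measurable lebesgue" using u_measurable by simp
  show "locally_integrable (\<lambda>x. norm (u x) ^ 4)" by (rule norm_u_power) simp
  have "\<bar>u x $ i\<bar> ^ 4 \<le> norm (u x) ^ 4" for x by (intro power_mono component_u_le) auto
  then show "\<bar>(u x $ i) ^ 4\<bar> \<le> norm (u x) ^ 4" for x by (simp add: power_abs)
qed

lemma G_L2: "locally_L2 (\<lambda>x. G x $ i $ j)"
  unfolding locally_L2_def using G_measurable locally_integrable_of_integrable[OF G2] by simp

lemma u2_L2: "locally_L2 (\<lambda>x. (u x $ i)\<^sup>2)"
  unfolding locally_L2_def using u_measurable[of i] u4[of i] by (simp flip: power_mult)

lemma u_L2: "locally_L2 (\<lambda>x. u x $ i)"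
  unfolding locally_L2_def using u_measurable locally_L2_integrable[OF u2_L2] by simp

lemma uu_L2: "locally_L2 (\<lambda>x. u x $ i * u x $ j)"
  unfolding locally_L2_def power_mult_distrib
  by (intro conjI borel_measurable_times u_measurable locally_L2_mult u2_L2)

lemma mollify_div_free: "r > 0 \<Longrightarrow> (\<Sum>j\<in>UNIV. convolution (partial_deriv j (rescaled \<eta> r)) (\<lambda>y. u y $ j) x) = 0"
  using divergence_free[OF test_function_reflect[OF radial.test_rescaled], of r x]
  by (simp add: convolution_def partial_deriv_reflect test_function_smooth radial.test_rescaled mult.commute sum_negf)

lemma convolution_gradient:
  assumes k: "test_function \<kappa>"
  shows "convolution (partial_deriv j \<kappa>) (\<lambda>y. u y $ i) x = convolution \<kappa> (\<lambda>y. G y $ i $ j) x"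
  using gradient_eq[OF test_function_reflect[OF k], of i j x]
  by (simp add: convolution_def partial_deriv_reflect[OF test_function_smooth[OF k]] mult.commute)

text \<open>The weak product rule is obtained by mollifying one factor, which keeps the divergence zero and
  makes the product of this factor with a test function a test function.\<close>

lemma convection_divergence_form:
  assumes th: "test_function \<theta>"
  shows "(\<Sum>j\<in>UNIV. LINT x|lebesgue. G x $ i $ j * u x $ j * \<theta> x)
    = - (\<Sum>j\<in>UNIV. LINT x|lebesgue. u x $ i * u x $ j * partial_deriv j \<theta> x)"
proof -
  obtain S where S: "\<And>x. norm x > S \<Longrightarrow> \<theta> x = 0" using th test_function_iff by metis
  have S': "norm x > S \<Longrightarrow> partial_deriv j \<theta> x = 0" for x j using partial_deriv_outside[of S \<theta>] S by blast
  have sth: "smooth \<theta>" "smooth (partial_deriv j \<theta>)" for j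
    by (auto intro: test_function_smooth th smooth_partial_deriv)
  have moll: "(\<Sum>j\<in>UNIV. LINT x|lebesgue. G x $ i $ j * \<theta> x * mollify r (\<lambda>y. u y $ j) x)
      = - (\<Sum>j\<in>UNIV. LINT x|lebesgue. u x $ i * partial_deriv j \<theta> x * mollify r (\<lambda>y. u y $ j) x)" if r: "r > 0" for r
  proof -
    let ?w = "\<lambda>j. mollify r (\<lambda>y. u y $ j)"
    let ?dw = "\<lambda>j. convolution (partial_deriv j (rescaled \<eta> r)) (\<lambda>y. u y $ j)"
    have sw: "smooth (?w j)" for j by (intro smooth_convolution radial.test_rescaled r u_locally_integrable)
    have sdw: "smooth (?dw j)" for j
      by (intro smooth_convolution radial.test_rescaled r u_locally_integrable test_function_partial_deriv)
    have pw: "partial_deriv j (\<lambda>x. \<theta> x * ?w j x) = (\<lambda>x. \<theta> x * ?dw j x + partial_deriv j \<theta> x * ?w j x)" for j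
      unfolding partial_deriv_mult[OF smooth_differentiable[OF sth(1)] smooth_differentiable[OF sw]]
        partial_deriv_convolution[OF radial.test_rescaled[OF r] u_locally_integrable] ..
    have i1: "integrable lebesgue (\<lambda>x. u x $ i * (\<theta> x * ?dw j x))" for j
      by (intro integrable_mult_test u_locally_integrable test_function_mult_smooth th sdw)
    have i2: "integrable lebesgue (\<lambda>x. u x $ i * (partial_deriv j \<theta> x * ?w j x))" for j
      by (intro integrable_mult_test u_locally_integrable test_function_mult_smooth test_function_partial_deriv th sw)
    have "(\<Sum>j\<in>UNIV. LINT x|lebesgue. u x $ i * (\<theta> x * ?dw j x)) = (LINT x|lebesgue. (\<Sum>j\<in>UNIV. u x $ i * (\<theta> x * ?dw j x)))"
      by (rule Bochner_Integration.integral_sum[symmetric]) (rule i1)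
    also have "\<dots> = 0"
      by (simp add: mollify_div_free[OF r] flip: sum_distrib_left)
    finally have z: "(\<Sum>j\<in>UNIV. LINT x|lebesgue. u x $ i * (\<theta> x * ?dw j x)) = 0" .
    have "(LINT x|lebesgue. G x $ i $ j * (\<theta> x * ?w j x))
        = - (LINT x|lebesgue. u x $ i * (\<theta> x * ?dw j x)) - (LINT x|lebesgue. u x $ i * (partial_deriv j \<theta> x * ?w j x))" for j
      using gradient_eq[OF test_function_mult_smooth[OF th sw], of i j j] i1[of j] i2[of j]
      unfolding pw by (simp add: distrib_left)
    then show ?thesis using z by (simp add: sum_subtractf sum_negf mult.assoc)
  qed
  have L: "((\<lambda>r. \<Sum>j\<in>UNIV. LINT x|lebesgue. G x $ i $ j * \<theta> x * mollify r (\<lambda>y. u y $ j) x)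
      \<longlongrightarrow> (\<Sum>j\<in>UNIV. LINT x|lebesgue. G x $ i $ j * \<theta> x * u x $ j)) (at_right 0)"
    by (intro tendsto_sum radial.pairing_tendsto[of _ S] locally_L2_mult_smooth G_L2 u_L2 sth) (simp add: S)
  have R: "((\<lambda>r. - (\<Sum>j\<in>UNIV. LINT x|lebesgue. u x $ i * partial_deriv j \<theta> x * mollify r (\<lambda>y. u y $ j) x))
      \<longlongrightarrow> - (\<Sum>j\<in>UNIV. LINT x|lebesgue. u x $ i * partial_deriv j \<theta> x * u x $ j)) (at_right 0)"
    by (intro tendsto_minus tendsto_sum radial.pairing_tendsto[of _ S] locally_L2_mult_smooth u_L2 sth) (simp add: S')
  have ev: "\<forall>\<^sub>F r in at_right 0. (\<Sum>j\<in>UNIV. LINT x|lebesgue. G x $ i $ j * \<theta> x * mollify r (\<lambda>y. u y $ j) x)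
      = - (\<Sum>j\<in>UNIV. LINT x|lebesgue. u x $ i * partial_deriv j \<theta> x * mollify r (\<lambda>y. u y $ j) x)"
    unfolding eventually_at_right[OF zero_less_one] using moll by (intro exI[of _ 1]) auto
  have "(\<Sum>j\<in>UNIV. LINT x|lebesgue. G x $ i $ j * \<theta> x * u x $ j) = - (\<Sum>j\<in>UNIV. LINT x|lebesgue. u x $ i * partial_deriv j \<theta> x * u x $ j)"
    by (rule tendsto_unique[OF _ Lim_transform_eventually[OF L ev] R]) simp
  then show ?thesis by (simp add: mult_ac)
qed

lemma convection_components:
  assumes "test_function \<theta>"
  shows "(LINT x|lebesgue. (G x *v u x) $ i * \<theta> x) = (\<Sum>j\<in>UNIV. LINT x|lebesgue. G x $ i $ j * u x $ j * \<theta> x)"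
  unfolding matrix_vector_mult_def vec_lambda_beta sum_distrib_right
  by (rule Bochner_Integration.integral_sum) (intro integrable_mult_test locally_L2_mult G_L2 u_L2 assms)

text \<open>Formally \<open>u\<^sub>i (u \<cdot> \<nabla>) u\<^sub>i = u \<cdot> \<nabla> (u\<^sub>i\<^sup>2 / 2)\<close>. The product is legitimate with one factor \<open>u\<^sub>i\<close>
  mollified; the local integrability of \<open>|u|\<^sup>4\<close> then lets the mollification be removed.\<close>

lemma energy_flux:
  assumes p: "test_function \<phi>"
  shows "(\<Sum>j\<in>UNIV. LINT x|lebesgue. \<phi> x * (u x $ i * u x $ j * G x $ i $ j))
    = - (1/2) * (\<Sum>j\<in>UNIV. LINT x|lebesgue. (u x $ i)\<^sup>2 * u x $ j * partial_deriv j \<phi> x)"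
proof -
  obtain S where S: "\<And>x. norm x > S \<Longrightarrow> \<phi> x = 0" using p test_function_iff by metis
  have S': "norm x > S \<Longrightarrow> partial_deriv j \<phi> x = 0" for x j using partial_deriv_outside[of S \<phi>] S by blast
  have sp: "smooth \<phi>" "smooth (partial_deriv j \<phi>)" for j
    by (auto intro: test_function_smooth p smooth_partial_deriv)
  let ?w = "\<lambda>r. mollify r (\<lambda>y. u y $ i)"
  have moll: "(\<Sum>j\<in>UNIV. LINT x|lebesgue. \<phi> x * G x $ i $ j * (u x $ j * ?w r x))
      = - (\<Sum>j\<in>UNIV. (LINT x|lebesgue. (u x $ i * u x $ j * partial_deriv j \<phi> x) * ?w r x)
           + (LINT x|lebesgue. (u x $ i * u x $ j * \<phi> x) * mollify r (\<lambda>y. G y $ i $ j) x))" if r: "r > 0" for r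
  proof -
    have sw: "smooth (?w r)" by (intro smooth_convolution radial.test_rescaled r u_locally_integrable)
    have sG: "smooth (mollify r (\<lambda>y. G y $ i $ j))" for j by (intro smooth_convolution radial.test_rescaled r G_locally_integrable)
    have pw: "partial_deriv j (\<lambda>x. \<phi> x * ?w r x) = (\<lambda>x. \<phi> x * mollify r (\<lambda>y. G y $ i $ j) x + partial_deriv j \<phi> x * ?w r x)" for j
      unfolding partial_deriv_mult[OF smooth_differentiable[OF sp(1)] smooth_differentiable[OF sw]]
        partial_deriv_convolution[OF radial.test_rescaled[OF r] u_locally_integrable] convolution_gradient[OF radial.test_rescaled[OF r]] ..
    have uu: "locally_integrable (\<lambda>x. u x $ i * u x $ j)" for j by (rule locally_L2_integrable[OF uu_L2])
    have i1: "integrable lebesgue (\<lambda>x. u x $ i * u x $ j * (\<phi> x * mollify r (\<lambda>y. G y $ i $ j) x))" for j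
      by (intro integrable_mult_test uu test_function_mult_smooth p sG)
    have i2: "integrable lebesgue (\<lambda>x. u x $ i * u x $ j * (partial_deriv j \<phi> x * ?w r x))" for j
      by (intro integrable_mult_test uu test_function_mult_smooth test_function_partial_deriv p sw)
    show ?thesis
      using convection_divergence_form[OF test_function_mult_smooth[OF p sw], of i] i1 i2
      unfolding pw by (simp add: distrib_left sum.distrib mult_ac)
  qed
  have lim1: "((\<lambda>r. LINT x|lebesgue. \<phi> x * G x $ i $ j * (u x $ j * ?w r x)) \<longlongrightarrow> (LINT x|lebesgue. \<phi> x * G x $ i $ j * (u x $ j * u x $ i))) (at_right 0)" for j
  proof -
    let ?a = "\<lambda>x. \<phi> x * G x $ i $ j"
    have a: "locally_L2 ?a" using locally_L2_mult_smooth[OF G_L2 sp(1)] by (simp add: mult.commute)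
    have a2: "integrable lebesgue (\<lambda>x. (?a x)\<^sup>2)"
      by (rule integrable_bounded_support_of_local[of _ S]) (use a S in \<open>auto simp: locally_L2_def\<close>)
    have "((\<lambda>r. LINT x|lebesgue. indicator (cball 0 S) x * \<bar>?w r x - u x $ i\<bar> ^ Suc 3) \<longlongrightarrow> 0) (at_right 0)"
      using u4[of i] u_measurable by (intro radial.local_mollification_tendsto) (auto simp: power_even_abs)
    then have l4: "((\<lambda>r. LINT x|lebesgue. indicator (cball 0 S) x * (?w r x - u x $ i) ^ 4) \<longlongrightarrow> 0) (at_right 0)"
      by (simp add: power_even_abs del: power_Suc)
    let ?A = "sqrt (LINT x|lebesgue. (?a x)\<^sup>2)"
    let ?U = "sqrt (LINT x|lebesgue. indicator (cball 0 S) x * (u x $ j) ^ 4)"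
    let ?E = "\<lambda>r. LINT x|lebesgue. indicator (cball 0 S) x * (?w r x - u x $ i) ^ 4"
    have "((\<lambda>r. ?A * sqrt (?U * sqrt (?E r))) \<longlongrightarrow> ?A * sqrt (?U * sqrt 0)) (at_right 0)"
      by (intro tendsto_intros l4)
    then have lim: "((\<lambda>r. ?A * sqrt (?U * sqrt (?E r))) \<longlongrightarrow> 0) (at_right 0)" by simp
    have ic: "indicator (cball 0 S) x * indicator (cball 0 S) x = (indicator (cball 0 S) x :: real)" for x :: "real^3"
      by (simp add: indicator_def)
    have bound: "\<bar>(LINT x|lebesgue. ?a x * (u x $ j * ?w r x)) - (LINT x|lebesgue. ?a x * (u x $ j * u x $ i))\<bar>
        \<le> ?A * sqrt (?U * sqrt (?E r))" if r: "r > 0" for r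
    proof -
      have sw: "smooth (?w r)" by (intro smooth_convolution radial.test_rescaled r u_locally_integrable)
      let ?d = "\<lambda>x. ?w r x - u x $ i"
      have dm: "?d \<in> borel_measurable lebesgue" by (intro borel_measurable_diff smooth_lebesgue sw u_measurable)
      have "locally_integrable (\<lambda>x. 2 ^ 4 * ((?w r x) ^ 4 + (u x $ i) ^ 4))"
      proof (intro locally_integrable_cmult locally_integrable_add u4 locally_integrable_smooth)
        show "smooth (\<lambda>x. (?w r x) ^ 4)" by (simp add: eval_nat_numeral) (intro smooth_mult sw)
      qed
      then have d4: "locally_integrable (\<lambda>x. (?d x) ^ 4)"
      proof (rule locally_integrable_subset[rotated])
        show "(\<lambda>x. (?d x) ^ 4) \<in> borel_measurable lebesgue" using dm by simp
        show "\<bar>(?d x) ^ 4\<bar> \<le> 2 ^ 4 * ((?w r x) ^ 4 + (u x $ i) ^ 4)" for x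
          using abs_add_power_le[of "?w r x" "- u x $ i" 4] by (simp add: power_even_abs)
      qed
      have d2: "locally_L2 (\<lambda>x. (?d x)\<^sup>2)" unfolding locally_L2_def using dm d4 by (simp flip: power_mult)
      have dL2: "locally_L2 ?d" unfolding locally_L2_def using dm locally_L2_integrable[OF d2] by simp
      have ud: "locally_L2 (\<lambda>x. u x $ j * ?d x)"
        unfolding locally_L2_def power_mult_distrib
        by (intro conjI borel_measurable_times u_measurable dm locally_L2_mult u2_L2 d2)
      let ?b = "\<lambda>x. indicator (cball 0 S) x * (u x $ j * ?d x)"
      have b2: "(?b x)\<^sup>2 = (indicator (cball 0 S) x * (u x $ j)\<^sup>2) * (indicator (cball 0 S) x * (?d x)\<^sup>2)" for x
        by (simp add: indicator_def power_mult_distrib)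
      have b2': "(?b x)\<^sup>2 = indicator (cball 0 S) x * (u x $ j * ?d x)\<^sup>2" for x
        by (simp add: indicator_def)
      have B2: "(LINT x|lebesgue. (?b x)\<^sup>2) \<le> ?U * sqrt (?E r)"
      proof -
        have e1: "(indicator (cball 0 S) x * (u x $ j)\<^sup>2)\<^sup>2 = indicator (cball 0 S) x * (u x $ j) ^ 4" for x
          by (simp add: indicator_def flip: power_mult)
        have e2: "(indicator (cball 0 S) x * (?d x)\<^sup>2)\<^sup>2 = indicator (cball 0 S) x * (?d x) ^ 4" for x
          by (simp add: indicator_def flip: power_mult)
        have "\<bar>LINT x|lebesgue. (indicator (cball 0 S) x * (u x $ j)\<^sup>2) * (indicator (cball 0 S) x * (?d x)\<^sup>2)\<bar>
           \<le> sqrt (LINT x|lebesgue. (indicator (cball 0 S) x * (u x $ j)\<^sup>2)\<^sup>2) * sqrt (LINT x|lebesgue. (indicator (cball 0 S) x * (?d x)\<^sup>2)\<^sup>2)"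
        proof (rule integral_Cauchy_Schwarz(2))
          show "(\<lambda>x. indicat_real (cball 0 S) x * (u x $ j)\<^sup>2) \<in> borel_measurable lebesgue"
            by (rule indicator_borel_mult[OF locally_L2_measurable[OF u2_L2]]) simp
          show "(\<lambda>x. indicat_real (cball 0 S) x * (?d x)\<^sup>2) \<in> borel_measurable lebesgue"
            by (rule indicator_borel_mult[OF locally_L2_measurable[OF d2]]) simp
          show "integrable lebesgue (\<lambda>x. (indicat_real (cball 0 S) x * (u x $ j)\<^sup>2)\<^sup>2)"
            unfolding e1 by (rule locally_integrable_cball[OF u4])
          show "integrable lebesgue (\<lambda>x. (indicat_real (cball 0 S) x * (?d x)\<^sup>2)\<^sup>2)"
            unfolding e2 by (rule locally_integrable_cball[OF d4])
        qed
        then show ?thesis unfolding e1 e2 b2 by linarith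
      qed
      have "integrable lebesgue (\<lambda>x. ?a x * (u x $ j * ?w r x))" "integrable lebesgue (\<lambda>x. ?a x * (u x $ j * u x $ i))"
        by (rule integrable_bounded_support_of_local[of _ S],
            intro locally_L2_mult a locally_L2_mult_smooth u_L2 sw uu_L2, simp add: S)+
      then have "(LINT x|lebesgue. ?a x * (u x $ j * ?w r x)) - (LINT x|lebesgue. ?a x * (u x $ j * u x $ i))
          = (LINT x|lebesgue. ?a x * (u x $ j * ?w r x) - ?a x * (u x $ j * u x $ i))"
        by (rule Bochner_Integration.integral_diff[symmetric])
      also have "\<dots> = (LINT x|lebesgue. ?a x * ?b x)"
        by (rule Bochner_Integration.integral_cong[OF refl]) (use S in \<open>auto simp: indicator_def algebra_simps\<close>)
      finally have eqd: "(LINT x|lebesgue. ?a x * (u x $ j * ?w r x)) - (LINT x|lebesgue. ?a x * (u x $ j * u x $ i))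
          = (LINT x|lebesgue. ?a x * ?b x)" .
      have CS: "\<bar>LINT x|lebesgue. ?a x * ?b x\<bar> \<le> ?A * sqrt (LINT x|lebesgue. (?b x)\<^sup>2)"
      proof (rule integral_Cauchy_Schwarz(2)[OF _ _ a2])
        show "?a \<in> borel_measurable lebesgue" by (rule locally_L2_measurable[OF a])
        show "?b \<in> borel_measurable lebesgue"
          by (rule indicator_borel_mult[OF locally_L2_measurable[OF ud]]) simp
        show "integrable lebesgue (\<lambda>x. (?b x)\<^sup>2)"
          unfolding b2' by (rule locally_integrable_cball) (use ud in \<open>simp add: locally_L2_def\<close>)
      qed
      have "?A * sqrt (LINT x|lebesgue. (?b x)\<^sup>2) \<le> ?A * sqrt (?U * sqrt (?E r))"
        by (intro mult_left_mono real_sqrt_le_mono B2) simp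
      then show ?thesis unfolding eqd by (rule order_trans[OF CS])
    qed
    have "((\<lambda>r. (LINT x|lebesgue. ?a x * (u x $ j * ?w r x)) - (LINT x|lebesgue. ?a x * (u x $ j * u x $ i))) \<longlongrightarrow> 0) (at_right 0)"
    proof (rule Lim_null_comparison[OF _ lim])
      show "\<forall>\<^sub>F r in at_right 0. norm ((LINT x|lebesgue. ?a x * (u x $ j * ?w r x)) - (LINT x|lebesgue. ?a x * (u x $ j * u x $ i)))
          \<le> ?A * sqrt (?U * sqrt (?E r))"
        unfolding eventually_at_right[OF zero_less_one] using bound by (intro exI[of _ 1]) auto
    qed
    then show ?thesis by (simp add: LIM_zero_iff)
  qed
  have L: "((\<lambda>r. \<Sum>j\<in>UNIV. LINT x|lebesgue. \<phi> x * G x $ i $ j * (u x $ j * ?w r x))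
      \<longlongrightarrow> (\<Sum>j\<in>UNIV. LINT x|lebesgue. \<phi> x * G x $ i $ j * (u x $ j * u x $ i))) (at_right 0)"
    by (intro tendsto_sum lim1)
  have R: "((\<lambda>r. - (\<Sum>j\<in>UNIV. (LINT x|lebesgue. (u x $ i * u x $ j * partial_deriv j \<phi> x) * ?w r x)
           + (LINT x|lebesgue. (u x $ i * u x $ j * \<phi> x) * mollify r (\<lambda>y. G y $ i $ j) x)))
      \<longlongrightarrow> - (\<Sum>j\<in>UNIV. (LINT x|lebesgue. (u x $ i * u x $ j * partial_deriv j \<phi> x) * u x $ i)
           + (LINT x|lebesgue. (u x $ i * u x $ j * \<phi> x) * G x $ i $ j))) (at_right 0)"
    by (intro tendsto_minus tendsto_sum tendsto_add radial.pairing_tendsto[of _ S] locally_L2_mult_smooth uu_L2 u_L2 G_L2 sp)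
      (simp_all add: S S')
  have ev: "\<forall>\<^sub>F r in at_right 0. (\<Sum>j\<in>UNIV. LINT x|lebesgue. \<phi> x * G x $ i $ j * (u x $ j * ?w r x))
      = - (\<Sum>j\<in>UNIV. (LINT x|lebesgue. (u x $ i * u x $ j * partial_deriv j \<phi> x) * ?w r x)
           + (LINT x|lebesgue. (u x $ i * u x $ j * \<phi> x) * mollify r (\<lambda>y. G y $ i $ j) x))"
    unfolding eventually_at_right[OF zero_less_one] using moll by (intro exI[of _ 1]) auto
  have eq: "(\<Sum>j\<in>UNIV. LINT x|lebesgue. \<phi> x * G x $ i $ j * (u x $ j * u x $ i))
     = - (\<Sum>j\<in>UNIV. (LINT x|lebesgue. (u x $ i * u x $ j * partial_deriv j \<phi> x) * u x $ i)
           + (LINT x|lebesgue. (u x $ i * u x $ j * \<phi> x) * G x $ i $ j))"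
    by (rule tendsto_unique[OF _ Lim_transform_eventually[OF L ev] R]) simp
  show ?thesis using eq by (simp add: sum.distrib mult_ac power2_eq_square)
qed

lemma convolution_localized:
  assumes p: "test_function \<phi>" and k: "test_function \<kappa>"
  shows "convolution (partial_deriv j \<kappa>) (\<lambda>y. u y $ i * \<phi> y) x
      = convolution \<kappa> (\<lambda>y. G y $ i $ j * \<phi> y + u y $ i * partial_deriv j \<phi> y) x"
    and "(\<Sum>k\<in>UNIV. convolution (partial_deriv k \<kappa>) (\<lambda>y. u y $ k * \<phi> y) x)
      = convolution \<kappa> (\<lambda>y. \<Sum>k\<in>UNIV. u y $ k * partial_deriv k \<phi> y) x"
proof -
  have kr: "test_function (\<lambda>y. \<kappa> (x - y))" by (rule test_function_reflect[OF k])
  have sp: "smooth \<phi>" "smooth (partial_deriv j \<phi>)" for j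
    by (auto intro: test_function_smooth p smooth_partial_deriv)
  have pd: "partial_deriv j (\<lambda>y. \<kappa> (x - y) * \<phi> y) = (\<lambda>y. \<kappa> (x - y) * partial_deriv j \<phi> y - partial_deriv j \<kappa> (x - y) * \<phi> y)" for j
    unfolding partial_deriv_mult[OF smooth_differentiable[OF test_function_smooth[OF kr]] smooth_differentiable[OF sp(1)]]
      partial_deriv_reflect[OF test_function_smooth[OF k]] by simp
  have i1: "integrable lebesgue (\<lambda>y. u y $ i * (\<kappa> (x - y) * partial_deriv j \<phi> y))" for i j
    by (intro integrable_mult_test u_locally_integrable test_function_mult_smooth kr sp)
  have i2: "integrable lebesgue (\<lambda>y. u y $ i * (partial_deriv j \<kappa> (x - y) * \<phi> y))" for i j
    by (intro integrable_mult_test u_locally_integrable test_function_mult_smooth test_function_reflect test_function_partial_deriv k sp)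
  have i3: "integrable lebesgue (\<lambda>y. G y $ i $ j * (\<kappa> (x - y) * \<phi> y))"
    by (intro integrable_mult_test G_locally_integrable test_function_mult_smooth kr sp)
  have "(LINT y|lebesgue. u y $ i * (\<kappa> (x - y) * partial_deriv j \<phi> y)) - (LINT y|lebesgue. u y $ i * (partial_deriv j \<kappa> (x - y) * \<phi> y))
      = - (LINT y|lebesgue. G y $ i $ j * (\<kappa> (x - y) * \<phi> y))"
    using gradient_eq[OF test_function_mult_smooth[OF kr sp(1)], of i j] i1 i2 unfolding pd by (simp add: right_diff_distrib)
  then show "convolution (partial_deriv j \<kappa>) (\<lambda>y. u y $ i * \<phi> y) x
      = convolution \<kappa> (\<lambda>y. G y $ i $ j * \<phi> y + u y $ i * partial_deriv j \<phi> y) x"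
    using i1 i3 unfolding convolution_def by (simp add: distrib_left mult_ac)
  have "(\<Sum>k\<in>UNIV. LINT y|lebesgue. u y $ k * (\<kappa> (x - y) * partial_deriv k \<phi> y))
      = (\<Sum>k\<in>UNIV. LINT y|lebesgue. u y $ k * (partial_deriv k \<kappa> (x - y) * \<phi> y))"
    using divergence_free[OF test_function_mult_smooth[OF kr sp(1)]] i1 i2 unfolding pd
    by (simp add: right_diff_distrib sum_subtractf)
  moreover have "convolution \<kappa> (\<lambda>y. \<Sum>k\<in>UNIV. u y $ k * partial_deriv k \<phi> y) x
      = (LINT y|lebesgue. (\<Sum>k\<in>UNIV. u y $ k * (\<kappa> (x - y) * partial_deriv k \<phi> y)))"
    by (simp add: convolution_def sum_distrib_left mult_ac)
  moreover have "\<dots> = (\<Sum>k\<in>UNIV. LINT y|lebesgue. u y $ k * (\<kappa> (x - y) * partial_deriv k \<phi> y))"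
    by (rule Bochner_Integration.integral_sum) (rule i1)
  ultimately show "(\<Sum>k\<in>UNIV. convolution (partial_deriv k \<kappa>) (\<lambda>y. u y $ k * \<phi> y) x)
      = convolution \<kappa> (\<lambda>y. \<Sum>k\<in>UNIV. u y $ k * partial_deriv k \<phi> y) x"
    by (simp add: convolution_def mult_ac)
qed

text \<open>The test field is \<open>W = \<eta>\<^sub>a * (\<phi> u) - \<eta>\<^sub>b * (\<phi> u) + \<nabla> (K * f)\<close>, where \<open>f = \<nabla>\<phi> \<cdot> u\<close> is the divergence of
  \<open>\<phi> u\<close> and \<open>K\<close> is the potential with \<open>\<Delta>K = \<eta>\<^sub>b - \<eta>\<^sub>a\<close>. Its three parts have the divergences
  \<open>\<eta>\<^sub>a * f\<close>, \<open>- \<eta>\<^sub>b * f\<close> and \<open>\<eta>\<^sub>b * f - \<eta>\<^sub>a * f\<close>, so \<open>W\<close> is divergence-free. It replaces the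
  field \<open>\<phi> u\<close>, which is neither smooth nor divergence-free.\<close>

lemma tested_momentum:
  assumes p: "test_function \<phi>" and ab: "0 < a" "a \<le> b"
  defines "f \<equiv> \<lambda>x. \<Sum>k\<in>UNIV. u x $ k * partial_deriv k \<phi> x"
  shows "(\<Sum>i\<in>UNIV. \<Sum>j\<in>UNIV. LINT x|lebesgue. (G x $ i $ j - u x $ i * u x $ j) *
        mollify a (\<lambda>y. G y $ i $ j * \<phi> y + u y $ i * partial_deriv j \<phi> y) x)
    = (\<Sum>i\<in>UNIV. \<Sum>j\<in>UNIV. LINT x|lebesgue. (G x $ i $ j - u x $ i * u x $ j) *
        (convolution (partial_deriv j (rescaled \<eta> b)) (\<lambda>y. u y $ i * \<phi> y) x
         - partial_deriv j (partial_deriv i (convolution (potential a b) f)) x))"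
proof -
  have b: "0 < b" using ab by linarith
  obtain S where S: "\<And>x. norm x > S \<Longrightarrow> \<phi> x = 0" using p test_function_iff by metis
  have S': "norm x > S \<Longrightarrow> partial_deriv j \<phi> x = 0" for x j using partial_deriv_outside[of S \<phi>] S by blast
  have sp: "smooth \<phi>" "smooth (partial_deriv j \<phi>)" for j
    by (auto intro: test_function_smooth p smooth_partial_deriv)
  let ?V = "\<lambda>i y. u y $ i * \<phi> y"
  let ?D = "\<lambda>i j y. G y $ i $ j * \<phi> y + u y $ i * partial_deriv j \<phi> y"
  let ?K = "potential a b"
  have Vl: "locally_integrable (?V i)" for i by (intro locally_integrable_mult_smooth u_locally_integrable sp)
  have VS: "norm x > S \<Longrightarrow> ?V i x = 0" for i x by (simp add: S)
  have fl: "locally_integrable f" unfolding f_def by (intro locally_integrable_sum locally_integrable_mult_smooth u_locally_integrable sp) simp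
  have fS: "norm x > S \<Longrightarrow> f x = 0" for x by (simp add: f_def S')
  note ta = radial.test_rescaled[OF ab(1)] and tb = radial.test_rescaled[OF b] and tK = test_function_potential[OF ab]
  note cV = convolution_localized(1)[OF p] and cdiv = convolution_localized(2)[OF p, folded f_def]
  define W where "W = (\<lambda>i x. mollify a (?V i) x - mollify b (?V i) x + convolution (partial_deriv i ?K) f x)"
  have tW: "test_function (W i)" for i
    unfolding W_def by (intro test_function_add test_function_diff test_function_convolution[where S=S] ta tb tK test_function_partial_deriv Vl VS fl fS)
  have pW: "partial_deriv j (W i) x = mollify a (?D i j) x - (convolution (partial_deriv j (rescaled \<eta> b)) (?V i) x
      - partial_deriv j (partial_deriv i (convolution ?K f)) x)" for i j x
  proof -
    have s: "smooth (mollify a (?V i))" "smooth (mollify b (?V i))" "smooth (convolution (partial_deriv i ?K) f)"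
      by (intro smooth_convolution ta tb tK test_function_partial_deriv Vl fl)+
    show ?thesis
      unfolding W_def partial_deriv_add[OF smooth_differentiable[OF smooth_diff[OF s(1,2)]] smooth_differentiable[OF s(3)]]
        partial_deriv_diff[OF s(1,2)] partial_deriv_convolution[OF ta Vl] partial_deriv_convolution[OF tb Vl] cV[OF ta]
        partial_deriv_convolution[OF tK fl] by simp
  qed
  have divW: "(\<Sum>i\<in>UNIV. partial_deriv i (W i) x) = 0" for x
  proof -
    note lap = laplacian_convolution_potential[OF ab fl, unfolded laplacian_def]
    have "(\<Sum>i\<in>UNIV. partial_deriv i (W i) x) = (\<Sum>i\<in>UNIV. mollify a (?D i i) x) - (\<Sum>i\<in>UNIV. convolution (partial_deriv i (rescaled \<eta> b)) (?V i) x)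
       + (\<Sum>i\<in>UNIV. partial_deriv i (partial_deriv i (convolution ?K f)) x)"
      unfolding pW by (simp add: sum.distrib sum_subtractf)
    then show ?thesis unfolding cV[OF ta, symmetric] cdiv[OF ta] cdiv[OF tb] lap by simp
  qed
  have con: "(\<Sum>i\<in>UNIV. LINT x|lebesgue. (G x *v u x) $ i * W i x)
     = - (\<Sum>i\<in>UNIV. \<Sum>j\<in>UNIV. LINT x|lebesgue. u x $ i * u x $ j * partial_deriv j (W i) x)"
    by (simp add: convection_components[OF tW] convection_divergence_form[OF tW] sum_negf)
  have FL: "locally_integrable (\<lambda>x. G x $ i $ j - u x $ i * u x $ j)" for i j
    by (intro locally_integrable_diff G_locally_integrable locally_L2_integrable uu_L2)
  have "(\<Sum>i\<in>UNIV. \<Sum>j\<in>UNIV. LINT x|lebesgue. (G x $ i $ j - u x $ i * u x $ j) * partial_deriv j (W i) x) = 0"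
  proof -
    have i1: "integrable lebesgue (\<lambda>x. G x $ i $ j * partial_deriv j (W i) x)" for i j
      by (intro integrable_mult_test G_locally_integrable test_function_partial_deriv tW)
    have i2: "integrable lebesgue (\<lambda>x. u x $ i * u x $ j * partial_deriv j (W i) x)" for i j
      by (intro integrable_mult_test locally_L2_integrable uu_L2 test_function_partial_deriv tW)
    show ?thesis using momentum[OF tW divW] con i1 i2 by (simp add: left_diff_distrib sum_subtractf)
  qed
  moreover have "(LINT x|lebesgue. (G x $ i $ j - u x $ i * u x $ j) * partial_deriv j (W i) x)
     = (LINT x|lebesgue. (G x $ i $ j - u x $ i * u x $ j) * mollify a (?D i j) x)
     - (LINT x|lebesgue. (G x $ i $ j - u x $ i * u x $ j) * (convolution (partial_deriv j (rescaled \<eta> b)) (?V i) x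
      - partial_deriv j (partial_deriv i (convolution ?K f)) x))" for i j
  proof -
    have Dl: "locally_integrable (?D i j)"
      by (intro locally_integrable_add locally_integrable_mult_smooth G_locally_integrable u_locally_integrable sp)
    have DS: "norm x > S \<Longrightarrow> ?D i j x = 0" for x by (simp add: S S')
    have "integrable lebesgue (\<lambda>x. (G x $ i $ j - u x $ i * u x $ j) * mollify a (?D i j) x)"
      by (intro integrable_mult_test FL test_function_convolution[where S=S] ta Dl DS)
    moreover have "integrable lebesgue (\<lambda>x. (G x $ i $ j - u x $ i * u x $ j) * (convolution (partial_deriv j (rescaled \<eta> b)) (?V i) x
      - partial_deriv j (partial_deriv i (convolution ?K f)) x))"
      by (intro integrable_mult_test FL test_function_diff test_function_convolution[where S=S] tb Vl VS test_function_partial_deriv tK fl fS)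
    ultimately show ?thesis unfolding pW right_diff_distrib[of _ "mollify a (?D i j) _"]
      by (rule Bochner_Integration.integral_diff)
  qed
  ultimately show ?thesis by (simp add: sum_subtractf)
qed

end

section \<open>Averages over large balls\<close>

lemma measure_cball_scale:
  assumes "0 \<le> R" shows "measure lebesgue (cball (0::real^3) (R * s)) = R ^ 3 * measure lebesgue (cball (0::real^3) s)"
proof (cases "s \<ge> 0")
  case True
  then show ?thesis using assms by (simp add: content_cball power_mult_distrib)
next
  case False
  then show ?thesis using assms
    by (cases "R = 0") (auto simp: mult_pos_neg not_le)
qed

text \<open>Young's inequality for \<open>s = R powr (2/3) * t\<close>, in a form that separates \<open>s \<le> d\<close> from \<open>s > d\<close>.\<close>

lemma scaled_power_le:
  fixes t R d :: real
  assumes d: "0 < d" "d \<le> 1" and R: "0 < R" and t: "0 \<le> t" and q: "1 \<le> q" "q \<le> 4"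
  shows "R powr (2 * real q / 3) * t ^ q \<le> d + d powr (real q - 9/2) * R ^ 3 * t powr (9/2)"
proof -
  define s where "s = R powr (2/3) * t"
  have s0: "0 \<le> s" using t by (simp add: s_def)
  have sq: "R powr (2 * real q / 3) * t ^ q = s ^ q"
    using R by (simp add: s_def power_mult_distrib powr_powr flip: powr_realpow)
  have s92: "s powr (9/2) = R ^ 3 * t powr (9/2)"
    using R t by (simp add: s_def powr_mult powr_powr powr_numeral)
  have nn: "0 \<le> d powr (real q - 9/2) * s powr (9/2)" by simp
  have "s ^ q \<le> d + d powr (real q - 9/2) * s powr (9/2)"
  proof (cases "s \<le> d")
    case True
    have "s ^ q \<le> s ^ 1" using True s0 d q by (intro power_decreasing) auto
    then have "s ^ q \<le> d" using True by simp
    then show ?thesis using nn by linarith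
  next
    case False
    then have s: "s > 0" using d by simp
    have "s ^ q = s powr (9/2) * s powr (real q - 9/2)"
      using s by (simp flip: powr_realpow powr_add)
    also have "\<dots> \<le> s powr (9/2) * d powr (real q - 9/2)"
    proof (rule mult_left_mono)
      show "s powr (real q - 9/2) \<le> d powr (real q - 9/2)"
        using False d q by (intro powr_mono2') auto
    qed simp
    finally show ?thesis using d by (simp add: mult.commute)
  qed
  then show ?thesis by (simp add: sq s92 mult.assoc)
qed

text \<open>Hoelder's inequality bounds these scaled integrals. They even tend to zero: the part of the integral
  near the origin is divided by a positive power of \<open>R\<close>, because \<open>q < 9/2\<close>, and the rest is, up to an
  arbitrarily small constant, controlled by the tail of the integral of \<open>n powr (9/2)\<close>.\<close>

lemma scaled_average_tendsto_zero:
  fixes n :: "real^3 \<Rightarrow> real"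
  assumes n0: "\<And>x. 0 \<le> n x" and nm: "n \<in> borel_measurable lebesgue"
    and n92: "integrable lebesgue (\<lambda>x. n x powr (9/2))"
    and nq: "locally_integrable (\<lambda>x. n x ^ q)" and q: "1 \<le> q" "q \<le> 4"
  shows "((\<lambda>R. (LINT x|lebesgue. indicator (cball 0 (2 * R)) x * n x ^ q) / R powr (3 - 2 * real q / 3)) \<longlongrightarrow> 0) at_top"
proof (rule tendstoI)
  fix e :: real assume e: "e > 0"
  define V where "V = measure lebesgue (cball (0::real^3) 2)"
  have V0: "V \<ge> 0" by (simp add: V_def)
  define d where "d = min 1 (e / (3 * (V + 1)))"
  have d: "0 < d" "d \<le> 1" using e V0 by (auto simp: d_def)
  have dV: "d * V < e / 3"
  proof -
    have "d * V \<le> e / (3 * (V + 1)) * V" using V0 by (intro mult_right_mono) (auto simp: d_def)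
    also have "\<dots> = e / 3 * (V / (V + 1))" by simp
    also have "\<dots> < e / 3 * 1" using e V0 by (intro mult_strict_left_mono) auto
    finally show ?thesis by simp
  qed
  define K where "K = d powr (real q - 9/2)"
  have K0: "K > 0" using d by (simp add: K_def)
  define out where "out = (\<lambda>(k::nat) x. indicator (- cball 0 (real k)) x * n x powr (9/2))"
  have outi: "integrable lebesgue (out k)" for k
    unfolding out_def using integrable_mult_indicator[OF _ n92, of "- cball 0 (real k)"] by simp
  have "(\<lambda>k. LINT x|lebesgue. out k x) \<longlonglongrightarrow> (LINT x|(lebesgue :: (real^3) measure). 0)"
  proof (rule integral_dominated_convergence[where w="\<lambda>x. n x powr (9/2)"])
    show "integrable lebesgue (\<lambda>x. n x powr (9/2))" by (rule n92)
    show "out k \<in> borel_measurable lebesgue" for k using outi by (rule borel_measurable_integrable)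
    show "AE x in lebesgue. (\<lambda>k. out k x) \<longlonglongrightarrow> 0"
    proof (rule AE_I2, rule tendsto_eventually)
      fix x :: "real^3"
      show "\<forall>\<^sub>F k in sequentially. out k x = 0"
        using eventually_ge_at_top[of "nat \<lceil>norm x\<rceil>"]
        by eventually_elim (simp add: out_def indicator_def nat_ceiling_le_eq)
    qed
    show "AE x in lebesgue. norm (out k x) \<le> n x powr (9/2)" for k by (simp add: out_def indicator_def)
  qed simp
  then have "(\<lambda>k. LINT x|lebesgue. out k x) \<longlonglongrightarrow> 0" by simp
  from order_tendstoD(2)[OF this, of "e / (3 * K)"] obtain k where k: "(LINT x|lebesgue. out k x) < e / (3 * K)"
    using e K0 by (auto simp: eventually_sequentially)
  define I where "I = (LINT x|lebesgue. indicator (cball 0 (real k)) x * n x ^ q)"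
  have "((\<lambda>R. I * R powr - (3 - 2 * real q / 3)) \<longlongrightarrow> I * 0) at_top"
    by (intro tendsto_mult tendsto_const tendsto_neg_powr filterlim_ident) (use q in simp)
  then have ev: "\<forall>\<^sub>F R in at_top. I * R powr - (3 - 2 * real q / 3) < e / 3"
    using e by (intro order_tendstoD(2)[of _ "I * 0"]) auto
  show "\<forall>\<^sub>F R in at_top. dist ((LINT x|lebesgue. indicator (cball 0 (2 * R)) x * n x ^ q) / R powr (3 - 2 * real q / 3)) 0 < e"
    using ev eventually_gt_at_top[of 0]
  proof eventually_elim
    case (elim R)
    have R: "R > 0" by (rule elim(2))
    let ?s = "R powr (2 * real q / 3)"
    have pw: "R powr (3 - 2 * real q / 3) = R ^ 3 / ?s"
      using R by (simp add: powr_diff powr_numeral)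
    let ?J = "\<lambda>x. indicator (cball 0 (real k)) x * n x ^ q * ?s + d * indicator (cball 0 (2 * R)) x + K * R ^ 3 * out k x"
    have le: "indicator (cball 0 (2 * R)) x * n x ^ q * ?s \<le> ?J x" for x
    proof (cases "norm x \<le> real k")
      case True
      then show ?thesis using n0[of x] d by (auto simp: indicator_def out_def)
    next
      case False
      then show ?thesis
        using scaled_power_le[OF d R n0[of x] q] n0[of x] K0 R by (auto simp: indicator_def out_def K_def mult_ac)
    qed
    have i1: "integrable lebesgue (\<lambda>x. indicator (cball 0 S) x * n x ^ q)" for S
      by (rule locally_integrable_cball[OF nq])
    have "(LINT x|lebesgue. indicator (cball 0 (2 * R)) x * n x ^ q) * ?s = (LINT x|lebesgue. indicator (cball 0 (2 * R)) x * n x ^ q * ?s)"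
      by simp
    also have "\<dots> \<le> integral\<^sup>L lebesgue ?J"
    proof (rule integral_mono[OF _ _ le])
      show "integrable lebesgue (\<lambda>x. indicator (cball 0 (2 * R)) x * n x ^ q * ?s)" using i1 by simp
      show "integrable lebesgue ?J"
        by (intro Bochner_Integration.integrable_add integrable_mult_left integrable_mult_right i1 outi integrable_indicator_cball)
    qed
    also have "\<dots> = I * ?s + d * (R ^ 3 * V) + K * R ^ 3 * (LINT x|lebesgue. out k x)"
    proof -
      have "measure lebesgue (cball (0::real^3) (2 * R)) = R ^ 3 * V"
        using measure_cball_scale[of R 2] R by (simp add: V_def mult.commute)
      then show ?thesis
        using i1 outi integrable_indicator_cball[of "0::real^3" "2 * R"] by (simp add: I_def)
    qed
    finally have "(LINT x|lebesgue. indicator (cball 0 (2 * R)) x * n x ^ q) * ?s / R ^ 3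
        \<le> (I * ?s + d * (R ^ 3 * V) + K * R ^ 3 * (LINT x|lebesgue. out k x)) / R ^ 3"
      using R by (intro divide_right_mono) auto
    also have "\<dots> = I * (?s / R ^ 3) + d * V + K * (LINT x|lebesgue. out k x)"
      using R by (simp add: add_divide_distrib)
    also have "I * (?s / R ^ 3) = I * R powr - (3 - 2 * real q / 3)"
      unfolding powr_minus pw using R by simp
    also have "I * R powr - (3 - 2 * real q / 3) + d * V + K * (LINT x|lebesgue. out k x) < e / 3 + e / 3 + e / 3"
    proof -
      have "K * (LINT x|lebesgue. out k x) < e / 3" using k K0 by (simp add: field_simps)
      then show ?thesis using elim(1) dV by linarith
    qed
    finally have "(LINT x|lebesgue. indicator (cball 0 (2 * R)) x * n x ^ q) / R powr (3 - 2 * real q / 3) < e"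
      using R by (simp add: pw)
    moreover have "0 \<le> (LINT x|lebesgue. indicator (cball 0 (2 * R)) x * n x ^ q)"
      using n0 by (intro integral_nonneg_AE AE_I2) auto
    ultimately show ?case by (simp add: dist_real_def)
  qed
qed

section \<open>Vanishing of the Dirichlet integral\<close>

lemma abs_integral_bounded_support_le:
  fixes f k h :: "real^'n::finite \<Rightarrow> real"
  assumes h: "locally_integrable h" and f: "\<And>x. \<bar>f x\<bar> \<le> h x"
    and k: "\<And>x. \<bar>k x\<bar> \<le> c" and S: "\<And>x. norm x > S \<Longrightarrow> k x = 0"
  shows "\<bar>LINT x|lebesgue. f x * k x\<bar> \<le> c * (LINT x|lebesgue. indicator (cball 0 S) x * h x)"
proof -
  have c0: "0 \<le> c" using k[of 0] by linarith
  have h0: "0 \<le> h x" for x using f[of x] by linarith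
  have i: "integrable lebesgue (\<lambda>x. c * (indicator (cball 0 S) x * h x))"
    by (intro integrable_mult_right locally_integrable_cball h)
  have le: "\<bar>f x * k x\<bar> \<le> c * (indicator (cball 0 S) x * h x)" for x
  proof (cases "norm x > S")
    case False
    then show ?thesis using mult_mono[OF f[of x] k[of x]] h0[of x] by (simp add: abs_mult mult.commute)
  qed (simp add: S c0 h0)
  have "\<bar>LINT x|lebesgue. f x * k x\<bar> \<le> (LINT x|lebesgue. \<bar>f x * k x\<bar>)" by (rule integral_abs_bound)
  also have "\<dots> \<le> (LINT x|lebesgue. c * (indicator (cball 0 S) x * h x))"
    by (rule integral_mono_AE'[OF i]) (use le c0 h0 in auto)
  finally show ?thesis by simp
qed

lemma (in mollifier) pairing_tendsto_right:
  assumes a: "locally_L2 a" and b: "locally_L2 b" and S: "\<And>x. norm x > S \<Longrightarrow> b x = 0"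
  shows "((\<lambda>r. LINT x|lebesgue. a x * mollify r b x) \<longlongrightarrow> (LINT x|lebesgue. a x * b x)) (at_right 0)"
proof -
  let ?a = "\<lambda>x. indicator (cball 0 (S + 1)) x * a x"
  have sq: "(?a x)\<^sup>2 = indicator (cball 0 (S + 1)) x * (a x)\<^sup>2" for x by (simp add: indicator_def)
  have "locally_L2 ?a"
    unfolding locally_L2_def sq
    using a by (auto simp: locally_L2_def intro!: indicator_borel_mult locally_integrable_of_integrable locally_integrable_cball)
  then have lim: "((\<lambda>r. LINT x|lebesgue. ?a x * mollify r b x) \<longlongrightarrow> (LINT x|lebesgue. ?a x * b x)) (at_right 0)"
    by (rule pairing_tendsto[of _ "S + 1", OF _ _ b]) simp
  have eqb: "?a x * b x = a x * b x" for x using S[of x] by (auto simp: indicator_def)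
  have eqr: "?a x * mollify r b x = a x * mollify r b x" if r: "0 < r" "r < 1" for r x
  proof (cases "norm x \<le> S + 1")
    case False
    have "mollify r b x = 0"
      by (rule convolution_outside[of r _ S]) (use rescaled_support[OF r(1)] S False r in auto)
    then show ?thesis by simp
  qed simp
  have "\<forall>\<^sub>F r in at_right 0. (LINT x|lebesgue. ?a x * mollify r b x) = (LINT x|lebesgue. a x * mollify r b x)"
    unfolding eventually_at_right[OF zero_less_one]
  proof (intro exI[of _ 1] conjI allI impI)
    fix r :: real assume "0 < r" "r < 1"
    then show "(LINT x|lebesgue. ?a x * mollify r b x) = (LINT x|lebesgue. a x * mollify r b x)"
      by (simp only: eqr)
  qed simp
  from Lim_transform_eventually[OF lim this] show ?thesis unfolding eqb .
qed

lemma partial_deriv_rescaled: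
  fixes \<eta> :: "real^'n::finite \<Rightarrow> real"
  assumes "test_function \<eta>" "r > 0"
  shows "partial_deriv j (rescaled \<eta> r) x = partial_deriv j \<eta> (x /\<^sub>R r) / r ^ Suc CARD('n)"
proof -
  have s: "smooth \<eta>" using assms(1) by (rule test_function_smooth)
  have "rescaled \<eta> r = (\<lambda>x. (1 / r ^ CARD('n)) * \<eta> (0 + inverse r *\<^sub>R x))" by (auto simp: rescaled_def)
  then have "partial_deriv j (rescaled \<eta> r) = (\<lambda>x. (1 / r ^ CARD('n)) * (inverse r * partial_deriv j \<eta> (0 + inverse r *\<^sub>R x)))"
    by (simp only: partial_deriv_cmult[OF smooth_affine[OF s]] partial_deriv_affine[OF smooth_differentiable[OF s]])
  then show ?thesis by (simp add: divide_inverse mult_ac)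
qed

definition cutoff :: "real \<Rightarrow> real^3 \<Rightarrow> real" where
  "cutoff R x = radial_bump 0 (x /\<^sub>R R)"

lemma test_function_cutoff: "R > 0 \<Longrightarrow> test_function (cutoff R)"
  using test_function_affine[OF test_function_radial_bump, of "inverse R" 0 0] by (simp add: cutoff_def[abs_def])

lemma cutoff_support: "R > 0 \<Longrightarrow> norm x > R \<Longrightarrow> cutoff R x = 0"
  unfolding cutoff_def by (rule radial_bump_support) (simp add: field_simps)

lemma cutoff_range: "0 \<le> cutoff R x" "cutoff R x \<le> 1"
  by (auto simp: cutoff_def radial_bump_def bump_0)

text \<open>At \<open>|x| = R / 2\<close> the exponent \<open>1 / (1 - |x / R|\<^sup>2)\<close> of the bump equals \<open>4 / 3\<close>.\<close>

lemma cutoff_lower: "R > 0 \<Longrightarrow> norm x \<le> R / 2 \<Longrightarrow> exp (- 4 / 3) \<le> cutoff R x"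
proof -
  assume R: "R > 0" "norm x \<le> R / 2"
  then have "norm (x /\<^sub>R R) \<le> 1 / 2" by (simp add: field_simps)
  then have s: "(norm (x /\<^sub>R R))\<^sup>2 \<le> (1 / 2)\<^sup>2" by (intro power_mono) auto
  define t where "t = 1 - (norm (x /\<^sub>R R))\<^sup>2"
  have t: "3 / 4 \<le> t" using s by (simp add: t_def power2_eq_square)
  have "1 / t \<le> 4 / 3" using t by (simp add: field_simps)
  then show ?thesis using t unfolding cutoff_def radial_bump_def bump_0 t_def[symmetric]
    by (auto simp: t_def)
qed

lemma partial_deriv_cutoff: "R > 0 \<Longrightarrow> partial_deriv j (cutoff R) x = partial_deriv j (radial_bump 0) (x /\<^sub>R R) / R"
  using partial_deriv_affine[OF smooth_differentiable[OF test_function_smooth[OF test_function_radial_bump[of 0]]],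
      where i=j and a=0 and c="inverse R"]
  by (simp add: cutoff_def[abs_def] fun_eq_iff divide_inverse mult.commute)

locale decaying_flow = stationary_flow +
  assumes u92: "integrable lebesgue (\<lambda>x. norm (u x) powr (9/2))"
begin

text \<open>The radius \<open>2 R\<close> is that of the support of the test field when the cutoff and the larger
  mollification scale are both \<open>R\<close>.\<close>

definition moment :: "nat \<Rightarrow> real \<Rightarrow> real" where
  "moment q R = (LINT x|lebesgue. indicator (cball 0 (2 * R)) x * norm (u x) ^ q)"

lemma moment_nonneg: "0 \<le> moment q R"
  unfolding moment_def by (intro integral_nonneg_AE AE_I2) auto

lemma ball_moment_le:
  assumes "S \<le> 2 * R" "q \<le> 6"
  shows "(LINT x|lebesgue. indicator (cball 0 S) x * norm (u x) ^ q) \<le> moment q R"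
  unfolding moment_def
  by (rule integral_mono[OF locally_integrable_cball locally_integrable_cball])
    (use assms in \<open>auto intro!: norm_u_power mult_right_mono simp: indicator_def\<close>)

text \<open>The scaling under which \<open>u\<close> behaves like \<open>|x| powr (-2/3)\<close>, the borderline of \<open>L\<^sup>9\<^sup>/\<^sup>2\<close>.\<close>

lemma moment_tendsto: "1 \<le> q \<Longrightarrow> q \<le> 4 \<Longrightarrow> ((\<lambda>R. moment q R / R powr (3 - 2 * real q / 3)) \<longlongrightarrow> 0) at_top"
  unfolding moment_def
  by (rule scaled_average_tendsto_zero) (auto intro: norm_u_measurable u92 norm_u_power)

lemma norm_G_sq: "(norm (G x))\<^sup>2 = (\<Sum>i\<in>UNIV. \<Sum>j\<in>UNIV. (G x $ i $ j)\<^sup>2)"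
  unfolding power2_norm_eq_inner inner_vec_def by (simp add: power2_eq_square)

lemma norm_G_sq_integrable: "integrable lebesgue (\<lambda>x. (norm (G x))\<^sup>2)"
  unfolding norm_G_sq by (intro Bochner_Integration.integrable_sum G2)

lemma norm_G_measurable: "(\<lambda>x. norm (G x)) \<in> borel_measurable lebesgue"
proof -
  have "(\<lambda>x. sqrt ((norm (G x))\<^sup>2)) \<in> borel_measurable lebesgue"
    by (intro measurable_compose[OF _ borel_measurable_sqrt] borel_measurable_integrable norm_G_sq_integrable)
  then show ?thesis by simp
qed

lemma norm_G_L2: "locally_L2 (\<lambda>x. norm (G x))"
  unfolding locally_L2_def using norm_G_measurable locally_integrable_of_integrable[OF norm_G_sq_integrable] by simp

lemma norm_u_L2: "locally_L2 (\<lambda>x. norm (u x))"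
  unfolding locally_L2_def using norm_u_measurable norm_u_power[of 2] by simp

lemma component_G_le: "\<bar>G x $ i $ j\<bar> \<le> norm (G x)"
  using component_le_norm_cart[of "G x $ i" j] Finite_Cartesian_Product.norm_nth_le[of "G x" i] by linarith

definition "dirichlet = (LINT x|lebesgue. (norm (G x))\<^sup>2)"

lemma dirichlet_nonneg: "0 \<le> dirichlet" by (simp add: dirichlet_def)

lemma ball_G_mult_le:
  assumes f: "f \<in> borel_measurable lebesgue" and f2: "locally_integrable (\<lambda>x. (f x)\<^sup>2)"
  shows "(LINT x|lebesgue. indicator (cball 0 S) x * (norm (G x) * f x))
    \<le> sqrt dirichlet * sqrt (LINT x|lebesgue. indicator (cball 0 S) x * (f x)\<^sup>2)"
proof -
  let ?f = "\<lambda>x. indicator (cball 0 S) x * f x"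
  have sq: "(?f x)\<^sup>2 = indicator (cball 0 S) x * (f x)\<^sup>2" for x by (simp add: indicator_def)
  have "\<bar>LINT x|lebesgue. norm (G x) * ?f x\<bar> \<le> sqrt dirichlet * sqrt (LINT x|lebesgue. (?f x)\<^sup>2)"
    unfolding dirichlet_def
    by (rule integral_Cauchy_Schwarz(2)[OF norm_G_measurable indicator_borel_mult[OF f] norm_G_sq_integrable])
      (auto simp: sq intro: locally_integrable_cball f2)
  then show ?thesis unfolding sq by (simp add: mult.left_commute)
qed

lemma ball_flux_le:
  fixes i j :: 3
  shows "locally_integrable (\<lambda>x. norm (G x) + (norm (u x))\<^sup>2)"
    "\<bar>G x $ i $ j - u x $ i * u x $ j\<bar> \<le> norm (G x) + (norm (u x))\<^sup>2"
    "R > 0 \<Longrightarrow> (LINT x|lebesgue. indicator (cball 0 (2 * R)) x * (norm (G x) + (norm (u x))\<^sup>2))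
      \<le> sqrt dirichlet * sqrt (measure lebesgue (cball (0::real^3) 2) * R ^ 3) + moment 2 R"
    "(LINT x|lebesgue. indicator (cball 0 (2 * R)) x * (G x $ i $ j - u x $ i * u x $ j)\<^sup>2) \<le> 2 * dirichlet + 2 * moment 4 R"
proof -
  have Gl: "locally_integrable (\<lambda>x. norm (G x))" by (rule locally_L2_integrable[OF norm_G_L2])
  show "locally_integrable (\<lambda>x. norm (G x) + (norm (u x))\<^sup>2)"
    by (intro locally_integrable_add Gl norm_u_power) simp
  have F: "\<bar>G x $ i $ j - u x $ i * u x $ j\<bar> \<le> norm (G x) + (norm (u x))\<^sup>2" for x
  proof -
    have "\<bar>u x $ i * u x $ j\<bar> \<le> norm (u x) * norm (u x)"
      unfolding abs_mult by (intro mult_mono component_u_le) auto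
    then show ?thesis using component_G_le[where x=x and i=i and j=j] unfolding power2_eq_square by linarith
  qed
  then show "\<bar>G x $ i $ j - u x $ i * u x $ j\<bar> \<le> norm (G x) + (norm (u x))\<^sup>2" .
  show "(LINT x|lebesgue. indicator (cball 0 (2 * R)) x * (norm (G x) + (norm (u x))\<^sup>2))
      \<le> sqrt dirichlet * sqrt (measure lebesgue (cball (0::real^3) 2) * R ^ 3) + moment 2 R" if R: "R > 0"
  proof -
    have "measure lebesgue (cball (0::real^3) (2 * R)) = measure lebesgue (cball (0::real^3) 2) * R ^ 3"
      using measure_cball_scale[of R 2] R by (simp add: mult.commute)
    then have "(LINT x|lebesgue. indicator (cball (0::real^3) (2 * R)) x * 1\<^sup>2) = measure lebesgue (cball (0::real^3) 2) * R ^ 3"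
      by simp
    moreover have "(LINT x|lebesgue. indicator (cball 0 (2 * R)) x * (norm (G x) * 1))
        \<le> sqrt dirichlet * sqrt (LINT x|lebesgue. indicator (cball (0::real^3) (2 * R)) x * 1\<^sup>2)"
      by (rule ball_G_mult_le) (auto intro: locally_integrable_smooth smooth_const)
    ultimately have "(LINT x|lebesgue. indicator (cball 0 (2 * R)) x * norm (G x)) \<le> sqrt dirichlet * sqrt (measure lebesgue (cball (0::real^3) 2) * R ^ 3)"
      by simp
    moreover have "(LINT x|lebesgue. indicator (cball 0 (2 * R)) x * (norm (G x) + (norm (u x))\<^sup>2))
        = (LINT x|lebesgue. indicator (cball 0 (2 * R)) x * norm (G x)) + moment 2 R"
      unfolding moment_def distrib_left
      by (rule Bochner_Integration.integral_add[OF locally_integrable_cball[OF Gl] locally_integrable_cball[OF norm_u_power]]) simp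
    ultimately show ?thesis by simp
  qed
  have F2: "(G x $ i $ j - u x $ i * u x $ j)\<^sup>2 \<le> 2 * (norm (G x))\<^sup>2 + 2 * norm (u x) ^ 4" for x
  proof -
    have "\<bar>G x $ i $ j - u x $ i * u x $ j\<bar>\<^sup>2 \<le> (norm (G x) + (norm (u x))\<^sup>2)\<^sup>2"
      by (intro power_mono F) simp
    also have "\<dots> \<le> 2 * (norm (G x))\<^sup>2 + 2 * ((norm (u x))\<^sup>2)\<^sup>2"
      using sum_squares_bound[of "norm (G x)" "(norm (u x))\<^sup>2"] unfolding power2_sum by argo
    finally show ?thesis by (simp flip: power_mult)
  qed
  have FL: "locally_L2 (\<lambda>x. G x $ i $ j - u x $ i * u x $ j)" by (intro locally_L2_diff G_L2 uu_L2)
  have i4: "integrable lebesgue (\<lambda>x. indicator (cball 0 (2 * R)) x * norm (u x) ^ 4)"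
    by (rule locally_integrable_cball[OF norm_u_power]) simp
  have "(LINT x|lebesgue. indicator (cball 0 (2 * R)) x * (G x $ i $ j - u x $ i * u x $ j)\<^sup>2)
      \<le> (LINT x|lebesgue. 2 * (norm (G x))\<^sup>2 + 2 * (indicator (cball 0 (2 * R)) x * norm (u x) ^ 4))"
  proof (rule integral_mono)
    show "integrable lebesgue (\<lambda>x. indicator (cball 0 (2 * R)) x * (G x $ i $ j - u x $ i * u x $ j)\<^sup>2)"
      using FL by (intro locally_integrable_cball) (simp add: locally_L2_def)
    show "integrable lebesgue (\<lambda>x. 2 * (norm (G x))\<^sup>2 + 2 * (indicator (cball 0 (2 * R)) x * norm (u x) ^ 4))"
      by (intro Bochner_Integration.integrable_add integrable_mult_right norm_G_sq_integrable i4)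
    show "indicator (cball 0 (2 * R)) x * (G x $ i $ j - u x $ i * u x $ j)\<^sup>2
        \<le> 2 * (norm (G x))\<^sup>2 + 2 * (indicator (cball 0 (2 * R)) x * norm (u x) ^ 4)" for x
      using F2[of x] by (auto simp: indicator_def)
  qed
  also have "\<dots> = 2 * dirichlet + 2 * moment 4 R"
    using norm_G_sq_integrable i4 by (simp add: dirichlet_def moment_def)
  finally show "(LINT x|lebesgue. indicator (cball 0 (2 * R)) x * (G x $ i $ j - u x $ i * u x $ j)\<^sup>2) \<le> 2 * dirichlet + 2 * moment 4 R" .
qed

end

lemma abs_double_sum_le:
  fixes X :: "3 \<Rightarrow> 3 \<Rightarrow> real"
  assumes "\<And>i j. \<bar>X i j\<bar> \<le> c" shows "\<bar>\<Sum>i\<in>UNIV. \<Sum>j\<in>UNIV. X i j\<bar> \<le> 9 * c"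
proof -
  have "\<bar>\<Sum>i\<in>UNIV. \<Sum>j\<in>UNIV. X i j\<bar> \<le> (\<Sum>i\<in>(UNIV::3 set). \<Sum>j\<in>(UNIV::3 set). c)"
    by (intro order_trans[OF sum_abs] sum_mono order_trans[OF sum_abs] assms)
  then show ?thesis by simp
qed

context decaying_flow
begin

text \<open>The derivative falls on the mollifier at the large scale, which yields the factor \<open>R\<^sup>-\<^sup>4\<close>.\<close>

lemma far_error_le:
  assumes R: "0 < R" and B: "\<And>x. \<bar>partial_deriv j radial_mollifier x\<bar> \<le> B"
  shows "\<bar>LINT x|lebesgue. (G x $ i $ j - u x $ i * u x $ j) * convolution (partial_deriv j (rescaled \<eta> R)) (\<lambda>y. u y $ i * cutoff R y) x\<bar>
    \<le> (B / R ^ 4 * moment 1 R) * (sqrt dirichlet * sqrt (measure lebesgue (cball (0::real^3) 2) * R ^ 3) + moment 2 R)"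
proof -
  have B0: "0 \<le> B" using B[of 0] by linarith
  have kb: "\<bar>partial_deriv j (rescaled \<eta> R) z\<bar> \<le> B / R ^ 4" for z
    using B[of "z /\<^sub>R R"] R by (simp add: partial_deriv_rescaled[OF radial.test R] abs_divide divide_right_mono)
  let ?P = "convolution (partial_deriv j (rescaled \<eta> R)) (\<lambda>y. u y $ i * cutoff R y)"
  have Pb: "\<bar>?P x\<bar> \<le> B / R ^ 4 * moment 1 R" for x
  proof -
    have "\<bar>LINT y|lebesgue. u y $ i * (partial_deriv j (rescaled \<eta> R) (x - y) * cutoff R y)\<bar>
        \<le> B / R ^ 4 * (LINT y|lebesgue. indicator (cball 0 R) y * norm (u y) ^ 1)"
    proof (rule abs_integral_bounded_support_le)
      show "locally_integrable (\<lambda>y. norm (u y) ^ 1)" by (rule norm_u_power) simp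
      show "\<bar>u y $ i\<bar> \<le> norm (u y) ^ 1" for y using component_u_le by simp
      show "\<bar>partial_deriv j (rescaled \<eta> R) (x - y) * cutoff R y\<bar> \<le> B / R ^ 4" for y
        using mult_mono[OF kb[of "x - y"] cutoff_range(2)[of R y]] cutoff_range(1)[of R y] B0 R by (simp add: abs_mult)
      show "partial_deriv j (rescaled \<eta> R) (x - y) * cutoff R y = 0" if "norm y > R" for y
        using cutoff_support[OF R that] by simp
    qed
    also have "\<dots> \<le> B / R ^ 4 * moment 1 R"
      using R B0 by (intro mult_left_mono ball_moment_le) auto
    finally show ?thesis by (simp add: convolution_def mult_ac)
  qed
  have PS: "?P x = 0" if "norm x > 2 * R" for x
  proof (rule convolution_outside[of R _ R])
    show "\<And>x. norm x > R \<Longrightarrow> partial_deriv j (rescaled \<eta> R) x = 0"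
      by (rule partial_deriv_outside[of R]) (auto intro: radial.rescaled_support[OF R])
    show "\<And>x. norm x > R \<Longrightarrow> u x $ i * cutoff R x = 0" by (simp add: cutoff_support[OF R])
  qed (use that in simp)
  have "\<bar>LINT x|lebesgue. (G x $ i $ j - u x $ i * u x $ j) * ?P x\<bar>
    \<le> (B / R ^ 4 * moment 1 R) * (LINT x|lebesgue. indicator (cball 0 (2 * R)) x * (norm (G x) + (norm (u x))\<^sup>2))"
    by (rule abs_integral_bounded_support_le[OF ball_flux_le(1,2) Pb PS])
  also have "\<dots> \<le> (B / R ^ 4 * moment 1 R) * (sqrt dirichlet * sqrt (measure lebesgue (cball (0::real^3) 2) * R ^ 3) + moment 2 R)"
    using R B0 moment_nonneg[of 1 R] by (intro mult_left_mono ball_flux_le(3)) auto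
  finally show ?thesis .
qed

text \<open>The Hessian of the potential is controlled in \<open>L\<^sup>2\<close> by its Laplacian, which is a difference of two
  mollifications of \<open>f\<close>; hence the bound does not depend on the small scale \<open>a\<close>.\<close>

lemma potential_error_le:
  assumes a: "0 < a" "a \<le> R" and B: "\<And>k x. \<bar>partial_deriv k (radial_bump 0) x\<bar> \<le> B"
  defines "f \<equiv> \<lambda>x. \<Sum>k\<in>UNIV. u x $ k * partial_deriv k (cutoff R) x"
  shows "\<bar>LINT x|lebesgue. (G x $ i $ j - u x $ i * u x $ j) * partial_deriv j (partial_deriv i (convolution (potential a R) f)) x\<bar>
    \<le> sqrt (2 * dirichlet + 2 * moment 4 R) * sqrt (36 * B\<^sup>2 / R\<^sup>2 * moment 2 R)"
proof -
  have R: "0 < R" using a by linarith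
  have B0: "0 \<le> B" using B[of undefined 0] by linarith
  have tc: "test_function (cutoff R)" by (rule test_function_cutoff[OF R])
  have cs: "partial_deriv k (cutoff R) x = 0" if "norm x > R" for k x
    by (rule partial_deriv_outside[OF cutoff_support[OF R] that])
  have fl2: "locally_L2 f"
  proof -
    have "locally_L2 (\<lambda>x. \<Sum>k\<in>A. u x $ k * partial_deriv k (cutoff R) x)" if "finite A" for A
      using that
    proof (induction A rule: finite_induct)
      case empty
      then show ?case using locally_L2_smooth[OF smooth_const[of 0]] by simp
    next
      case (insert k A)
      then show ?case
        using locally_L2_add[OF locally_L2_mult_smooth[OF u_L2 smooth_partial_deriv[OF test_function_smooth[OF tc]]] insert.IH] by simp
    qed
    then show ?thesis unfolding f_def by simp
  qed
  have fl: "locally_integrable f" by (rule locally_L2_integrable[OF fl2])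
  have fS: "f x = 0" if "norm x > R" for x using cs[OF that] by (simp add: f_def)
  have fb: "(f x)\<^sup>2 \<le> 9 * B\<^sup>2 / R\<^sup>2 * (indicator (cball 0 R) x * norm (u x) ^ 2)" for x
  proof (cases "norm x > R")
    case False
    have t: "\<bar>u x $ k * partial_deriv k (cutoff R) x\<bar> \<le> norm (u x) * (B / R)" for k
    proof -
      have "\<bar>partial_deriv k (cutoff R) x\<bar> \<le> B / R"
        using B[of k "x /\<^sub>R R"] R by (simp add: partial_deriv_cutoff[OF R] abs_divide divide_right_mono)
      then show ?thesis unfolding abs_mult by (intro mult_mono component_u_le) auto
    qed
    have "\<bar>f x\<bar> \<le> (\<Sum>k\<in>(UNIV::3 set). norm (u x) * (B / R))"
      unfolding f_def by (intro order_trans[OF sum_abs] sum_mono t)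
    then have "\<bar>f x\<bar> \<le> 3 * (norm (u x) * (B / R))" by simp
    then have "\<bar>f x\<bar>\<^sup>2 \<le> (3 * (norm (u x) * (B / R)))\<^sup>2" by (intro power_mono) auto
    then show ?thesis using False by (simp add: power_mult_distrib power_divide mult_ac)
  qed (simp add: fS)
  have f2i: "integrable lebesgue (\<lambda>x. (f x)\<^sup>2)"
    by (rule integrable_bounded_support_of_local[of _ R]) (use fl2 fS in \<open>auto simp: locally_L2_def\<close>)
  have u2i: "integrable lebesgue (\<lambda>x. 9 * B\<^sup>2 / R\<^sup>2 * (indicator (cball 0 R) x * norm (u x) ^ 2))"
    by (intro integrable_mult_right locally_integrable_cball norm_u_power) simp
  have f2: "(LINT x|lebesgue. (f x)\<^sup>2) \<le> 9 * B\<^sup>2 / R\<^sup>2 * moment 2 R"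
  proof -
    have "(LINT x|lebesgue. (f x)\<^sup>2) \<le> (LINT x|lebesgue. 9 * B\<^sup>2 / R\<^sup>2 * (indicator (cball 0 R) x * norm (u x) ^ 2))"
      by (rule integral_mono[OF f2i u2i fb])
    also have "\<dots> = 9 * B\<^sup>2 / R\<^sup>2 * (LINT x|lebesgue. indicator (cball 0 R) x * norm (u x) ^ 2)"
      by (rule integral_mult_right_zero)
    also have "\<dots> \<le> 9 * B\<^sup>2 / R\<^sup>2 * moment 2 R"
      using R by (intro mult_left_mono ball_moment_le) auto
    finally show ?thesis .
  qed
  let ?g = "convolution (potential a R) f"
  have tg: "test_function ?g" by (rule test_function_convolution[OF test_function_potential[OF a] fl fS])
  have gS: "?g x = 0" if "norm x > 2 * R" for x
    by (rule convolution_outside[of R _ R, OF potential_support[OF a] fS]) (use that in auto)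
  let ?Q = "partial_deriv j (partial_deriv i ?g)"
  have QS: "?Q x = 0" if "norm x > 2 * R" for x
    by (rule partial_deriv_outside[OF partial_deriv_outside[OF gS] that])
  have tQ: "test_function ?Q" by (intro test_function_partial_deriv tg)
  have lapg: "(LINT x|lebesgue. (laplacian ?g x)\<^sup>2) \<le> 4 * (LINT x|lebesgue. (f x)\<^sup>2)"
  proof -
    have mi: "integrable lebesgue (\<lambda>x. (mollify r f x)\<^sup>2)" "(LINT x|lebesgue. (mollify r f x)\<^sup>2) \<le> (LINT x|lebesgue. (f x)\<^sup>2)" if "0 < r" for r
      using radial.Lp_mollification_le[OF that fl, of 1] f2i by (simp_all add: power2_eq_square)
    have "(LINT x|lebesgue. (laplacian ?g x)\<^sup>2) \<le> (LINT x|lebesgue. 2 * (mollify R f x)\<^sup>2 + 2 * (mollify a f x)\<^sup>2)"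
    proof (rule integral_mono)
      show "integrable lebesgue (\<lambda>x. (laplacian ?g x)\<^sup>2)"
        unfolding power2_eq_square by (intro integrable_test_mult test_function_laplacian tg)
      show "integrable lebesgue (\<lambda>x. 2 * (mollify R f x)\<^sup>2 + 2 * (mollify a f x)\<^sup>2)"
        by (intro Bochner_Integration.integrable_add integrable_mult_right mi R a)
      fix x
      show "(laplacian ?g x)\<^sup>2 \<le> 2 * (mollify R f x)\<^sup>2 + 2 * (mollify a f x)\<^sup>2"
        using sum_squares_bound[of "mollify R f x" "- mollify a f x"]
        unfolding laplacian_convolution_potential[OF a fl] power2_diff power2_minus by argo
    qed
    also have "\<dots> = 2 * (LINT x|lebesgue. (mollify R f x)\<^sup>2) + 2 * (LINT x|lebesgue. (mollify a f x)\<^sup>2)"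
      using mi(1)[OF R] mi(1)[OF a(1)] by simp
    also have "\<dots> \<le> 4 * (LINT x|lebesgue. (f x)\<^sup>2)" using mi(2)[OF R] mi(2)[OF a(1)] by linarith
    finally show ?thesis .
  qed
  let ?F = "\<lambda>x. indicator (cball 0 (2 * R)) x * (G x $ i $ j - u x $ i * u x $ j)"
  have FL: "locally_L2 (\<lambda>x. G x $ i $ j - u x $ i * u x $ j)" by (intro locally_L2_diff G_L2 uu_L2)
  have Fsq: "(?F x)\<^sup>2 = indicator (cball 0 (2 * R)) x * (G x $ i $ j - u x $ i * u x $ j)\<^sup>2" for x by (simp add: indicator_def)
  have "(LINT x|lebesgue. (G x $ i $ j - u x $ i * u x $ j) * ?Q x) = (LINT x|lebesgue. ?F x * ?Q x)"
  proof (rule Bochner_Integration.integral_cong[OF refl])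
    fix x show "(G x $ i $ j - u x $ i * u x $ j) * ?Q x = ?F x * ?Q x"
      using QS[of x] by (cases "norm x \<le> 2 * R") auto
  qed
  moreover have "\<bar>LINT x|lebesgue. ?F x * ?Q x\<bar> \<le> sqrt (LINT x|lebesgue. (?F x)\<^sup>2) * sqrt (LINT x|lebesgue. (?Q x)\<^sup>2)"
  proof (rule integral_Cauchy_Schwarz(2))
    show "?F \<in> borel_measurable lebesgue" by (rule indicator_borel_mult[OF locally_L2_measurable[OF FL]]) simp
    show "?Q \<in> borel_measurable lebesgue" by (intro smooth_lebesgue test_function_smooth tQ)
    show "integrable lebesgue (\<lambda>x. (?F x)\<^sup>2)"
      unfolding Fsq using FL by (intro locally_integrable_cball) (simp add: locally_L2_def)
    show "integrable lebesgue (\<lambda>x. (?Q x)\<^sup>2)" unfolding power2_eq_square by (rule integrable_test_mult[OF tQ tQ])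
  qed
  moreover have "sqrt (LINT x|lebesgue. (?F x)\<^sup>2) * sqrt (LINT x|lebesgue. (?Q x)\<^sup>2)
      \<le> sqrt (2 * dirichlet + 2 * moment 4 R) * sqrt (36 * B\<^sup>2 / R\<^sup>2 * moment 2 R)"
  proof (intro mult_mono real_sqrt_le_mono)
    show "(LINT x|lebesgue. (?F x)\<^sup>2) \<le> 2 * dirichlet + 2 * moment 4 R" unfolding Fsq by (rule ball_flux_le(4))
    have "(LINT x|lebesgue. (?Q x)\<^sup>2) \<le> 4 * (9 * B\<^sup>2 / R\<^sup>2 * moment 2 R)"
      using integral_second_partial_le[OF tg, of j i] lapg f2 by linarith
    then show "(LINT x|lebesgue. (?Q x)\<^sup>2) \<le> 36 * B\<^sup>2 / R\<^sup>2 * moment 2 R" by simp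
  qed (auto intro: integral_nonneg_AE simp: dirichlet_nonneg moment_nonneg)
  ultimately show ?thesis by linarith
qed

text \<open>The energy balance for \<open>\<phi> u\<close>, where \<open>\<phi>\<close> is the cutoff at radius \<open>R\<close>, follows from the tested equation
  as the small scale tends to zero. Everything except the localized Dirichlet integral is an
  error: the terms with \<open>\<nabla>\<phi>\<close>, and the two corrections of the test field.\<close>

lemma energy_inequality:
  assumes R: "0 < R"
    and B: "\<And>k x. \<bar>partial_deriv k (radial_bump 0) x\<bar> \<le> B" "\<And>k x. \<bar>partial_deriv k radial_mollifier x\<bar> \<le> B"
  shows "(\<Sum>i\<in>UNIV. \<Sum>j\<in>UNIV. LINT x|lebesgue. cutoff R x * (G x $ i $ j)\<^sup>2)
    \<le> 9 * ((B / R ^ 4 * moment 1 R) * (sqrt dirichlet * sqrt (measure lebesgue (cball (0::real^3) 2) * R ^ 3) + moment 2 R)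
         + sqrt (2 * dirichlet + 2 * moment 4 R) * sqrt (36 * B\<^sup>2 / R\<^sup>2 * moment 2 R))
      + 9 * (B / R * (sqrt dirichlet * sqrt (moment 2 R))) + 9 / 2 * (B / R * moment 3 R)"
    (is "?A \<le> 9 * (?e1 + ?e2) + 9 * ?e3 + 9 / 2 * ?e4")
proof -
  let ?\<phi> = "cutoff R"
  let ?F = "\<lambda>i j x. G x $ i $ j - u x $ i * u x $ j"
  let ?D = "\<lambda>i j y. G y $ i $ j * ?\<phi> y + u y $ i * partial_deriv j ?\<phi> y"
  let ?f = "\<lambda>x. \<Sum>k\<in>UNIV. u x $ k * partial_deriv k ?\<phi> x"
  have B0: "0 \<le> B" using B(1)[of undefined 0] by linarith
  have tc: "test_function ?\<phi>" by (rule test_function_cutoff[OF R])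
  have sc: "smooth ?\<phi>" "smooth (partial_deriv k ?\<phi>)" for k by (auto intro: test_function_smooth tc smooth_partial_deriv)
  have cs: "norm x > R \<Longrightarrow> ?\<phi> x = 0" for x by (rule cutoff_support[OF R])
  have ds: "norm x > R \<Longrightarrow> partial_deriv k ?\<phi> x = 0" for k x by (rule partial_deriv_outside[OF cs])
  have db: "\<bar>partial_deriv k ?\<phi> x\<bar> \<le> B / R" for k x
    using B(1)[of k "x /\<^sub>R R"] R by (simp add: partial_deriv_cutoff[OF R] abs_divide divide_right_mono)
  have FL: "locally_L2 (?F i j)" for i j by (intro locally_L2_diff G_L2 uu_L2)
  have DL: "locally_L2 (?D i j)" for i j by (intro locally_L2_add locally_L2_mult_smooth G_L2 u_L2 sc)
  have DS: "norm x > R \<Longrightarrow> ?D i j x = 0" for i j x by (simp add: cs ds)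
  have fl: "locally_integrable ?f" by (intro locally_integrable_sum locally_integrable_mult_smooth u_locally_integrable sc) simp
  have fS: "norm x > R \<Longrightarrow> ?f x = 0" for x by (simp add: ds)
  have ap: "\<bar>\<Sum>i\<in>UNIV. \<Sum>j\<in>UNIV. LINT x|lebesgue. ?F i j x * mollify a (?D i j) x\<bar> \<le> 9 * (?e1 + ?e2)"
    if a: "0 < a" "a \<le> R" for a
    unfolding tested_momentum[OF tc a]
  proof (rule abs_double_sum_le)
    fix i j
    let ?P = "convolution (partial_deriv j (rescaled \<eta> R)) (\<lambda>y. u y $ i * ?\<phi> y)"
    let ?Q = "partial_deriv j (partial_deriv i (convolution (potential a R) ?f))"
    have Vl: "locally_integrable (\<lambda>y. u y $ i * ?\<phi> y)" by (intro locally_integrable_mult_smooth u_locally_integrable sc)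
    have VS: "norm x > R \<Longrightarrow> u x $ i * ?\<phi> x = 0" for x by (simp add: cs)
    have iP: "integrable lebesgue (\<lambda>x. ?F i j x * ?P x)"
      by (intro integrable_mult_test locally_L2_integrable FL test_function_convolution[OF test_function_partial_deriv[OF radial.test_rescaled[OF R]] Vl VS])
    have iQ: "integrable lebesgue (\<lambda>x. ?F i j x * ?Q x)"
      by (intro integrable_mult_test locally_L2_integrable FL test_function_partial_deriv
          test_function_convolution[OF test_function_potential[OF a] fl fS])
    have "(LINT x|lebesgue. ?F i j x * (?P x - ?Q x)) = (LINT x|lebesgue. ?F i j x * ?P x) - (LINT x|lebesgue. ?F i j x * ?Q x)"
      unfolding right_diff_distrib[of _ "?P _"] by (rule Bochner_Integration.integral_diff[OF iP iQ])
    moreover have "\<bar>LINT x|lebesgue. ?F i j x * ?P x\<bar> \<le> ?e1" by (rule far_error_le[OF R B(2)])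
    moreover have "\<bar>LINT x|lebesgue. ?F i j x * ?Q x\<bar> \<le> ?e2" by (rule potential_error_le[OF a B(1)])
    ultimately show "\<bar>LINT x|lebesgue. ?F i j x * (?P x - ?Q x)\<bar> \<le> ?e1 + ?e2" by linarith
  qed
  have lim: "((\<lambda>a. \<bar>\<Sum>i\<in>UNIV. \<Sum>j\<in>UNIV. LINT x|lebesgue. ?F i j x * mollify a (?D i j) x\<bar>)
      \<longlongrightarrow> \<bar>\<Sum>i\<in>UNIV. \<Sum>j\<in>UNIV. LINT x|lebesgue. ?F i j x * ?D i j x\<bar>) (at_right 0)"
    by (intro tendsto_rabs tendsto_sum radial.pairing_tendsto_right[OF FL DL DS])
  have ev: "\<forall>\<^sub>F a in at_right 0. \<bar>\<Sum>i\<in>UNIV. \<Sum>j\<in>UNIV. LINT x|lebesgue. ?F i j x * mollify a (?D i j) x\<bar> \<le> 9 * (?e1 + ?e2)"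
    unfolding eventually_at_right[OF R] using ap by (intro exI[of _ R]) (use R in auto)
  have main: "\<bar>\<Sum>i\<in>UNIV. \<Sum>j\<in>UNIV. LINT x|lebesgue. ?F i j x * ?D i j x\<bar> \<le> 9 * (?e1 + ?e2)"
    by (rule tendsto_upperbound[OF lim ev]) simp
  let ?T = "\<lambda>i j. LINT x|lebesgue. G x $ i $ j * u x $ i * partial_deriv j ?\<phi> x"
  let ?X = "\<lambda>i j. LINT x|lebesgue. ?\<phi> x * (u x $ i * u x $ j * G x $ i $ j)"
  let ?Y = "\<lambda>i j. LINT x|lebesgue. (u x $ i)\<^sup>2 * u x $ j * partial_deriv j ?\<phi> x"
  have split: "(LINT x|lebesgue. ?F i j x * ?D i j x) = (LINT x|lebesgue. ?\<phi> x * (G x $ i $ j)\<^sup>2) + ?T i j - ?X i j - ?Y i j" for i j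
  proof -
    have i: "integrable lebesgue (\<lambda>x. ?\<phi> x * (G x $ i $ j)\<^sup>2)"
      "integrable lebesgue (\<lambda>x. G x $ i $ j * u x $ i * partial_deriv j ?\<phi> x)"
      "integrable lebesgue (\<lambda>x. ?\<phi> x * (u x $ i * u x $ j * G x $ i $ j))"
      "integrable lebesgue (\<lambda>x. (u x $ i)\<^sup>2 * u x $ j * partial_deriv j ?\<phi> x)"
      using integrable_mult_test[OF locally_L2_mult[OF G_L2 G_L2] tc, of i j i j]
        integrable_mult_test[OF locally_L2_mult[OF G_L2 u_L2] test_function_partial_deriv[OF tc], of i j i j]
        integrable_mult_test[OF locally_L2_mult[OF uu_L2 G_L2] tc, of i j i j]
        integrable_mult_test[OF locally_L2_mult[OF u2_L2 u_L2] test_function_partial_deriv[OF tc], of i j j]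
      by (simp_all add: power2_eq_square mult_ac)
    have "(LINT x|lebesgue. ?F i j x * ?D i j x) = (LINT x|lebesgue. ?\<phi> x * (G x $ i $ j)\<^sup>2 + G x $ i $ j * u x $ i * partial_deriv j ?\<phi> x
       - ?\<phi> x * (u x $ i * u x $ j * G x $ i $ j) - (u x $ i)\<^sup>2 * u x $ j * partial_deriv j ?\<phi> x)"
      by (rule Bochner_Integration.integral_cong[OF refl]) (simp add: algebra_simps power2_eq_square)
    also have "\<dots> = (LINT x|lebesgue. ?\<phi> x * (G x $ i $ j)\<^sup>2) + ?T i j - ?X i j - ?Y i j"
      using i by simp
    finally show ?thesis .
  qed
  have X: "(\<Sum>j\<in>UNIV. ?X i j) = - (1/2) * (\<Sum>j\<in>UNIV. ?Y i j)" for i by (rule energy_flux[OF tc])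
  have "(\<Sum>i\<in>UNIV. \<Sum>j\<in>UNIV. LINT x|lebesgue. ?F i j x * ?D i j x)
      = ?A + (\<Sum>i\<in>UNIV. \<Sum>j\<in>UNIV. ?T i j) - 1 / 2 * (\<Sum>i\<in>UNIV. \<Sum>j\<in>UNIV. ?Y i j)"
  proof -
    have "(\<Sum>i\<in>UNIV. \<Sum>j\<in>UNIV. ?X i j) = - (1/2) * (\<Sum>i\<in>UNIV. \<Sum>j\<in>UNIV. ?Y i j)"
      unfolding X by (simp only: sum_distrib_left)
    then show ?thesis unfolding split sum_subtractf sum.distrib by linarith
  qed
  moreover have "\<bar>\<Sum>i\<in>UNIV. \<Sum>j\<in>UNIV. ?T i j\<bar> \<le> 9 * ?e3"
  proof (rule abs_double_sum_le)
    fix i j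
    have "\<bar>?T i j\<bar> \<le> B / R * (LINT x|lebesgue. indicator (cball 0 R) x * (norm (G x) * norm (u x)))"
    proof (rule abs_integral_bounded_support_le[OF _ _ db ds])
      show "locally_integrable (\<lambda>x. norm (G x) * norm (u x))" by (rule locally_L2_mult[OF norm_G_L2 norm_u_L2])
      show "\<bar>G x $ i $ j * u x $ i\<bar> \<le> norm (G x) * norm (u x)" for x
        unfolding abs_mult by (intro mult_mono component_G_le component_u_le) auto
    qed
    also have "\<dots> \<le> ?e3"
    proof (intro mult_left_mono)
      have "(LINT x|lebesgue. indicator (cball 0 R) x * (norm (G x) * norm (u x)))
          \<le> sqrt dirichlet * sqrt (LINT x|lebesgue. indicator (cball 0 R) x * (norm (u x))\<^sup>2)"
        by (rule ball_G_mult_le[OF norm_u_measurable norm_u_power]) simp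
      also have "\<dots> \<le> sqrt dirichlet * sqrt (moment 2 R)"
        using R by (intro mult_left_mono real_sqrt_le_mono ball_moment_le) (auto simp: dirichlet_nonneg)
      finally show "(LINT x|lebesgue. indicator (cball 0 R) x * (norm (G x) * norm (u x))) \<le> sqrt dirichlet * sqrt (moment 2 R)" .
    qed (use B0 R in auto)
    finally show "\<bar>?T i j\<bar> \<le> ?e3" .
  qed
  moreover have "\<bar>\<Sum>i\<in>UNIV. \<Sum>j\<in>UNIV. ?Y i j\<bar> \<le> 9 * ?e4"
  proof (rule abs_double_sum_le)
    fix i j
    have "\<bar>?Y i j\<bar> \<le> B / R * (LINT x|lebesgue. indicator (cball 0 R) x * norm (u x) ^ 3)"
    proof (rule abs_integral_bounded_support_le[OF _ _ db ds])
      show "locally_integrable (\<lambda>x. norm (u x) ^ 3)" by (rule norm_u_power) simp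
      fix x
      have "\<bar>u x $ i\<bar>\<^sup>2 * \<bar>u x $ j\<bar> \<le> (norm (u x))\<^sup>2 * norm (u x)"
        by (intro mult_mono power_mono component_u_le) auto
      then show "\<bar>(u x $ i)\<^sup>2 * u x $ j\<bar> \<le> norm (u x) ^ 3"
        by (simp add: abs_mult power2_eq_square power3_eq_cube)
    qed
    also have "\<dots> \<le> ?e4" using B0 R by (intro mult_left_mono ball_moment_le) auto
    finally show "\<bar>?Y i j\<bar> \<le> ?e4" .
  qed
  ultimately show ?thesis using main unfolding abs_le_iff by linarith
qed

text \<open>After rescaling, every term contains a factor \<open>m q R\<close> that tends to zero, and the remaining powers
  of \<open>R\<close> are never positive.\<close>

lemma error_tendsto_zero:
  "((\<lambda>R. 9 * ((B / R ^ 4 * moment 1 R) * (sqrt dirichlet * sqrt (c * R ^ 3) + moment 2 R)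
         + sqrt (2 * dirichlet + 2 * moment 4 R) * sqrt (36 * B\<^sup>2 / R\<^sup>2 * moment 2 R))
      + 9 * (B / R * (sqrt dirichlet * sqrt (moment 2 R))) + 9 / 2 * (B / R * moment 3 R)) \<longlongrightarrow> 0) at_top"
proof -
  define m where "m = (\<lambda>q R. moment q R / R powr (3 - 2 * real q / 3))"
  have m: "(m q \<longlongrightarrow> 0) at_top" if "1 \<le> q" "q \<le> 4" for q unfolding m_def by (rule moment_tendsto[OF that])
  have small: "((\<lambda>R::real. R powr - s) \<longlongrightarrow> 0) at_top" if "s > 0" for s
    by (rule tendsto_neg_powr[OF _ filterlim_ident]) (use that in simp)
  let ?rhs = "\<lambda>R. 9 * (B * sqrt dirichlet * sqrt c * (m 1 R * R powr - (1/6)) + B * (m 1 R * m 2 R)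
     + sqrt (36 * B\<^sup>2 * (2 * dirichlet * (m 2 R * R powr - (1/3)) + 2 * (m 4 R * m 2 R))))
     + 9 * (B * sqrt dirichlet * sqrt (m 2 R * R powr - (1/3))) + 9 / 2 * (B * m 3 R)"
  have "(?rhs \<longlongrightarrow> 9 * (B * sqrt dirichlet * sqrt c * (0 * 0) + B * (0 * 0)
     + sqrt (36 * B\<^sup>2 * (2 * dirichlet * (0 * 0) + 2 * (0 * 0))))
     + 9 * (B * sqrt dirichlet * sqrt (0 * 0)) + 9 / 2 * (B * 0)) at_top"
    by (intro tendsto_intros m small) auto
  then have lim: "(?rhs \<longlongrightarrow> 0) at_top" by simp
  show ?thesis
  proof (rule Lim_transform_eventually[OF lim])
    show "\<forall>\<^sub>F R in at_top. ?rhs R = 9 * ((B / R ^ 4 * moment 1 R) * (sqrt dirichlet * sqrt (c * R ^ 3) + moment 2 R)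
         + sqrt (2 * dirichlet + 2 * moment 4 R) * sqrt (36 * B\<^sup>2 / R\<^sup>2 * moment 2 R))
      + 9 * (B / R * (sqrt dirichlet * sqrt (moment 2 R))) + 9 / 2 * (B / R * moment 3 R)"
      using eventually_gt_at_top[of 0]
    proof eventually_elim
      case (elim R)
      have R: "R > 0" by (rule elim)
      have M1: "moment 1 R = m 1 R * R powr (7/3)" and M2: "moment 2 R = m 2 R * R powr (5/3)"
        and M3: "moment 3 R = m 3 R * R" and M4: "moment 4 R = m 4 R * R powr (1/3)"
        using R by (simp_all add: m_def)
      have pq: "R powr a * R powr b / R ^ k = R powr (a + b - real k)" for a b k
        using R by (simp only: powr_add powr_diff powr_realpow)
      have pq1: "R powr a / R ^ k = R powr (a - real k)" for a k
        using R by (simp only: powr_diff powr_realpow)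
      have sq3: "sqrt (R ^ 3) = R powr (3/2)" 
      proof -
        have "sqrt (R ^ 3) = (R powr 3) powr (1/2)" using R by (simp add: powr_half_sqrt powr_numeral)
        then show ?thesis by (simp add: powr_powr)
      qed
      have e1: "B / R ^ 4 * moment 1 R * (sqrt dirichlet * sqrt (c * R ^ 3)) = B * sqrt dirichlet * sqrt c * (m 1 R * R powr - (1/6))"
      proof -
        have "R powr (7/3) * R powr (3/2) / R ^ 4 = R powr - (1/6)"
          unfolding pq by simp
        moreover have "B / z * (n * p) * (d * (t * q)) = B * d * t * (n * (p * q / z))" for n p d t q z :: real by simp
        ultimately show ?thesis unfolding M1 real_sqrt_mult sq3 by (simp only:)
      qed
      have e2: "B / R ^ 4 * moment 1 R * moment 2 R = B * (m 1 R * m 2 R)"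
      proof -
        have "R powr (7/3) * R powr (5/3) / R ^ 4 = 1" unfolding pq using R by simp
        moreover have "B / z * (n * p) * (k * q) = B * (n * k) * (p * q / z)" for n p k q z :: real by simp
        ultimately show ?thesis unfolding M1 M2 by (simp only: mult_1_right)
      qed
      have q2: "moment 2 R / R\<^sup>2 = m 2 R * R powr - (1/3)"
      proof -
        have "R powr (5/3) / R\<^sup>2 = R powr - (1/3)" unfolding pq1 by simp
        then show ?thesis unfolding M2 by (simp only: times_divide_eq_right[symmetric])
      qed
      have q42: "moment 4 R * (moment 2 R / R\<^sup>2) = m 4 R * m 2 R"
      proof -
        have "R powr (1/3) * R powr (5/3) / R\<^sup>2 = 1" unfolding pq using R by simp
        moreover have "(n * p) * (k * q / z) = n * k * (p * q / z)" for n p k q z :: real by simp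
        ultimately show ?thesis unfolding M4 M2 by (simp only: mult_1_right)
      qed
      have e3: "sqrt (2 * dirichlet + 2 * moment 4 R) * sqrt (36 * B\<^sup>2 / R\<^sup>2 * moment 2 R)
          = sqrt (36 * B\<^sup>2 * (2 * dirichlet * (m 2 R * R powr - (1/3)) + 2 * (m 4 R * m 2 R)))"
        unfolding q2[symmetric] q42[symmetric] real_sqrt_mult[symmetric] by (simp add: algebra_simps add_divide_distrib)
      have e4: "B / R * (sqrt dirichlet * sqrt (moment 2 R)) = B * sqrt dirichlet * sqrt (m 2 R * R powr - (1/3))"
        unfolding q2[symmetric] using R by (simp add: real_sqrt_divide)
      have e5: "B / R * moment 3 R = B * m 3 R" unfolding M3 using R by simp
      show ?case unfolding distrib_left[of _ "sqrt dirichlet * sqrt (c * R ^ 3)"] e1 e2 e3 e4 e5 by simp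
    qed
  qed
qed

lemma gradient_zero: "AE x in lebesgue. G x $ i $ j = 0"
proof -
  have "\<exists>B. \<forall>x. \<bar>partial_deriv k (radial_bump 0) x\<bar> \<le> B \<and> \<bar>partial_deriv k radial_mollifier x\<bar> \<le> B" for k
  proof -
    obtain b where b: "\<And>x. \<bar>partial_deriv k (radial_bump 0) x\<bar> \<le> b"
      using test_function_bounded[OF test_function_partial_deriv[OF test_function_radial_bump[of 0], of k]] by blast
    obtain c where c: "\<And>x. \<bar>partial_deriv k radial_mollifier x\<bar> \<le> c"
      using test_function_bounded[OF test_function_partial_deriv[OF radial.test, of k]] by blast
    have "\<bar>partial_deriv k (radial_bump 0) x\<bar> \<le> max b c \<and> \<bar>partial_deriv k radial_mollifier x\<bar> \<le> max b c" for x
      using b[of x] c[of x] by linarith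
    then show ?thesis by blast
  qed
  then obtain b where b: "\<And>k x. \<bar>partial_deriv k (radial_bump 0) x\<bar> \<le> b k" "\<And>k x. \<bar>partial_deriv k radial_mollifier x\<bar> \<le> b k"
    by metis
  define B where "B = (\<Sum>k\<in>UNIV. b k)"
  have b0: "0 \<le> b k" for k using b(1)[of k 0] by linarith
  have bB: "b k \<le> B" for k unfolding B_def by (rule member_le_sum) (auto simp: b0)
  have B: "\<bar>partial_deriv k (radial_bump 0) x\<bar> \<le> B" "\<bar>partial_deriv k radial_mollifier x\<bar> \<le> B" for k x
    using b(1)[of k x] b(2)[of k x] bB[of k] by linarith+
  have zero: "(LINT x|lebesgue. indicator (cball 0 S) x * (G x $ i $ j)\<^sup>2) = 0" for S
  proof -
    let ?I = "LINT x|lebesgue. indicator (cball 0 S) x * (G x $ i $ j)\<^sup>2"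
    define E where "E = (\<lambda>R. 9 * ((B / R ^ 4 * moment 1 R) * (sqrt dirichlet * sqrt (measure lebesgue (cball (0::real^3) 2) * R ^ 3) + moment 2 R)
         + sqrt (2 * dirichlet + 2 * moment 4 R) * sqrt (36 * B\<^sup>2 / R\<^sup>2 * moment 2 R))
      + 9 * (B / R * (sqrt dirichlet * sqrt (moment 2 R))) + 9 / 2 * (B / R * moment 3 R))"
    have lim: "(E \<longlongrightarrow> 0) at_top" unfolding E_def by (rule error_tendsto_zero)
    have ci: "integrable lebesgue (\<lambda>x. cutoff R x * (G x $ k $ l)\<^sup>2)" if "R > 0" for R k l
      using integrable_mult_test[OF locally_integrable_of_integrable[OF G2] test_function_cutoff[OF that]] by (simp add: mult.commute)
    have "\<forall>\<^sub>F R in at_top. exp (- 4 / 3) * ?I \<le> E R"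
      using eventually_gt_at_top[of "max 0 (2 * S)"]
    proof eventually_elim
      case (elim R)
      then have R: "R > 0" "2 * S < R" by auto
      have "exp (- 4 / 3) * ?I = (LINT x|lebesgue. exp (- 4 / 3) * (indicator (cball 0 S) x * (G x $ i $ j)\<^sup>2))"
        by simp
      also have "\<dots> \<le> (LINT x|lebesgue. cutoff R x * (G x $ i $ j)\<^sup>2)"
      proof (rule integral_mono[OF _ ci[OF R(1)]])
        show "integrable lebesgue (\<lambda>x. exp (- 4 / 3) * (indicator (cball 0 S) x * (G x $ i $ j)\<^sup>2))"
          by (intro integrable_mult_right locally_integrable_cball locally_integrable_of_integrable G2)
        show "exp (- 4 / 3) * (indicator (cball 0 S) x * (G x $ i $ j)\<^sup>2) \<le> cutoff R x * (G x $ i $ j)\<^sup>2" for x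
        proof (cases "norm x \<le> S")
          case True
          then show ?thesis using cutoff_lower[OF R(1), of x] R(2) by (simp add: mult_right_mono)
        next
          case False
          then show ?thesis using cutoff_range(1) by simp
        qed
      qed
      also have "\<dots> \<le> (\<Sum>l\<in>UNIV. LINT x|lebesgue. cutoff R x * (G x $ i $ l)\<^sup>2)"
        by (rule member_le_sum) (auto intro!: integral_nonneg_AE AE_I2 mult_nonneg_nonneg cutoff_range(1))
      also have "\<dots> \<le> (\<Sum>k\<in>UNIV. \<Sum>l\<in>UNIV. LINT x|lebesgue. cutoff R x * (G x $ k $ l)\<^sup>2)"
        by (rule member_le_sum[where f="\<lambda>k. \<Sum>l\<in>UNIV. LINT x|lebesgue. cutoff R x * (G x $ k $ l)\<^sup>2"])
          (auto intro!: sum_nonneg integral_nonneg_AE AE_I2 mult_nonneg_nonneg cutoff_range(1))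
      also have "\<dots> \<le> E R" unfolding E_def by (rule energy_inequality[OF R(1) B])
      finally show ?case .
    qed
    from tendsto_lowerbound[OF lim this] have "exp (- 4 / 3) * ?I \<le> 0" by simp
    then have "?I \<le> 0" by (simp add: mult_le_0_iff)
    moreover have "0 \<le> ?I" by (intro integral_nonneg_AE AE_I2) auto
    ultimately show ?thesis by linarith
  qed
  have "AE x in lebesgue. indicator (cball 0 (real n)) x * (G x $ i $ j)\<^sup>2 = 0" for n
    using zero[of "real n"] integral_nonneg_eq_0_iff_AE[of lebesgue "\<lambda>x. indicator (cball 0 (real n)) x * (G x $ i $ j)\<^sup>2"]
      locally_integrable_cball[OF locally_integrable_of_integrable[OF G2], of "real n" i j] by simp
  then have "AE x in lebesgue. \<forall>n. indicator (cball 0 (real n)) x * (G x $ i $ j)\<^sup>2 = 0" unfolding AE_all_countable by blast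
  then show ?thesis
  proof eventually_elim
    case (elim x)
    obtain n where "norm x \<le> real n" using real_arch_simple by blast
    then show ?case using elim[rule_format, of n] by (simp add: indicator_def)
  qed
qed

text \<open>The mollifications of \<open>u\<close> have zero gradient, so they are constants; being in \<open>L\<^sup>6\<close>, they vanish.\<close>

lemma flow_zero: "AE x in lebesgue. u x = 0"
proof -
  have "AE x in lebesgue. u x $ i = 0" for i
  proof (rule radial.mollification_zero_imp_zero[OF u_locally_integrable])
    fix r :: real and x :: "real^3"
    assume r: "r > 0"
    let ?w = "mollify r (\<lambda>y. u y $ i)"
    have dz: "convolution (partial_deriv j (rescaled \<eta> r)) (\<lambda>y. u y $ i) z = 0" for j z
    proof -
      have "(LINT y|lebesgue. rescaled \<eta> r (z - y) * G y $ i $ j) = (LINT y|(lebesgue :: (real^3) measure). 0)"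
      proof (rule integral_cong_AE)
        show "(\<lambda>y. rescaled \<eta> r (z - y) * G y $ i $ j) \<in> borel_measurable lebesgue"
          by (rule borel_measurable_integrable[OF convolution_integrable[OF radial.test_rescaled[OF r] G_locally_integrable]])
        show "AE y in lebesgue. rescaled \<eta> r (z - y) * G y $ i $ j = 0"
          using gradient_zero[of i j] by eventually_elim simp
      qed simp
      then show ?thesis
        unfolding convolution_gradient[OF radial.test_rescaled[OF r]] by (simp add: convolution_def)
    qed
    have "(?w has_derivative (\<lambda>h. 0)) (at z within UNIV)" for z
      using convolution_has_derivative[OF radial.test_rescaled[OF r] u_locally_integrable, of i z] by (simp add: dz)
    then obtain c where c: "\<And>z. ?w z = c"
      using has_derivative_zero_constant[OF convex_UNIV, of ?w] by auto
    have "integrable lebesgue (\<lambda>y. \<bar>u y $ i\<bar> ^ Suc 5)"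
    proof (rule Bochner_Integration.integrable_bound[OF u6])
      show "(\<lambda>y. \<bar>u y $ i\<bar> ^ Suc 5) \<in> borel_measurable lebesgue"
        by (intro borel_measurable_power borel_measurable_abs u_measurable)
      have "\<bar>u y $ i\<bar> ^ 6 \<le> norm (u y) ^ 6" for y by (intro power_mono component_u_le) auto
      then show "AE y in lebesgue. norm (\<bar>u y $ i\<bar> ^ Suc 5) \<le> norm (norm (u y) ^ 6)" by simp
    qed
    from radial.Lp_mollification_le(1)[OF r u_locally_integrable this]
    have "integrable (lebesgue :: (real^3) measure) (\<lambda>y. \<bar>c\<bar> ^ Suc 5)" unfolding c .
    from integrable_mult_left[OF this, of "inverse (\<bar>c\<bar> ^ Suc 5)"]
    have "c \<noteq> 0 \<Longrightarrow> integrable (lebesgue :: (real^3) measure) (indicat_real UNIV)" by simp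
    then have "c \<noteq> 0 \<Longrightarrow> emeasure lebesgue (UNIV \<inter> space lebesgue :: (real^3) set) < \<infinity>"
      unfolding integrable_indicator_iff by simp
    then have "c = 0" by (cases "c = 0") (simp_all add: emeasure_lborel_UNIV)
    then show "?w x = 0" by (simp add: c)
  qed
  then have "AE x in lebesgue. \<forall>i. u x $ i = 0" unfolding AE_all_countable by blast
  then show ?thesis by eventually_elim (simp add: vec_eq_iff)
qed

end

section \<open>From the variable exponent to the exponent 9/2\<close>

lemma summable_exp_cubic: "summable (\<lambda>n. exp (- real n) * (real n + 1) ^ 3)"
proof (rule summable_ratio_test[where c="7/10" and N=9])
  \<comment> \<open>from \<open>n = 9\<close> on, the cube grows by at most \<open>(11 / 10)\<^sup>3\<close> per step, which \<open>exp (- 1) \<le> 1 / 2\<close> outweighs\<close>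
  fix n :: nat assume n: "9 \<le> n"
  have "exp (1::real) \<ge> 2" using exp_ge_add_one_self[of 1] by simp
  then have e1: "exp (- 1 :: real) \<le> 1 / 2" by (simp add: exp_minus field_simps)
  have "(real n + 2) ^ 3 \<le> (11 / 10 * (real n + 1)) ^ 3" using n by (intro power_mono) auto
  also have "\<dots> = 1331 / 1000 * (real n + 1) ^ 3"
  proof -
    have "(11 / 10 :: real) ^ 3 = 1331 / 1000" by (simp add: power3_eq_cube)
    then show ?thesis by (simp only: power_mult_distrib)
  qed
  finally have c: "(real n + 2) ^ 3 \<le> 1331 / 1000 * (real n + 1) ^ 3" .
  have "exp (- real (Suc n)) = exp (- 1) * exp (- real n)" by (simp flip: exp_add)
  then have "exp (- real (Suc n)) * (real (Suc n) + 1) ^ 3 = exp (- real n) * (exp (- 1) * (real n + 2) ^ 3)"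
    by (simp add: mult_ac add.commute)
  also have "\<dots> \<le> exp (- real n) * (1 / 2 * (1331 / 1000 * (real n + 1) ^ 3))"
    by (intro mult_left_mono mult_mono e1 c) auto
  also have "\<dots> \<le> 7 / 10 * (exp (- real n) * (real n + 1) ^ 3)" by simp
  finally show "norm (exp (- real (Suc n)) * (real (Suc n) + 1) ^ 3) \<le> 7 / 10 * norm (exp (- real n) * (real n + 1) ^ 3)"
    by (simp add: abs_mult)
qed simp

text \<open>The integrand is dominated by a sum of multiples of indicators of the balls of radius \<open>n + 1\<close>.\<close>

lemma nn_integral_exp_norm_finite: "(\<integral>\<^sup>+x. ennreal (exp (- norm (x :: real^3))) \<partial>lebesgue) < \<infinity>"
proof -
  define V where "V = measure lebesgue (cball (0::real^3) 1)"
  let ?t = "\<lambda>(n::nat) (x::real^3). ennreal (exp (- real n)) * indicator (cball 0 (real n + 1)) x"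
  have le: "ennreal (exp (- norm x)) \<le> (\<Sum>n. ?t n x)" for x :: "real^3"
  proof -
    define n where "n = nat \<lfloor>norm x\<rfloor>"
    have n: "real n \<le> norm x" "norm x \<le> real n + 1" by (auto simp: n_def)
    have "ennreal (exp (- norm x)) \<le> ?t n x" using n by (simp add: ennreal_leI)
    also have "\<dots> \<le> (\<Sum>n. ?t n x)"
    proof -
      have "(\<Sum>k\<in>{n}. ?t k x) \<le> (\<Sum>n. ?t n x)" by (rule sum_le_suminf[OF summableI]) auto
      then show ?thesis by (simp only: sum.insert sum.empty finite.emptyI empty_iff not_False_eq_True add_0_right)
    qed
    finally show ?thesis .
  qed
  have em: "emeasure lebesgue (cball (0::real^3) (real n + 1)) = ennreal ((real n + 1) ^ 3 * V)" for n
  proof -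
    have "emeasure lebesgue (cball (0::real^3) (real n + 1)) = ennreal (measure lebesgue (cball (0::real^3) (real n + 1)))"
      using emeasure_bounded_finite[of "cball (0::real^3) (real n + 1)"]
      by (intro emeasure_eq_ennreal_measure) (simp add: top.not_eq_extremum infinity_ennreal_def)
    then show ?thesis using measure_cball_scale[of "real n + 1" 1] by (simp add: V_def)
  qed
  have "(\<integral>\<^sup>+x. ennreal (exp (- norm (x :: real^3))) \<partial>lebesgue) \<le> (\<integral>\<^sup>+x. (\<Sum>n. ?t n x) \<partial>lebesgue)"
    by (intro nn_integral_mono le)
  also have "\<dots> = (\<Sum>n. \<integral>\<^sup>+x. ?t n x \<partial>lebesgue)"
  proof (rule nn_integral_suminf)
    fix n
    have "(indicator (cball 0 (real n + 1)) :: real^3 \<Rightarrow> ennreal) \<in> borel_measurable lebesgue"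
      by (rule borel_measurable_indicator) auto
    then show "?t n \<in> borel_measurable lebesgue" by simp
  qed
  also have "\<dots> = (\<Sum>n. ennreal (exp (- real n) * (real n + 1) ^ 3 * V))"
  proof (rule suminf_cong)
    fix n
    have "(\<integral>\<^sup>+x. ?t n x \<partial>lebesgue) = ennreal (exp (- real n)) * emeasure lebesgue (cball (0::real^3) (real n + 1))"
      by (rule nn_integral_cmult_indicator) auto
    then show "(\<integral>\<^sup>+x. ?t n x \<partial>lebesgue) = ennreal (exp (- real n) * (real n + 1) ^ 3 * V)"
      unfolding em by (simp add: ennreal_mult'[symmetric] mult.assoc)
  qed
  also have "\<dots> = ennreal (\<Sum>n. exp (- real n) * (real n + 1) ^ 3 * V)"
    by (rule suminf_ennreal2) (auto simp: V_def intro: summable_mult2 summable_exp_cubic)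
  also have "\<dots> < \<infinity>" by simp
  finally show ?thesis .
qed

text \<open>Where \<open>|v| < exp (-|x|)\<close> the power \<open>9/2\<close> is integrable anyway; elsewhere the excess \<open>p - 9/2 \<le> C/|x|\<close>
  of the exponent costs at most the factor \<open>exp C\<close>.\<close>

lemma powr_nine_halves_le:
  fixes t p C r :: real
  assumes t: "0 \<le> t" and C: "0 \<le> C" and p: "9/2 \<le> p" and r: "0 < r" and pC: "p - 9/2 \<le> C / r"
  shows "t powr (9/2) \<le> exp C * t powr p + exp (- r)"
proof -
  consider "t < exp (- r)" | "exp (- r) \<le> t" "t < 1" | "1 \<le> t" by linarith
  then show ?thesis
  proof cases
    case 1
    have "t powr (9/2) \<le> exp (- r) powr (9/2)" using 1 t by (intro powr_mono2) auto
    also have "\<dots> = exp (- r * (9/2))" by (simp add: powr_def)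
    also have "\<dots> \<le> exp (- r)" using r by simp
    finally show ?thesis using C by (simp add: add_increasing)
  next
    case 2
    then have t0: "t > 0" using exp_gt_zero[of "- r"] by linarith
    have "t powr (9/2) = t powr p * t powr (9/2 - p)" using t0 by (simp flip: powr_add)
    also have "\<dots> \<le> t powr p * exp C"
    proof (rule mult_left_mono)
      have "t powr (9/2 - p) \<le> exp (- r) powr (9/2 - p)"
        using 2 p by (intro powr_mono2') auto
      also have "\<dots> = exp (r * (p - 9/2))" by (simp add: powr_def algebra_simps)
      also have "\<dots> \<le> exp C" using pC r by (simp add: field_simps)
      finally show "t powr (9/2 - p) \<le> exp C" .
    qed simp
    finally have "t powr (9/2) \<le> exp C * t powr p" by (simp add: mult.commute)
    then show ?thesis using exp_gt_zero[of "- r"] by linarith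
  next
    case 3
    have "t powr (9/2) \<le> t powr p" using 3 p by (intro powr_mono) auto
    also have "\<dots> \<le> exp C * t powr p" using C mult_right_mono[of 1 "exp C" "t powr p"] by simp
    finally show ?thesis using exp_gt_zero[of "- r"] by linarith
  qed
qed

lemma integrable_powr_nine_halves:
  fixes u :: "real^3 \<Rightarrow> real^3" and p :: "real^3 \<Rightarrow> real"
  assumes u6: "in_Lebesgue_space 6 u" and pm: "p \<in> borel_measurable lebesgue" and p: "\<And>x. 9/2 \<le> p x"
    and rho: "0 < \<rho>" and C: "0 \<le> C" "\<And>x. \<rho> \<le> norm x \<Longrightarrow> \<bar>p x - 9/2\<bar> \<le> C / norm x"
    and up: "in_var_Lebesgue_space UNIV p u"
  shows "integrable lebesgue (\<lambda>x. norm (u x) powr (9/2))"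
proof -
  have um: "(\<lambda>x. norm (u x)) \<in> borel_measurable lebesgue" and u6i: "integrable lebesgue (\<lambda>x. norm (u x) powr 6)"
    using u6 by (auto simp: in_Lebesgue_space_def)
  have "Inf (ereal ` {l. l > 0 \<and> (\<integral>\<^sup>+ x. ennreal (norm (u x /\<^sub>R l) powr p x) \<partial>lebesgue) \<le> 1}) < \<infinity>"
    using up by (simp add: in_var_Lebesgue_space_def var_Lebesgue_norm_def lebesgue_on_UNIV_eq)
  then obtain l where l: "l > 0" "(\<integral>\<^sup>+ x. ennreal (norm (u x /\<^sub>R l) powr p x) \<partial>lebesgue) \<le> 1"
    unfolding Inf_less_iff by auto
  define t where "t = (\<lambda>x. norm (u x) / l)"
  have t0: "0 \<le> t x" for x using l by (simp add: t_def)
  have tm: "t \<in> borel_measurable lebesgue" unfolding t_def using um by simp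
  have lt: "(\<integral>\<^sup>+ x. ennreal (t x powr p x) \<partial>lebesgue) \<le> 1"
    using l by (simp add: t_def divide_inverse mult.commute)
  have t6i: "integrable lebesgue (\<lambda>x. t x powr 6)"
    using l u6i by (simp add: t_def powr_divide)
  have le: "t x powr (9/2) \<le> exp C * t x powr p x + exp (- norm x) + (indicator (cball 0 \<rho>) x + t x powr 6)" for x
  proof (cases "norm x \<le> \<rho>")
    case True
    have "t x powr (9/2) \<le> 1 + t x powr 6"
    proof (cases "t x \<le> 1")
      case True
      then have "t x powr (9/2) \<le> 1 powr (9/2)" using t0[of x] by (intro powr_mono2) auto
      then show ?thesis by (simp add: add_increasing2)
    next
      case False
      then have "t x powr (9/2) \<le> t x powr 6" by (intro powr_mono) auto
      then show ?thesis by simp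
    qed
    moreover have "0 \<le> exp C * t x powr p x" "0 \<le> exp (- norm x)" by simp_all
    moreover have "indicator (cball 0 \<rho>) x = (1::real)" using True by simp
    ultimately show ?thesis by linarith
  next
    case False
    have "t x powr (9/2) \<le> exp C * t x powr p x + exp (- norm x)"
      using C(2)[of x] False rho by (intro powr_nine_halves_le t0 C(1) p) auto
    moreover have "0 \<le> t x powr 6" by simp
    moreover have "indicator (cball 0 \<rho>) x = (0::real)" using False by simp
    ultimately show ?thesis by linarith
  qed
  have pmeas: "(\<lambda>x. t x powr p x) \<in> borel_measurable lebesgue" using tm pm by simp
  have nmeas: "(\<lambda>x::real^3. exp (- norm x)) \<in> borel_measurable lebesgue"
    by (intro measurable_completion) simp
  have imeas: "(\<lambda>x::real^3. indicat_real (cball 0 \<rho>) x + t x powr 6) \<in> borel_measurable lebesgue"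
    by (intro borel_measurable_add borel_measurable_integrable[OF integrable_indicator_cball] borel_measurable_integrable[OF t6i])
  have ii: "integrable lebesgue (\<lambda>x. indicat_real (cball 0 \<rho>) x + t x powr 6)"
    by (intro Bochner_Integration.integrable_add integrable_indicator_cball t6i)
  have "integrable lebesgue (\<lambda>x. t x powr (9/2))"
  proof (rule integrableI_bounded)
    show "(\<lambda>x. t x powr (9/2)) \<in> borel_measurable lebesgue" using tm by simp
    have "(\<integral>\<^sup>+x. ennreal (norm (t x powr (9/2))) \<partial>lebesgue)
        \<le> (\<integral>\<^sup>+x. ennreal (exp C) * ennreal (t x powr p x) + ennreal (exp (- norm x)) + ennreal (indicator (cball 0 \<rho>) x + t x powr 6) \<partial>lebesgue)"
    proof (rule nn_integral_mono)
      fix x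
      have "ennreal (norm (t x powr (9/2))) \<le> ennreal (exp C * t x powr p x + exp (- norm x) + (indicator (cball 0 \<rho>) x + t x powr 6))"
        using le[of x] by (intro ennreal_leI) simp
      then show "ennreal (norm (t x powr (9/2))) \<le> ennreal (exp C) * ennreal (t x powr p x) + ennreal (exp (- norm x)) + ennreal (indicator (cball 0 \<rho>) x + t x powr 6)"
        by (simp add: ennreal_plus ennreal_mult)
    qed
    also have "\<dots> = ennreal (exp C) * (\<integral>\<^sup>+x. ennreal (t x powr p x) \<partial>lebesgue) + (\<integral>\<^sup>+x. ennreal (exp (- norm (x::real^3))) \<partial>lebesgue)
        + (\<integral>\<^sup>+x. ennreal (indicator (cball 0 \<rho>) x + t x powr 6) \<partial>lebesgue)"
    proof -
      note [measurable] = pmeas nmeas imeas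
      have "(\<integral>\<^sup>+x. ennreal (exp C) * ennreal (t x powr p x) + ennreal (exp (- norm x)) + ennreal (indicator (cball 0 \<rho>) x + t x powr 6) \<partial>lebesgue)
          = (\<integral>\<^sup>+x. ennreal (exp C) * ennreal (t x powr p x) + ennreal (exp (- norm x)) \<partial>lebesgue)
          + (\<integral>\<^sup>+x. ennreal (indicator (cball 0 \<rho>) x + t x powr 6) \<partial>lebesgue)"
        by (rule nn_integral_add) measurable
      also have "(\<integral>\<^sup>+x. ennreal (exp C) * ennreal (t x powr p x) + ennreal (exp (- norm x)) \<partial>lebesgue)
          = (\<integral>\<^sup>+x. ennreal (exp C) * ennreal (t x powr p x) \<partial>lebesgue) + (\<integral>\<^sup>+x. ennreal (exp (- norm (x::real^3))) \<partial>lebesgue)"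
        by (rule nn_integral_add) measurable
      also have "(\<integral>\<^sup>+x. ennreal (exp C) * ennreal (t x powr p x) \<partial>lebesgue) = ennreal (exp C) * (\<integral>\<^sup>+x. ennreal (t x powr p x) \<partial>lebesgue)"
        by (rule nn_integral_cmult) measurable
      finally show ?thesis .
    qed
    also have "\<dots> < \<infinity>"
    proof -
      have "ennreal (exp C) * (\<integral>\<^sup>+x. ennreal (t x powr p x) \<partial>lebesgue) \<le> ennreal (exp C) * 1"
        by (intro mult_left_mono lt) simp
      then have a: "ennreal (exp C) * (\<integral>\<^sup>+x. ennreal (t x powr p x) \<partial>lebesgue) < \<infinity>"
        by (rule le_less_trans) (simp add: ennreal_less_top)
      have c: "(\<integral>\<^sup>+x. ennreal (indicator (cball 0 \<rho>) x + t x powr 6) \<partial>lebesgue) < \<infinity>"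
        by (subst nn_integral_eq_integral[OF ii]) auto
      show ?thesis using a nn_integral_exp_norm_finite c by simp
    qed
    finally show "(\<integral>\<^sup>+x. ennreal (norm (t x powr (9/2))) \<partial>lebesgue) < \<infinity>" .
  qed
  then have "integrable lebesgue (\<lambda>x. l powr (9/2) * t x powr (9/2))" by (rule integrable_mult_right)
  moreover have "l powr (9/2) * t x powr (9/2) = norm (u x) powr (9/2)" for x
    using l by (simp add: t_def powr_divide)
  ultimately show ?thesis by simp
qed

section \<open>The Liouville theorem\<close>

lemma weak_gradient_unique:
  fixes u :: "real^3 \<Rightarrow> real^3"
  assumes "weak_gradient u G" "weak_gradient u H"
  shows "AE x in lebesgue. G x = H x"
proof -
  have "AE x in lebesgue. G x $ i $ j = H x $ i $ j" for i j
  proof -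
    have Gl: "locally_integrable (\<lambda>x. G x $ i $ j)" and Hl: "locally_integrable (\<lambda>x. H x $ i $ j)"
      using assms by (auto simp: weak_gradient_def)
    have "AE x in lebesgue. G x $ i $ j - H x $ i $ j = 0"
    proof (rule radial.test_function_orthogonal[OF locally_integrable_diff[OF Gl Hl]])
      fix \<phi> :: "real^3 \<Rightarrow> real" assume t: "test_function \<phi>"
      have "dist_of (\<lambda>x. G x $ i $ j) \<phi> = dist_of (\<lambda>x. H x $ i $ j) \<phi>"
        using assms t unfolding weak_gradient_def by metis
      then show "(LINT x|lebesgue. (G x $ i $ j - H x $ i $ j) * \<phi> x) = 0"
        using integrable_mult_test[OF Gl t] integrable_mult_test[OF Hl t]
        by (simp add: dist_of_def left_diff_distrib)
    qed
    then show ?thesis by eventually_elim simp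
  qed
  then show ?thesis unfolding vec_eq_iff AE_all_countable by blast
qed

lemma distribution_zero: "distribution P \<Longrightarrow> P (\<lambda>x. 0) = 0"
proof -
  assume P: "distribution P"
  have "\<forall>c \<phi>. test_function \<phi> \<longrightarrow> P (\<lambda>x. c * \<phi> x) = c * P \<phi>" using P by (simp add: distribution_def)
  from this[rule_format, OF test_function_zero, of 0] show ?thesis by simp
qed

lemma distribution_sum:
  assumes P: "distribution P" and "finite A" and "\<And>i. i \<in> A \<Longrightarrow> test_function (f i)"
  shows "P (\<lambda>x. \<Sum>i\<in>A. f i x) = (\<Sum>i\<in>A. P (f i))"
  using assms(2,3)
proof (induction A rule: finite_induct)
  case empty
  then show ?case by (simp add: distribution_zero[OF P])
next
  case (insert a A)
  have "P (\<lambda>x. f a x + (\<Sum>i\<in>A. f i x)) = P (f a) + P (\<lambda>x. \<Sum>i\<in>A. f i x)"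
    using P insert.prems insert.hyps test_function_sum[of A f] unfolding distribution_def by auto
  then show ?case using insert by simp
qed

theorem theorem1p2:
  fixes R\<^sub>0 :: real and u :: "real^3 \<Rightarrow> real^3" and p :: "real^3 \<Rightarrow> real"
  assumes "R\<^sub>0 > 1"
    and "homogeneous_H1 u"
    and "stationary_NS_solution u"
    and "variable_exponent UNIV p"
    and "\<forall>x\<in>ball 0 R\<^sub>0. p x = 6"
    and "\<exists>L. L-lipschitz_on UNIV p"
    and "radially_decreasing p"
    and "\<forall>x. p x \<ge> 9/2"
    and "\<exists>C. 0 \<le> C \<and> C < R\<^sub>0\<^sup>2 \<and> (\<forall>x. norm x \<ge> R\<^sub>0\<^sup>2 \<longrightarrow> \<bar>p x - 9/2\<bar> \<le> C / norm x)"
    and "in_var_Lebesgue_space UNIV p u"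
  shows "AE x in lebesgue. u x = 0"
proof -
  obtain C where C: "0 \<le> C" "\<And>x. norm x \<ge> R\<^sub>0\<^sup>2 \<Longrightarrow> \<bar>p x - 9/2\<bar> \<le> C / norm x" using assms(9) by auto
  have u6L: "in_Lebesgue_space 6 u" using assms(2) by (simp add: homogeneous_H1_def)
  obtain G where G: "weak_gradient u G" "in_Lebesgue_space 2 G" using assms(2) by (auto simp: homogeneous_H1_def)
  obtain H P where H: "weak_gradient u H" and P: "distribution P"
    and mom: "\<And>i \<phi>. test_function \<phi> \<Longrightarrow> - dist_laplacian (dist_of (\<lambda>x. u x $ i)) \<phi> + dist_of (\<lambda>x. (H x *v u x) $ i) \<phi> + dist_deriv i P \<phi> = 0"
    and dv: "\<And>\<phi>. test_function \<phi> \<Longrightarrow> (\<Sum>i\<in>UNIV. dist_deriv i (dist_of (\<lambda>x. u x $ i)) \<phi>) = 0"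
    using assms(3) unfolding stationary_NS_solution_def by blast
  have pm: "p \<in> borel_measurable lebesgue" using assms(4) by (simp add: variable_exponent_def lebesgue_on_UNIV_eq)
  have u92: "integrable lebesgue (\<lambda>x. norm (u x) powr (9/2))"
    by (rule integrable_powr_nine_halves[OF u6L pm _ _ C assms(10)]) (use assms(1,8) in auto)
  have u6: "integrable lebesgue (\<lambda>x. norm (u x) ^ 6)"
    using u6L by (simp add: in_Lebesgue_space_def powr_numeral)
  have um: "(\<lambda>x. u x $ i) \<in> borel_measurable lebesgue" for i
    using G(1) by (intro locally_integrable_measurable) (simp add: weak_gradient_def)
  have gm: "(\<lambda>x. F x $ i $ j) \<in> borel_measurable lebesgue" if "weak_gradient u F" for F i j
    using that by (intro locally_integrable_measurable) (simp add: weak_gradient_def)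
  have G2: "integrable lebesgue (\<lambda>x. (G x $ i $ j)\<^sup>2)" for i j
  proof (rule Bochner_Integration.integrable_bound)
    show "integrable lebesgue (\<lambda>x. (norm (G x))\<^sup>2)"
      using G(2) by (simp add: in_Lebesgue_space_def powr_numeral)
    show "(\<lambda>x. (G x $ i $ j)\<^sup>2) \<in> borel_measurable lebesgue" using gm[OF G(1)] by simp
    have "\<bar>G x $ i $ j\<bar> \<le> norm (G x)" for x
      using component_le_norm_cart[of "G x $ i" j] Finite_Cartesian_Product.norm_nth_le[of "G x" i] by linarith
    then have "\<bar>G x $ i $ j\<bar>\<^sup>2 \<le> (norm (G x))\<^sup>2" for x by (intro power_mono) auto
    then show "AE x in lebesgue. norm ((G x $ i $ j)\<^sup>2) \<le> norm ((norm (G x))\<^sup>2)" by simp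
  qed
  \<comment> \<open>the weak gradient in the equation is the square integrable one, almost everywhere\<close>
  interpret decaying_flow u G
  proof unfold_locales
    fix \<phi> :: "real^3 \<Rightarrow> real" assume "test_function \<phi>"
    then show "(\<Sum>i\<in>UNIV. LINT x|lebesgue. u x $ i * partial_deriv i \<phi> x) = 0"
      using dv[of \<phi>] by (simp add: dist_deriv_def dist_of_def sum_negf)
  next
    fix W :: "3 \<Rightarrow> real^3 \<Rightarrow> real"
    assume tW: "\<And>i. test_function (W i)" and dW: "\<And>x. (\<Sum>i\<in>UNIV. partial_deriv i (W i) x) = 0"
    have "(LINT x|lebesgue. (H x *v u x) $ i * W i x) = (LINT x|lebesgue. (G x *v u x) $ i * W i x)" for i
    proof (rule integral_cong_AE)
      have "(\<lambda>x. (F x *v u x) $ i * W i x) \<in> borel_measurable lebesgue" if "weak_gradient u F" for F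
        unfolding matrix_vector_mult_def vec_lambda_beta
        by (intro borel_measurable_times borel_measurable_sum gm[OF that] um smooth_lebesgue test_function_smooth tW)
      then show "(\<lambda>x. (H x *v u x) $ i * W i x) \<in> borel_measurable lebesgue"
        "(\<lambda>x. (G x *v u x) $ i * W i x) \<in> borel_measurable lebesgue" using H G(1) by blast+
      show "AE x in lebesgue. (H x *v u x) $ i * W i x = (G x *v u x) $ i * W i x"
        using weak_gradient_unique[OF H G(1)] by eventually_elim simp
    qed
    moreover have "- dist_laplacian (dist_of (\<lambda>x. u x $ i)) (W i) = (\<Sum>j\<in>UNIV. LINT x|lebesgue. G x $ i $ j * partial_deriv j (W i) x)" for i
      unfolding dist_laplacian_def dist_deriv_def dist_of_def
      by (simp add: weak_gradient_test[OF G(1) test_function_partial_deriv[OF tW]] sum_negf)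
    moreover have "(\<Sum>i\<in>UNIV. dist_deriv i P (W i)) = 0"
    proof -
      have "(\<Sum>i\<in>UNIV. P (partial_deriv i (W i))) = P (\<lambda>x. \<Sum>i\<in>UNIV. partial_deriv i (W i) x)"
        by (rule distribution_sum[OF P, symmetric]) (auto intro: test_function_partial_deriv tW)
      then show ?thesis by (simp add: dist_deriv_def sum_negf dW distribution_zero[OF P])
    qed
    moreover have "(\<Sum>i\<in>UNIV. - dist_laplacian (dist_of (\<lambda>x. u x $ i)) (W i) + dist_of (\<lambda>x. (H x *v u x) $ i) (W i) + dist_deriv i P (W i)) = 0"
      by (rule sum.neutral) (use mom tW in blast)
    ultimately show "(\<Sum>i\<in>UNIV. \<Sum>j\<in>UNIV. LINT x|lebesgue. G x $ i $ j * partial_deriv j (W i) x)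
      + (\<Sum>i\<in>UNIV. LINT x|lebesgue. (G x *v u x) $ i * W i x) = 0"
      by (simp add: sum.distrib dist_of_def)
  qed (fact G(1) G2 u6 u92)+
  show ?thesis by (rule flow_zero)
qed

end
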